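(* Under the setting below, $G_{10}$ is a plane $6$-spanner of the visibility graph $\mathrm{Vis}(V,S)$ in which every vertex has degree at most $10$.
   Context: Setting: $V$ is a finite set of points (vertices) in the plane and $S$ a finite set of simple polygonal obstacles, pairwise non-intersecting, all of whose corners lie in $V$; each vertex is a corner of at most one obstacle and occurs at most once on its boundary. General position: no three vertices collinear and no two vertices on a line parallel to a cone boundary ray. Points $p,q$ are visible if segment $pq$ does not properly intersect any obstacle (touching at vertices or running along boundaries is allowed, meeting an obstacle interior is not). $\mathrm{Vis}(V,S)$ is the graph on $V$ with an edge for every visible pair, weighted by Euclidean length; $d_G$ is shortest-path length, and a subgraph $H$ is a $t$-spanner of $G$ if $d_H(x,y)\le t\,d_G(x,y)$ for all $x,y$. Plane means no two edges properly cross. Cones: around each vertex $u$ the plane is partitioned into six cones of angle $\pi/3$ with apex $u$; $C_0^u$ has the upward vertical bisector, and counterclockwise the cones are $C_0^u,\overline{C_2^u},C_1^u,\overline{C_0^u},C_2^u,\overline{C_1^u}$ (positive cones $C_i$, negative cones $\overline{C_i}$). If the obstacle having $u$ as a corner splits a cone so that there are vertices visible from $u$ on both sides of the obstacle within it, the cone is regarded as two subcones; otherwise a single subcone. $G_\infty$: for every vertex $u$ and every positive subcone of $u$, add an edge from $u$ to the vertex visible from $u$ in that subcone whose orthogonal projection onto the cone's bisector is closest to $u$. The canonical sequence of a negative subcone of $u$ is the list of vertices adjacent to $u$ in $G_\infty$ lying in that subcone, in counterclockwise order around $u$; its canonical path consists of the segments joining consecutive vertices of this sequence. $G_{10}$ is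 the graph on $V$ whose edges are, for every vertex $u$ and every negative subcone of $u$: the edge from $u$ to the closest (smallest projection onto the cone's bisector) $G_\infty$-neighbour of $u$ in that subcone, and all edges of the canonical path of that subcone. *)

theory Defs
  imports "HOL-Analysis.Analysis"
begin

(* Points of the plane are complex numbers.  An obstacle is a simple polygon,
   given by the (cyclic) list of its corners. *)

definition poly_edge :: "complex list \<Rightarrow> nat \<Rightarrow> complex set" where
  "poly_edge P k = closed_segment (P ! k) (P ! (Suc k mod length P))"

definition poly_boundary :: "complex list \<Rightarrow> complex set" where
  "poly_boundary P = (\<Union>k<length P. poly_edge P k)"

definition simple_polygon :: "complex list \<Rightarrow> bool" where
  "simple_polygon P \<longleftrightarrow> length P \<ge> 3 \<and> distinct P \<and>
     (\<forall>k<length P. \<forall>l<length P. k \<noteq> l \<longrightarrow>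
        poly_edge P k \<inter> poly_edge P l =
          (if l = Suc k mod length P then {P ! l}
           else if k = Suc l mod length P then {P ! k} else {}))"

definition obstacle_interior :: "complex list \<Rightarrow> complex set" where
  "obstacle_interior P = inside (poly_boundary P)"

definition obstacle_region :: "complex list \<Rightarrow> complex set" where
  "obstacle_region P = poly_boundary P \<union> obstacle_interior P"

(* general position: no three vertices collinear, and no two vertices on a line
   parallel to a cone boundary ray (directions 0, pi/3, 2pi/3) *)
definition general_position :: "complex set \<Rightarrow> bool" where
  "general_position V \<longleftrightarrow>
     (\<forall>a\<in>V. \<forall>b\<in>V. \<forall>c\<in>V. a \<noteq> b \<and> a \<noteq> c \<and> b \<noteq> c \<longrightarrow> \<not> collinear {a, b, c}) \<and>
     (\<forall>p\<in>V. \<forall>q\<in>V. p \<noteq> q \<longrightarrow> (\<forall>k::nat<3. Im ((q - p) / cis (real k * pi / 3)) \<noteq> 0))"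

definition scene :: "complex set \<Rightarrow> complex list set \<Rightarrow> bool" where
  "scene V S \<longleftrightarrow> finite V \<and> finite S \<and>
     (\<forall>P\<in>S. simple_polygon P \<and> set P \<subseteq> V) \<and>
     (\<forall>P\<in>S. \<forall>Q\<in>S. P \<noteq> Q \<longrightarrow> obstacle_region P \<inter> obstacle_region Q = {}) \<and>
     (\<forall>P\<in>S. \<forall>Q\<in>S. P \<noteq> Q \<longrightarrow> set P \<inter> set Q = {}) \<and>
     general_position V"

definition visible :: "complex list set \<Rightarrow> complex \<Rightarrow> complex \<Rightarrow> bool" where
  "visible S p q \<longleftrightarrow> (\<forall>P\<in>S. closed_segment p q \<inter> obstacle_interior P = {})"

definition vis_edge :: "complex set \<Rightarrow> complex list set \<Rightarrow> complex \<Rightarrow> complex \<Rightarrow> bool" where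
  "vis_edge V S p q \<longleftrightarrow> p \<in> V \<and> q \<in> V \<and> p \<noteq> q \<and> visible S p q"

(* Cones: cone i (i < 6) of apex u consists of the directions with angle in
   [pi/3 + i*pi/3, pi/3 + (i+1)*pi/3).  Counterclockwise:
   i=0: C_0, i=1: neg C_2, i=2: C_1, i=3: neg C_0, i=4: C_2, i=5: neg C_1.
   Positive cones are those with even i, negative cones those with odd i. *)
definition in_cone :: "nat \<Rightarrow> complex \<Rightarrow> complex \<Rightarrow> bool" where
  "in_cone i u v \<longleftrightarrow> i < 6 \<and> v \<noteq> u \<and>
     0 \<le> Arg ((v - u) / cis (pi / 3 + real i * pi / 3)) \<and>
     Arg ((v - u) / cis (pi / 3 + real i * pi / 3)) < pi / 3"

(* orthogonal projection (signed length) of v - u onto the bisector of cone i *)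
definition cone_proj :: "nat \<Rightarrow> complex \<Rightarrow> complex \<Rightarrow> real" where
  "cone_proj i u v = Re ((v - u) / cis (pi / 2 + real i * pi / 3))"

(* The obstacle having u as a corner separates v and w (seen from u): some direction
   strictly between the rays uv and uw points (locally at u) into the obstacle. *)
definition splits :: "complex list set \<Rightarrow> complex \<Rightarrow> complex \<Rightarrow> complex \<Rightarrow> bool" where
  "splits S u v w \<longleftrightarrow> (\<exists>P\<in>S. u \<in> set P \<and>
     (\<exists>\<alpha>>0. \<exists>\<beta>>0. \<exists>\<epsilon>>0. \<forall>t. 0 < t \<and> t < \<epsilon> \<longrightarrow>
        u + t *\<^sub>R (\<alpha> *\<^sub>R (v - u) + \<beta> *\<^sub>R (w - u)) \<in> obstacle_interior P))"

definition same_subcone :: "complex set \<Rightarrow> complex list set \<Rightarrow> nat \<Rightarrow> complex \<Rightarrow> complex \<Rightarrow> complex \<Rightarrow> bool" where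
  "same_subcone V S i u v w \<longleftrightarrow> vis_edge V S u v \<and> vis_edge V S u w \<and>
     in_cone i u v \<and> in_cone i u w \<and> \<not> splits S u v w"

definition ginf_arc :: "complex set \<Rightarrow> complex list set \<Rightarrow> complex \<Rightarrow> complex \<Rightarrow> bool" where
  "ginf_arc V S u v \<longleftrightarrow> (\<exists>i<6. even i \<and> same_subcone V S i u v v \<and>
     (\<forall>w. same_subcone V S i u v w \<longrightarrow> cone_proj i u v \<le> cone_proj i u w))"

definition ginf_adj :: "complex set \<Rightarrow> complex list set \<Rightarrow> complex \<Rightarrow> complex \<Rightarrow> bool" where
  "ginf_adj V S u v \<longleftrightarrow> ginf_arc V S u v \<or> ginf_arc V S v u"

definition ccw :: "complex \<Rightarrow> complex \<Rightarrow> complex \<Rightarrow> bool" where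
  "ccw u v w \<longleftrightarrow> Im (cnj (v - u) * (w - u)) > 0"

definition g10_closest :: "complex set \<Rightarrow> complex list set \<Rightarrow> nat \<Rightarrow> complex \<Rightarrow> complex \<Rightarrow> bool" where
  "g10_closest V S i u v \<longleftrightarrow> i < 6 \<and> odd i \<and> ginf_adj V S u v \<and> same_subcone V S i u v v \<and>
     (\<forall>w. ginf_adj V S u w \<and> same_subcone V S i u v w \<longrightarrow> cone_proj i u v \<le> cone_proj i u w)"

definition canon_consec :: "complex set \<Rightarrow> complex list set \<Rightarrow> nat \<Rightarrow> complex \<Rightarrow> complex \<Rightarrow> complex \<Rightarrow> bool" where
  "canon_consec V S i u v w \<longleftrightarrow> i < 6 \<and> odd i \<and> ginf_adj V S u v \<and> ginf_adj V S u w \<and>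
     same_subcone V S i u v w \<and> ccw u v w \<and>
     \<not> (\<exists>x. ginf_adj V S u x \<and> same_subcone V S i u v x \<and> ccw u v x \<and> ccw u x w)"

definition g10 :: "complex set \<Rightarrow> complex list set \<Rightarrow> complex \<Rightarrow> complex \<Rightarrow> bool" where
  "g10 V S x y \<longleftrightarrow> (\<exists>u i. g10_closest V S i x y \<or> g10_closest V S i y x \<or>
                             canon_consec V S i u x y \<or> canon_consec V S i u y x)"

definition gpath :: "complex set \<Rightarrow> (complex \<Rightarrow> complex \<Rightarrow> bool) \<Rightarrow> complex list \<Rightarrow> bool" where
  "gpath V E xs \<longleftrightarrow> xs \<noteq> [] \<and> set xs \<subseteq> V \<and> (\<forall>k. Suc k < length xs \<longrightarrow> E (xs ! k) (xs ! Suc k))"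

definition path_len :: "complex list \<Rightarrow> real" where
  "path_len xs = (\<Sum>k<length xs - 1. dist (xs ! k) (xs ! Suc k))"

(* H is a t-spanner of G: d_H(x,y) <= t * d_G(x,y), phrased via paths
   (every G-path from x to y is matched by an H-path at most t times as long) *)
definition is_spanner :: "complex set \<Rightarrow> (complex \<Rightarrow> complex \<Rightarrow> bool) \<Rightarrow> (complex \<Rightarrow> complex \<Rightarrow> bool) \<Rightarrow> real \<Rightarrow> bool" where
  "is_spanner V G H t \<longleftrightarrow> (\<forall>xs. gpath V G xs \<longrightarrow>
     (\<exists>ys. gpath V H ys \<and> hd ys = hd xs \<and> last ys = last xs \<and> path_len ys \<le> t * path_len xs))"

definition plane_graph :: "(complex \<Rightarrow> complex \<Rightarrow> bool) \<Rightarrow> bool" where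
  "plane_graph E \<longleftrightarrow> (\<forall>a b c d. E a b \<and> E c d \<longrightarrow> open_segment a b \<inter> open_segment c d = {} \<or> {a, b} = {c, d})"

end

theory Submission
  imports Defs
begin

text \<open>
  The tool behind everything is an emptiness principle: if two sides of a triangle at \<open>p\<close> are
  unobstructed, no obstacle enters the triangle at \<open>p\<close>, and the triangle contains no vertex off the
  third side, then no obstacle meets it, since an obstacle edge would have to cross one of the
  two sides. Rotating a ray around a vertex until it hits the first vertex therefore produces new
  visible vertices inside any such triangle.

  Measuring points by their heights over the three cone bisectors, whose sum is zero, turns cones into
  sign patterns and makes all arguments symmetric in the three cones. If two arcs of the half-theta
  graph crossed, the emptiness principle at the crossing point would give the source of one
  of them a visible vertex closer than its target. In the same way the triangle spanned by two
  consecutive vertices of a canonical path and their common neighbour is empty, so adding all canonical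
  paths keeps the graph plane. Planarity confines the edges at a vertex: each positive cone accounts
  for at most two of them, each negative subcone for at most one, and an obstacle splits at most
  one negative cone, which gives 10. For the ratio, a visible pair is joined by arcs of total length at
  most twice its distance, by induction on the size of the cone triangle, and an arc is replaced by the
  closest edge and a part of the canonical path at the cost of a factor 3.
\<close>

section \<open>Polygons and their interiors\<close>

text \<open>Visible segments may touch obstacles, so free sides alone do not protect a triangle: an
  obstacle with a corner at the apex could fill the whole angle. Two kinds of apex are safe, namely
  a crossing point of two visible segments, which lies on no obstacle boundary, and a vertex whose
  obstacle does not split the angle.

  The ratio 6 is 2 times 3. The 2 compares the way along a side and the base of the cone triangle
  with the straight segment; the 3 comes from
  \<open>p + 3 * q \<le> 3 * sqrt (p^2 + p * q + q^2)\<close> for positive \<open>p\<close>,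
  \<open>q\<close>.

  For the 2, bounding a walk by the longer way round the cone triangle is not inductive: when the
  walk is cut at an intermediate vertex, the longer ways of the two legs may run on different sides,
  and then the bounds do not add up. Two one-sided bounds are proved along with it, one for a cone
  triangle without visible vertices on one side, the other for a target that is extreme in the
  direction of the base.\<close>

fun chain_path :: "complex list \<Rightarrow> real \<Rightarrow> complex" where
  "chain_path (a # b # c # xs) = linepath a b +++ chain_path (b # c # xs)"
| "chain_path xs = linepath (hd xs) (last xs)"

definition chain_seg :: "complex list \<Rightarrow> nat \<Rightarrow> complex set" where
  "chain_seg xs k = closed_segment (xs ! k) (xs ! Suc k)"

lemma pathstart_chain_path [simp]: "xs \<noteq> [] \<Longrightarrow> pathstart (chain_path xs) = hd xs"
  by (induction xs rule: chain_path.induct) auto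

lemma pathfinish_chain_path [simp]: "xs \<noteq> [] \<Longrightarrow> pathfinish (chain_path xs) = last xs"
  by (induction xs rule: chain_path.induct) auto

lemma path_image_chain_path:
  "length xs \<ge> 2 \<Longrightarrow> path_image (chain_path xs) = (\<Union>k<length xs - 1. chain_seg xs k)"
proof (induction xs rule: chain_path.induct)
  case (1 a b c xs)
  have "path_image (chain_path (a # b # c # xs))
      = closed_segment a b \<union> path_image (chain_path (b # c # xs))"
    by (simp add: path_image_join)
  also have "\<dots> = chain_seg (a # b # c # xs) 0 \<union> (\<Union>k<length (b # c # xs) - 1. chain_seg (a # b # c # xs) (Suc k))"
    using 1 by (simp add: chain_seg_def)
  also have "\<dots> = (\<Union>k<length (a # b # c # xs) - 1. chain_seg (a # b # c # xs) k)"
    by (simp add: lessThan_Suc_eq_insert_0 image_UN)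
  finally show ?case .
next
  case ("2_3" a b)
  then show ?case by (simp add: chain_seg_def lessThan_Suc_eq_insert_0)
qed auto

text \<open>The recursion of \<open>chain_path\<close> stops at two points rather than at one, so no
  constant piece is appended that would destroy injectivity.\<close>

lemma arc_chain_path:
  assumes "length xs \<ge> 2" "distinct xs"
    "\<And>k l. k < l \<Longrightarrow> Suc l < length xs \<Longrightarrow>
       chain_seg xs k \<inter> chain_seg xs l \<subseteq> (if l = Suc k then {xs ! l} else {})"
  shows "arc (chain_path xs)"
  using assms
proof (induction xs rule: chain_path.induct)
  case (1 a b c xs)
  let ?ys = "b # c # xs"
  have arc: "arc (chain_path ?ys)"
  proof (rule "1.IH")
    fix k l assume "k < l" "Suc l < length ?ys"
    then have "Suc k < Suc l" "Suc (Suc l) < length (a # ?ys)" by auto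
    from "1.prems"(3)[OF this]
    show "chain_seg ?ys k \<inter> chain_seg ?ys l \<subseteq> (if l = Suc k then {?ys ! l} else {})"
      by (simp only: chain_seg_def nth_Cons_Suc nat.inject)
  qed (use "1.prems" in auto)
  have "closed_segment a b \<inter> path_image (chain_path ?ys) \<subseteq> {b}"
  proof
    fix x assume x: "x \<in> closed_segment a b \<inter> path_image (chain_path ?ys)"
    then obtain k where k: "k < length ?ys - 1" "x \<in> chain_seg ?ys k"
      using path_image_chain_path[of ?ys] by auto
    then have "x \<in> chain_seg (a # ?ys) 0 \<inter> chain_seg (a # ?ys) (Suc k)"
      using x by (auto simp: chain_seg_def)
    with "1.prems"(3)[of 0 "Suc k"] k show "x \<in> {b}" by (auto split: if_splits)
  qed
  with arc "1.prems" show ?case by (auto intro!: arc_join)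
next
  case ("2_3" a b)
  then show ?case by (simp add: arc_linepath)
qed auto

text \<open>The Jordan curve theorem, which wants the boundary as a simple closed path. The closing
  edge is joined last and separately, because it meets the arc of all other edges at both of its
  ends instead of one.\<close>

lemma obstacle_frontier:
  assumes "simple_polygon P"
  shows "frontier (obstacle_interior P) = poly_boundary P"
proof -
  let ?n = "length P"
  have n: "?n \<ge> 3" and dist: "distinct P"
    and I: "\<And>k l. k < ?n \<Longrightarrow> l < ?n \<Longrightarrow> k \<noteq> l \<Longrightarrow> poly_edge P k \<inter> poly_edge P l =
          (if l = Suc k mod ?n then {P ! l}
           else if k = Suc l mod ?n then {P ! k} else {})"
    using assms unfolding simple_polygon_def by auto
  have ne: "P \<noteq> []" using n by auto
  have seg: "chain_seg P k = poly_edge P k" if "Suc k < ?n" for k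
    using that by (simp add: chain_seg_def poly_edge_def)
  have arc: "arc (chain_path P)"
  proof (rule arc_chain_path)
    fix k l assume kl: "k < l" "Suc l < ?n"
    then have "poly_edge P k \<inter> poly_edge P l = (if l = Suc k then {P ! l} else {})"
      using I[of k l] by auto
    with kl seg show "chain_seg P k \<inter> chain_seg P l \<subseteq> (if l = Suc k then {P ! l} else {})"
      by simp
  qed (use n dist in auto)
  have last: "last P = P ! (?n - 1)" and hd: "hd P = P ! 0"
    using ne by (auto simp: last_conv_nth hd_conv_nth)
  have lh: "last P \<noteq> hd P"
    using nth_eq_iff_index_eq[OF dist, of "?n - 1" 0] n last hd by fastforce
  have seglast: "closed_segment (last P) (hd P) = poly_edge P (?n - 1)"
  proof -
    have "Suc (?n - 1) mod ?n = 0" using n by (cases ?n) auto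
    then show ?thesis using last hd by (simp add: poly_edge_def)
  qed
  have img: "path_image (chain_path P) = (\<Union>k<?n - 1. poly_edge P k)"
    using path_image_chain_path[of P] n seg by auto
  have inter: "path_image (chain_path P) \<inter> closed_segment (last P) (hd P) \<subseteq> {hd P, last P}"
  proof
    fix x assume x: "x \<in> path_image (chain_path P) \<inter> closed_segment (last P) (hd P)"
    then obtain k where k: "k < ?n - 1" "x \<in> poly_edge P k" using img by auto
    then have "x \<in> poly_edge P k \<inter> poly_edge P (?n - 1)" using x seglast by auto
    moreover have s0: "Suc (?n - 1) mod ?n = 0" using n by (cases ?n) auto
    moreover have "poly_edge P k \<inter> poly_edge P (?n - 1) \<subseteq> {P ! (?n - 1), P ! 0}"
      using I[of k "?n - 1"] k n unfolding s0 by (auto split: if_splits)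
    ultimately show "x \<in> {hd P, last P}" by (auto simp: last hd)
  qed
  define c where "c = chain_path P +++ linepath (last P) (hd P)"
  have sp: "simple_path c" unfolding c_def
    using arc lh inter ne by (intro simple_path_join_loop) (auto simp: arc_linepath)
  have loop: "pathfinish c = pathstart c" using ne by (simp add: c_def)
  have "path_image c = (\<Union>k<?n - 1. poly_edge P k) \<union> poly_edge P (?n - 1)"
    using ne by (simp add: c_def path_image_join img seglast)
  also have "\<dots> = (\<Union>k\<in>insert (?n - 1) {..<?n - 1}. poly_edge P k)" by blast
  also have "insert (?n - 1) {..<?n - 1} = {..<?n}" using n by auto
  finally have "path_image c = poly_boundary P" by (simp add: poly_boundary_def)
  with Jordan_inside_outside[OF sp loop] show ?thesis
    by (simp add: obstacle_interior_def)
qed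

lemma compact_poly_edge: "compact (poly_edge P k)"
  by (simp add: poly_edge_def)

lemma closed_poly_boundary: "closed (poly_boundary P)"
  unfolding poly_boundary_def by (intro closed_UN) (auto simp: compact_poly_edge compact_imp_closed)

lemma open_obstacle_interior: "open (obstacle_interior P)"
  unfolding obstacle_interior_def by (rule open_inside[OF closed_poly_boundary])

lemma obstacle_interior_disjoint_boundary: "obstacle_interior P \<inter> poly_boundary P = {}"
  unfolding obstacle_interior_def by simp

text \<open>How local information spreads: a half-disc, sector or triangle that avoids the boundary
  is interior as soon as one of its points is.\<close>

lemma connected_subset_obstacle_interior:
  assumes "connected C" "C \<inter> poly_boundary P = {}" "x \<in> C" "x \<in> obstacle_interior P"
  shows "C \<subseteq> obstacle_interior P"
proof
  fix y assume "y \<in> C"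
  with assms have "connected_component (- poly_boundary P) x y"
    unfolding connected_component_def by (intro exI[of _ C]) auto
  with assms(4) show "y \<in> obstacle_interior P"
    unfolding obstacle_interior_def by (rule inside_same_component[rotated])
qed

lemma closure_obstacle_interior:
  assumes "simple_polygon P"
  shows "closure (obstacle_interior P) = obstacle_interior P \<union> poly_boundary P"
  using obstacle_frontier[OF assms] closure_Un_frontier[of "obstacle_interior P"] by simp

section \<open>Cross products and planar coordinates\<close>

definition cr :: "complex \<Rightarrow> complex \<Rightarrow> real" where
  "cr a b = Im (cnj a * b)"

lemma cr_eq: "cr a b = Re a * Im b - Im a * Re b"
  by (simp add: cr_def)

lemma cr_simps [simp]:
  "cr a (b + c) = cr a b + cr a c" "cr (b + c) a = cr b a + cr c a"
  "cr a (b - c) = cr a b - cr a c" "cr (b - c) a = cr b a - cr c a"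
  "cr a (x *\<^sub>R b) = x * cr a b" "cr (x *\<^sub>R b) a = x * cr b a"
  "cr a (- b) = - cr a b" "cr (- b) a = - cr b a"
  "cr a a = 0" "cr a 0 = 0" "cr 0 a = 0"
  by (auto simp: cr_eq algebra_simps)

lemma cr_commute: "cr a b = - cr b a"
  by (simp add: cr_eq)

text \<open>Cramer's rule for two vectors that are not parallel.\<close>

lemma cr_expand:
  assumes "cr a b \<noteq> 0"
  shows "z = (cr z b / cr a b) *\<^sub>R a + (cr a z / cr a b) *\<^sub>R b"
proof -
  have "cr a b *\<^sub>R z = (cr z b) *\<^sub>R a + (cr a z) *\<^sub>R b"
    by (simp add: complex_eq_iff cr_eq algebra_simps)
  then have "(1 / cr a b) *\<^sub>R (cr a b *\<^sub>R z) = (1 / cr a b) *\<^sub>R ((cr z b) *\<^sub>R a + (cr a z) *\<^sub>R b)"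
    by simp
  with assms show ?thesis by (simp add: scaleR_add_right)
qed

lemma cr_coords_unique:
  assumes "cr a b \<noteq> 0" "x *\<^sub>R a + y *\<^sub>R b = x' *\<^sub>R a + y' *\<^sub>R b"
  shows "x = x'" "y = y'"
proof -
  have "cr (x *\<^sub>R a + y *\<^sub>R b) b = cr (x' *\<^sub>R a + y' *\<^sub>R b) b"
       "cr a (x *\<^sub>R a + y *\<^sub>R b) = cr a (x' *\<^sub>R a + y' *\<^sub>R b)" using assms by simp_all
  with assms(1) show "x = x'" "y = y'" by simp_all
qed

lemma convex_cr_gt: "convex {z. c < cr a z}"
proof -
  have "linear (cr a)" by (intro linearI) auto
  then have "convex (cr a -` {c<..})" by (intro convex_linear_vimage) auto
  then show ?thesis by (simp add: vimage_def)
qed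

text \<open>Sectors and triangles are handled below as images of convex sets of coordinate pairs;
  this is where their connectedness comes from.\<close>

lemma convex_param_image:
  fixes u d n :: complex
  assumes "convex T"
  shows "convex ((\<lambda>x. u + fst x *\<^sub>R d + snd x *\<^sub>R n) ` T)"
proof -
  have "linear (\<lambda>x::real\<times>real. fst x *\<^sub>R d + snd x *\<^sub>R n)"
    by (intro linearI) (auto simp: algebra_simps)
  then have "convex ((\<lambda>x. fst x *\<^sub>R d + snd x *\<^sub>R n) ` T)"
    using assms by (rule convex_linear_image)
  then have "convex ((+) u ` ((\<lambda>x. fst x *\<^sub>R d + snd x *\<^sub>R n) ` T))"
    by (rule convex_translation)
  then show ?thesis by (simp add: image_image add.assoc)
qed

lemma convex_linear_gt:
  fixes f :: "real \<times> real \<Rightarrow> real"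
  assumes "linear f"
  shows "convex {x. c < f x}" "convex {x. c \<le> f x}"
  using convex_linear_vimage[OF assms, of "{c<..}"] convex_linear_vimage[OF assms, of "{c..}"]
  by (simp_all add: vimage_def)

section \<open>Obstacles near their edges and corners\<close>

lemma open_segment_param:
  fixes a b :: complex
  assumes "q \<in> open_segment a b"
  obtains s where "0 < s" "s < 1" "q = a + s *\<^sub>R (b - a)" "a \<noteq> b"
  using assms by (auto simp: in_segment algebra_simps)

lemma closed_segment_param:
  fixes a b :: complex
  assumes "q \<in> closed_segment a b"
  obtains s where "0 \<le> s" "s \<le> 1" "q = a + s *\<^sub>R (b - a)"
  using assms by (auto simp: in_segment algebra_simps)

lemma open_segment_paramI:
  fixes a b :: complex
  assumes "0 < s" "s < 1" "a \<noteq> b"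
  shows "a + s *\<^sub>R (b - a) \<in> open_segment a b"
  using assms by (auto simp: in_segment algebra_simps intro!: exI[of _ s])

lemma closed_segment_paramI:
  fixes a b :: complex
  assumes "0 \<le> s" "s \<le> 1"
  shows "a + s *\<^sub>R (b - a) \<in> closed_segment a b"
  using assms by (auto simp: in_segment algebra_simps intro!: exI[of _ s])

text \<open>Near an inner point of an edge the boundary is that edge alone, so each half-disc is
  wholly inside or wholly outside. One is inside because the edge belongs to the frontier; which one
  depends on the orientation of the corner list and is left open.\<close>

lemma edge_local_side:
  assumes P: "simple_polygon P" and k: "k < length P" and e: "poly_edge P k = closed_segment a b"
    and q: "q \<in> open_segment a b"
  obtains r where "r > 0"
    "(\<forall>z. dist q z < r \<and> cr (b - a) (z - q) > 0 \<longrightarrow> z \<in> obstacle_interior P) \<or>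
     (\<forall>z. dist q z < r \<and> cr (b - a) (z - q) < 0 \<longrightarrow> z \<in> obstacle_interior P)"
proof -
  let ?I = "obstacle_interior P"
  define K where "K = (\<Union>l\<in>{..<length P} - {k}. poly_edge P l)"
  have ends: "{a, b} = {P ! k, P ! (Suc k mod length P)}"
    using e by (auto simp: poly_edge_def closed_segment_eq doubleton_eq_iff)
  obtain s where s: "0 < s" "s < 1" "q = a + s *\<^sub>R (b - a)" "a \<noteq> b"
    using q by (rule open_segment_param)
  have qab: "q \<noteq> a" "q \<noteq> b" "q \<in> closed_segment a b" using q by (auto simp: open_segment_def)
  have "q \<notin> K"
  proof
    assume "q \<in> K"
    then obtain l where l: "l < length P" "l \<noteq> k" "q \<in> poly_edge P l" by (auto simp: K_def)
    then have "q \<in> poly_edge P k \<inter> poly_edge P l" using qab e by auto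
    moreover have "poly_edge P k \<inter> poly_edge P l =
          (if l = Suc k mod length P then {P ! l}
           else if k = Suc l mod length P then {P ! k} else {})"
      using P k l unfolding simple_polygon_def by metis
    ultimately have "q \<in> {P ! k, P ! (Suc k mod length P)}" by (auto split: if_splits)
    with ends qab show False by blast
  qed
  moreover have "closed K" unfolding K_def
    by (intro closed_UN) (auto simp: compact_poly_edge compact_imp_closed)
  ultimately obtain r where r: "r > 0" "ball q r \<inter> K = {}"
    by (metis Compl_iff open_Compl open_contains_ball disjoint_eq_subset_Compl inf_commute)
  have bd: "cr (b - a) (z - q) = 0" if "z \<in> ball q r" "z \<in> poly_boundary P" for z
  proof -
    from that r have "z \<in> poly_edge P k" by (auto simp: poly_boundary_def K_def)
    then obtain s' where "z = a + s' *\<^sub>R (b - a)" using e closed_segment_param by metis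
    with s show ?thesis by simp
  qed
  \<comment> \<open>The factor \<open>c\<close> is 1 or -1 in use and selects the half-disc, so both
    sides are treated at once.\<close>
  have side: "\<forall>z. dist q z < r \<and> c * cr (b - a) (z - q) > 0 \<longrightarrow> z \<in> ?I"
    if z0: "dist q z0 < r" "c * cr (b - a) (z0 - q) > 0" "z0 \<in> ?I" for z0 c
  proof -
    let ?H = "ball q r \<inter> {z. cr (c *\<^sub>R (b - a)) q < cr (c *\<^sub>R (b - a)) z}"
    have "connected ?H" by (intro convex_connected convex_Int convex_cr_gt convex_ball)
    moreover have "?H \<inter> poly_boundary P = {}" using bd by force
    moreover have "z0 \<in> ?H" using z0 by (simp add: algebra_simps)
    ultimately have "?H \<subseteq> ?I" using z0(3) connected_subset_obstacle_interior by blast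
    then show ?thesis by (auto simp: algebra_simps)
  qed
  have "q \<in> poly_boundary P" using qab k e by (auto simp: poly_boundary_def)
  then have "q \<in> closure ?I" using closure_obstacle_interior[OF P] by auto
  then obtain z1 where z1: "z1 \<in> ?I" "dist z1 q < r" using r(1) closure_approachable by blast
  have "open (?I \<inter> ball q r)" using open_obstacle_interior by (intro open_Int) auto
  then obtain d where d: "d > 0" "ball z1 d \<subseteq> ?I \<inter> ball q r"
    using z1 open_contains_ball by (metis IntI mem_ball dist_commute)
  \<comment> \<open>A displacement perpendicular to the edge and short enough to stay in the ball
    around \<open>z1\<close>; it moves \<open>z1\<close> off the line in case it lies on it.\<close>
  define m where "m = (d / 2 / norm (b - a)) *\<^sub>R (\<i> * (b - a))"
  have "norm m = d / 2" using s(4) d by (simp add: m_def norm_mult)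
  moreover have "cr (b - a) m > 0"
  proof -
    have "cr x (\<i> * x) = (norm x)\<^sup>2" for x
      using cmod_power2[of x] by (simp add: cr_eq power2_eq_square)
    then have "cr (b - a) m = (d / 2 / norm (b - a)) * ((norm (b-a))\<^sup>2)"
      unfolding m_def by (simp only: cr_simps(5))
    then show ?thesis using d s(4) by simp
  qed
  ultimately obtain z0 where z0: "z0 \<in> ?I" "dist q z0 < r" "cr (b - a) (z0 - q) \<noteq> 0"
  proof (cases "cr (b - a) (z1 - q) = 0")
    case True
    have "z1 + m \<in> ball z1 d" using \<open>norm m = d / 2\<close> d by (simp add: dist_norm)
    then have "z1 + m \<in> ?I" "dist q (z1 + m) < r" using d by auto
    moreover have "cr (b - a) (z1 + m - q) \<noteq> 0" using True \<open>cr (b - a) m > 0\<close> by simp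
    ultimately show ?thesis using that by blast
  next
    case False
    then show ?thesis using that z1 by (metis dist_commute)
  qed
  show thesis
  proof (cases "cr (b - a) (z0 - q) > 0")
    case True
    then show thesis using that[OF r(1)] side[of z0 1] z0 by simp
  next
    case False
    then show thesis using that[OF r(1)] side[of z0 "-1"] z0 by simp
  qed
qed

text \<open>A transversal segment visits both half-discs at the crossing point, so it meets
  whichever of them is interior.\<close>

lemma crossing_edge_meets_interior:
  assumes P: "simple_polygon P" and k: "k < length P" and e: "poly_edge P k = closed_segment a b"
    and q: "q \<in> open_segment a b" "q \<in> open_segment x y" and tr: "cr (b - a) (y - x) \<noteq> 0"
  shows "open_segment x y \<inter> obstacle_interior P \<noteq> {}"
proof -
  obtain r where r: "r > 0"
    "(\<forall>z. dist q z < r \<and> cr (b - a) (z - q) > 0 \<longrightarrow> z \<in> obstacle_interior P) \<or>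
     (\<forall>z. dist q z < r \<and> cr (b - a) (z - q) < 0 \<longrightarrow> z \<in> obstacle_interior P)"
    using edge_local_side[OF P k e q(1)] by blast
  obtain s where s: "0 < s" "s < 1" "q = x + s *\<^sub>R (y - x)" "x \<noteq> y"
    using q(2) by (rule open_segment_param)
  have "0 < min (min s (1 - s)) (r / norm (y - x))" using s r(1) by simp
  then obtain \<epsilon> where "0 < \<epsilon>" "\<epsilon> < min (min s (1 - s)) (r / norm (y - x))" using dense by blast
  then have eps: "\<epsilon> > 0" "\<epsilon> < s" "\<epsilon> < 1 - s" "\<epsilon> < r / norm (y - x)" by simp_all
  then have eps4: "\<epsilon> * norm (y - x) < r" using s(4) by (simp add: field_simps)
  have mem: "q + c *\<^sub>R (y - x) \<in> open_segment x y" "dist q (q + c *\<^sub>R (y - x)) < r"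
    if "c = \<epsilon> \<or> c = - \<epsilon>" for c
  proof -
    have "q + c *\<^sub>R (y - x) = x + (s + c) *\<^sub>R (y - x)" using s by (simp add: algebra_simps)
    moreover have "x + (s + c) *\<^sub>R (y - x) \<in> open_segment x y"
      using open_segment_paramI[of "s + c" x y] that eps s by auto
    ultimately show "q + c *\<^sub>R (y - x) \<in> open_segment x y" by simp
    show "dist q (q + c *\<^sub>R (y - x)) < r" using that eps eps4 by (auto simp: dist_norm)
  qed
  have cv: "cr (b - a) (q + c *\<^sub>R (y - x) - q) = c * cr (b - a) (y - x)" for c by simp
  have "\<exists>c. (c = \<epsilon> \<or> c = - \<epsilon>) \<and> q + c *\<^sub>R (y - x) \<in> obstacle_interior P"
  proof (cases "cr (b - a) (y - x) > 0")
    case True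
    then have "\<epsilon> * cr (b - a) (y - x) > 0" "- \<epsilon> * cr (b - a) (y - x) < 0" using eps by auto
    then show ?thesis using r(2) mem(2)[of \<epsilon>] mem(2)[of "- \<epsilon>"] cv[of \<epsilon>] cv[of "- \<epsilon>"] by metis
  next
    case False
    with tr have "cr (b - a) (y - x) < 0" by simp
    then have "\<epsilon> * cr (b - a) (y - x) < 0" "- \<epsilon> * cr (b - a) (y - x) > 0"
      using eps by (auto simp: mult_pos_neg mult_neg_neg)
    then show ?thesis using r(2) mem(2)[of \<epsilon>] mem(2)[of "- \<epsilon>"] cv[of \<epsilon>] cv[of "- \<epsilon>"] by metis
  qed
  then show ?thesis using mem(1) by blast
qed

text \<open>The local picture at a corner. The names \<open>b\<close> and \<open>c\<close> carry no
  order for the user; the proof takes the successor and the predecessor of \<open>u\<close> in the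
  cyclic list.\<close>

lemma corner_edges:
  assumes P: "simple_polygon P" and u: "u \<in> set P"
  obtains b c k l r where "b \<in> set P" "c \<in> set P" "b \<noteq> c" "b \<noteq> u" "c \<noteq> u"
    "k < length P" "poly_edge P k = closed_segment u b"
    "l < length P" "poly_edge P l = closed_segment u c"
    "closed_segment u b \<inter> closed_segment u c = {u}"
    "\<And>j. j < length P \<Longrightarrow> u \<in> poly_edge P j \<Longrightarrow> j = k \<or> j = l"
    "r > 0" "ball u r \<inter> poly_boundary P \<subseteq> closed_segment u b \<union> closed_segment u c"
proof -
  let ?n = "length P"
  have n: "?n \<ge> 3" and dist: "distinct P"
    and I: "\<And>k l. k < ?n \<Longrightarrow> l < ?n \<Longrightarrow> k \<noteq> l \<Longrightarrow> poly_edge P k \<inter> poly_edge P l =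
          (if l = Suc k mod ?n then {P ! l}
           else if k = Suc l mod ?n then {P ! k} else {})"
    using P unfolding simple_polygon_def by auto
  obtain k where k: "k < ?n" "P ! k = u" using u by (auto simp: in_set_conv_nth)
  define l where "l = (if k = 0 then ?n - 1 else k - 1)"
  define m where "m = Suc k mod ?n"
  have l: "l < ?n" using n k by (auto simp: l_def)
  have sl: "Suc l mod ?n = k" using n k by (cases k) (auto simp: l_def)
  have l_unique: "j = l" if "j < ?n" "Suc j mod ?n = k" for j
    using that n by (cases "Suc j = ?n") (auto simp: l_def)
  have m: "m < ?n" "m = (if Suc k = ?n then 0 else Suc k)" unfolding m_def using n k by (auto intro!: mod_less_divisor)
  have neq: "m \<noteq> k" "l \<noteq> k" "m \<noteq> l" using n k m(2) by (auto simp: l_def split: if_splits)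
  have ek: "poly_edge P k = closed_segment u (P ! m)" using k by (simp add: poly_edge_def m_def)
  have el: "poly_edge P l = closed_segment u (P ! l)"
    using k sl by (simp add: poly_edge_def closed_segment_commute)
  have only: "j = k \<or> j = l" if j: "j < ?n" "u \<in> poly_edge P j" for j
  proof (rule ccontr)
    assume "\<not> (j = k \<or> j = l)"
    then have jk: "j \<noteq> k" "k \<noteq> j" "j \<noteq> l" by auto
    have "u \<in> poly_edge P k \<inter> poly_edge P j" using j ek by auto
    then have "u = P ! j" using I[OF k(1) j(1) jk(2)] l_unique[OF j(1)] jk
      by (auto split: if_splits)
    with k j jk dist show False by (simp add: nth_eq_iff_index_eq)
  qed
  define K where "K = (\<Union>j\<in>{..<?n} - {k, l}. poly_edge P j)"
  have "u \<notin> K" using only by (auto simp: K_def)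
  moreover have "closed K" unfolding K_def
    by (intro closed_UN) (auto simp: compact_poly_edge compact_imp_closed)
  ultimately obtain r where r: "r > 0" "ball u r \<inter> K = {}"
    by (metis Compl_iff open_Compl open_contains_ball disjoint_eq_subset_Compl inf_commute)
  have "ball u r \<inter> poly_boundary P \<subseteq> poly_edge P k \<union> poly_edge P l"
    using r(2) by (auto simp: K_def poly_boundary_def)
  moreover have "poly_edge P k \<inter> poly_edge P l = {u}"
    using I[OF k(1) l] neq sl k m_def by auto
  moreover have "P ! m \<noteq> P ! l" "P ! m \<noteq> u" "P ! l \<noteq> u"
    using k l m neq dist by (auto simp: nth_eq_iff_index_eq)
  ultimately show thesis
    using that[of "P ! m" "P ! l" k l r] k l m ek el only r by auto
qed

text \<open>One side of the edge is interior close to an inner point of it. A wedge around the edge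
  that is thin enough to stay in the angle and to avoid the other edge at \<open>u\<close> carries
  this back to \<open>u\<close>, so a whole direction of the wedge points into the obstacle.\<close>

lemma edge_in_cone_splits:
  assumes P: "simple_polygon P" and u: "u \<in> set P" and S: "P \<in> S"
    and k: "k < length P" and e: "poly_edge P k = closed_segment u b"
    and dir: "b - u = \<alpha> *\<^sub>R (v - u) + \<beta> *\<^sub>R (w - u)" "\<alpha> > 0" "\<beta> > 0"
    and nc: "cr (v - u) (w - u) \<noteq> 0"
  shows "splits S u v w"
proof -
  let ?I = "obstacle_interior P"
  have ucb: "\<exists>c r. c \<noteq> u \<and> closed_segment u b \<inter> closed_segment u c = {u} \<and> r > 0 \<and>
    ball u r \<inter> poly_boundary P \<subseteq> closed_segment u b \<union> closed_segment u c"
  proof (rule corner_edges[OF P u])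
    fix b' c k' l r
    assume h: "b' \<noteq> u" "c \<noteq> u" "k' < length P" "poly_edge P k' = closed_segment u b'"
      "l < length P" "poly_edge P l = closed_segment u c"
      "closed_segment u b' \<inter> closed_segment u c = {u}"
      "\<And>j. j < length P \<Longrightarrow> u \<in> poly_edge P j \<Longrightarrow> j = k' \<or> j = l"
      "r > 0" "ball u r \<inter> poly_boundary P \<subseteq> closed_segment u b' \<union> closed_segment u c"
    from h(8)[OF k] e have "k = k' \<or> k = l" by auto
    then show ?thesis
    proof
      assume "k = k'"
      with h e have "closed_segment u b = closed_segment u b'" by simp
      then have "b = b'" by (auto simp: closed_segment_eq doubleton_eq_iff)
      with h show ?thesis by (intro exI[of _ c] exI[of _ r]) simp
    next
      assume "k = l"
      with h e have "closed_segment u b = closed_segment u c" by simp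
      then have "b = c" by (auto simp: closed_segment_eq doubleton_eq_iff)
      with h show ?thesis by (intro exI[of _ b'] exI[of _ r]) auto
    qed
  qed
  then obtain c r where c: "c \<noteq> u" "closed_segment u b \<inter> closed_segment u c = {u}"
    and r: "r > 0" "ball u r \<inter> poly_boundary P \<subseteq> closed_segment u b \<union> closed_segment u c"
    by blast
  define d where "d = b - u"
  define n where "n = v - u"
  have "cr d n = \<beta> * cr (w - u) (v - u)"
    unfolding d_def n_def dir(1) by (simp only: cr_simps(2,6,9))
  then have dn: "cr d n \<noteq> 0" using nc dir(3) cr_commute[of "v - u" "w - u"] by simp
  have bu: "b \<noteq> u" using dn by (auto simp: d_def)
  define p q where "p = cr (c - u) n / cr d n" and "q = cr d (c - u) / cr d n"
  have cu: "c - u = p *\<^sub>R d + q *\<^sub>R n" unfolding p_def q_def by (rule cr_expand[OF dn])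
  \<comment> \<open>Slope bounding the wedge in coordinates along \<open>d\<close> and
    \<open>n\<close>. It is at most \<open>\<alpha>\<close>, so that tilting by
    \<open>s0 / 2\<close> keeps the coefficient of \<open>v - u\<close> positive, and at most |q| /
    p where this matters, so that the other edge stays outside.\<close>
  define s0 where "s0 = (if p > 0 \<and> q \<noteq> 0 then min \<alpha> (\<bar>q\<bar> / p) else \<alpha>)"
  have s0: "s0 > 0" "s0 \<le> \<alpha>" using dir by (auto simp: s0_def)
  have avoid: "\<not> (p > 0 \<and> \<bar>q\<bar> < s0 * p)"
  proof
    assume h: "p > 0 \<and> \<bar>q\<bar> < s0 * p"
    show False
    proof (cases "q = 0")
      case True
      define m where "m = min 1 (1 / p)"
      have m: "0 < m" "m \<le> 1" "m * p \<le> 1" using h by (auto simp: m_def min_def field_simps)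
      have "u + m *\<^sub>R (c - u) \<in> closed_segment u c" using m by (intro closed_segment_paramI) auto
      moreover have "u + m *\<^sub>R (c - u) = u + (m * p) *\<^sub>R (b - u)" using cu True by (simp add: d_def)
      moreover have "u + (m * p) *\<^sub>R (b - u) \<in> closed_segment u b"
        using m h by (intro closed_segment_paramI) auto
      ultimately have "u + m *\<^sub>R (c - u) \<in> closed_segment u b \<inter> closed_segment u c" by simp
      then have "u + m *\<^sub>R (c - u) = u" unfolding c(2) by simp
      then show False using m c(1) by simp
    next
      case False
      then have "s0 \<le> \<bar>q\<bar> / p" using h by (simp add: s0_def)
      then show False using h by (simp add: field_simps)
    qed
  qed
  have nd: "norm d + s0 * norm n > 0" using bu s0 by (simp add: d_def add_pos_nonneg)
  have "0 < min 1 (r / (norm d + s0 * norm n))" using nd r by simp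
  then obtain \<tau>0 where "0 < \<tau>0" "\<tau>0 < min 1 (r / (norm d + s0 * norm n))" using dense by blast
  then have "\<tau>0 > 0" "\<tau>0 \<le> 1" "\<tau>0 \<le> r / (norm d + s0 * norm n)" by simp_all
  then have t0: "\<tau>0 > 0" "\<tau>0 \<le> 1" "\<tau>0 * (norm d + s0 * norm n) \<le> r"
    using nd by (simp_all add: pos_le_divide_eq)
  have clear: "u + \<tau> *\<^sub>R d + \<sigma> *\<^sub>R n \<notin> poly_boundary P"
    if ts: "0 < \<tau>" "\<tau> < \<tau>0" "\<sigma> \<noteq> 0" "\<bar>\<sigma>\<bar> < s0 * \<tau>" for \<tau> \<sigma>
  proof
    let ?z = "u + \<tau> *\<^sub>R d + \<sigma> *\<^sub>R n"
    assume z: "?z \<in> poly_boundary P"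
    have "norm (\<tau> *\<^sub>R d + \<sigma> *\<^sub>R n) \<le> \<tau> * norm d + \<bar>\<sigma>\<bar> * norm n"
      using norm_triangle_ineq[of "\<tau> *\<^sub>R d" "\<sigma> *\<^sub>R n"] ts by simp
    also have "\<dots> \<le> \<tau> * norm d + (s0 * \<tau>) * norm n"
      using ts by (intro add_mono mult_right_mono) auto
    also have "\<dots> = \<tau> * (norm d + s0 * norm n)" by (simp add: algebra_simps)
    also have "\<dots> < \<tau>0 * (norm d + s0 * norm n)" using ts nd by (intro mult_strict_right_mono) auto
    also have "\<dots> \<le> r" by (rule t0)
    finally have "norm (\<tau> *\<^sub>R d + \<sigma> *\<^sub>R n) < r" .
    moreover have "dist u ?z = norm (\<tau> *\<^sub>R d + \<sigma> *\<^sub>R n)"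
      by (metis add.assoc add_diff_cancel_left' dist_commute dist_norm)
    ultimately have "?z \<in> ball u r" by simp
    with z r have "?z \<in> closed_segment u b \<or> ?z \<in> closed_segment u c" by auto
    then show False
    proof
      assume "?z \<in> closed_segment u b"
      then obtain s where "?z = u + s *\<^sub>R (b - u)" by (rule closed_segment_param)
      then have "\<tau> *\<^sub>R d + \<sigma> *\<^sub>R n = s *\<^sub>R d + 0 *\<^sub>R n" by (simp add: d_def)
      then show False using cr_coords_unique[OF dn] ts by blast
    next
      assume "?z \<in> closed_segment u c"
      then obtain s where s: "0 \<le> s" "?z = u + s *\<^sub>R (c - u)" by (rule closed_segment_param)
      then have "\<tau> *\<^sub>R d + \<sigma> *\<^sub>R n = (s * p) *\<^sub>R d + (s * q) *\<^sub>R n"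
        by (simp add: cu scaleR_add_right)
      then have e: "\<tau> = s * p" "\<sigma> = s * q" using cr_coords_unique[OF dn] by blast+
      with ts s have "s > 0" "p > 0" by (auto simp: zero_less_mult_iff)
      with e ts have "s * \<bar>q\<bar> < s * (s0 * p)" by (simp add: abs_mult mult.left_commute)
      with \<open>s > 0\<close> \<open>p > 0\<close> avoid show False by simp
    qed
  qed
  define z where "z = u + (\<tau>0 / 2) *\<^sub>R d"
  have "z \<in> open_segment u b" unfolding z_def d_def using t0 bu by (intro open_segment_paramI) auto
  then obtain \<rho> where rho: "\<rho> > 0"
    "(\<forall>y. dist z y < \<rho> \<and> cr (b - u) (y - z) > 0 \<longrightarrow> y \<in> ?I) \<or>
     (\<forall>y. dist z y < \<rho> \<and> cr (b - u) (y - z) < 0 \<longrightarrow> y \<in> ?I)"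
    using edge_local_side[OF P k e] by blast
  have n0: "norm n > 0" using dn by auto
  have "0 < min (s0 * \<tau>0 / 2) (\<rho> / norm n)" using s0 t0 rho n0 by simp
  then obtain \<eta> where "0 < \<eta>" "\<eta> < min (s0 * \<tau>0 / 2) (\<rho> / norm n)" using dense by blast
  then have eta: "\<eta> > 0" "\<eta> < s0 * \<tau>0 / 2" "\<eta> < \<rho> / norm n" by simp_all
  have eta': "\<eta> * norm n < \<rho>" using eta(3) n0 by (simp add: field_simps)
  have "\<exists>g. (g = 1 \<or> g = - 1) \<and> z + (g * \<eta>) *\<^sub>R n \<in> ?I"
  proof -
    have c: "cr (b - u) (z + (g * \<eta>) *\<^sub>R n - z) = g * (\<eta> * cr d n)" for g by (simp add: d_def)
    have ds: "dist z (z + (g * \<eta>) *\<^sub>R n) < \<rho>" if "g = 1 \<or> g = -1" for g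
      using that eta eta' by (auto simp: dist_norm)
    have "\<eta> * cr d n \<noteq> 0" using eta dn by simp
    then consider "1 * (\<eta> * cr d n) > 0 \<and> (-1) * (\<eta> * cr d n) < 0" | "1 * (\<eta> * cr d n) < 0 \<and> (-1) * (\<eta> * cr d n) > 0"
      by linarith
    then show ?thesis
    proof cases
      case 1
      with rho(2) c[of 1] c[of "-1"] ds[of 1] ds[of "-1"] show ?thesis by metis
    next
      case 2
      with rho(2) c[of 1] c[of "-1"] ds[of 1] ds[of "-1"] show ?thesis by metis
    qed
  qed
  then obtain g where g: "g = 1 \<or> g = - 1" "z + (g * \<eta>) *\<^sub>R n \<in> ?I" by blast
  \<comment> \<open>The half of the wedge on the interior side, cut off at
    \<open>\<tau>0\<close>.\<close>
  define T where "T = {x::real\<times>real. 0 < fst x} \<inter> {x. - \<tau>0 < - fst x} \<inter> {x. 0 < g * snd x} \<inter> {x. 0 < s0 * fst x - g * snd x}"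
  let ?f = "\<lambda>x::real\<times>real. u + fst x *\<^sub>R d + snd x *\<^sub>R n"
  have "convex T" unfolding T_def
    by (intro convex_Int convex_linear_gt linearI) (auto simp: algebra_simps)
  then have "connected (?f ` T)" by (intro convex_connected convex_param_image)
  moreover have "?f ` T \<inter> poly_boundary P = {}"
  proof -
    have "?f x \<notin> poly_boundary P" if "x \<in> T" for x
      using that g(1) by (intro clear) (auto simp: T_def)
    then show ?thesis by blast
  qed
  moreover have "z + (g * \<eta>) *\<^sub>R n \<in> ?f ` T"
    using t0 eta g(1) by (intro image_eqI[of _ _ "(\<tau>0 / 2, g * \<eta>)"]) (auto simp: z_def T_def)
  ultimately have sub: "?f ` T \<subseteq> ?I" using g(2) by (rule connected_subset_obstacle_interior)
  \<comment> \<open>The direction through the middle of that half-wedge, \<open>d\<close> tilted by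
    \<open>g * (s0 / 2)\<close> times \<open>n\<close>, written in terms of \<open>v - u\<close> and
    \<open>w - u\<close>.\<close>
  define \<alpha>' where "\<alpha>' = \<alpha> + g * (s0 / 2)"
  have a': "\<alpha>' > 0" using g(1) s0 by (auto simp: \<alpha>'_def)
  have "u + t *\<^sub>R (\<alpha>' *\<^sub>R (v - u) + \<beta> *\<^sub>R (w - u)) \<in> ?I" if t: "0 < t" "t < \<tau>0" for t
  proof -
    have "\<alpha>' *\<^sub>R (v - u) + \<beta> *\<^sub>R (w - u) = d + (g * (s0 / 2)) *\<^sub>R n"
      using dir(1) by (simp add: \<alpha>'_def d_def n_def scaleR_add_left)
    then have "u + t *\<^sub>R (\<alpha>' *\<^sub>R (v - u) + \<beta> *\<^sub>R (w - u)) = ?f (t, t * g * (s0 / 2))"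
      by (simp add: scaleR_add_right)
    moreover have "(t, t * g * (s0 / 2)) \<in> T" using t s0 g(1) by (auto simp: T_def)
    ultimately have "u + t *\<^sub>R (\<alpha>' *\<^sub>R (v - u) + \<beta> *\<^sub>R (w - u)) \<in> ?f ` T" by (rule image_eqI)
    then show ?thesis by (rule subsetD[OF sub])
  qed
  then show ?thesis unfolding splits_def using S u a' dir(3) t0(1) by blast
qed

text \<open>Turning from a direction into the obstacle to a free segment must pass an edge at the
  corner. Otherwise the small sector between them would be interior, and it contains points of the
  free segment.\<close>

lemma blocked_direction_edge:
  assumes P: "simple_polygon P" and u: "u \<in> set P"
    and bc: "b \<noteq> u" "c \<noteq> u" "r > 0" "ball u r \<inter> poly_boundary P \<subseteq> closed_segment u b \<union> closed_segment u c"
    and d: "\<epsilon> > 0" "\<And>t. 0 < t \<Longrightarrow> t < \<epsilon> \<Longrightarrow> u + t *\<^sub>R d \<in> obstacle_interior P"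
    and v: "closed_segment u v \<inter> obstacle_interior P = {}" and dn: "cr d (v - u) \<noteq> 0"
  shows "\<exists>e\<in>{b, c}. \<exists>x y. x \<ge> 0 \<and> y > 0 \<and> e - u = x *\<^sub>R d + y *\<^sub>R (v - u)"
proof (rule ccontr)
  assume neg: "\<not> ?thesis"
  let ?I = "obstacle_interior P"
  define n where "n = v - u"
  have "d \<noteq> 0" using dn by auto
  then have nd: "norm d + norm n > 0" by (simp add: add_pos_nonneg)
  have "0 < min (min 1 \<epsilon>) (r / (norm d + norm n))" using nd bc(3) d(1) by simp
  then obtain \<rho> where "0 < \<rho>" "\<rho> < min (min 1 \<epsilon>) (r / (norm d + norm n))" using dense by blast
  then have "\<rho> > 0" "\<rho> \<le> 1" "\<rho> \<le> \<epsilon>" "\<rho> \<le> r / (norm d + norm n)" by simp_all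
  then have rho: "\<rho> > 0" "\<rho> \<le> 1" "\<rho> \<le> \<epsilon>" "\<rho> * (norm d + norm n) \<le> r"
    using nd by (simp_all add: pos_le_divide_eq)
  \<comment> \<open>Both bounding rays belong to the sector, its apex does not:
    \<open>snd x = 0\<close> is the ray along \<open>d\<close>, \<open>fst x = 0\<close> the segment
    towards \<open>v\<close>.\<close>
  define T where "T = {x::real\<times>real. 0 \<le> fst x} \<inter> {x. 0 \<le> snd x} \<inter> {x. 0 < fst x + snd x} \<inter> {x. - \<rho> < - fst x - snd x}"
  let ?f = "\<lambda>x::real\<times>real. u + fst x *\<^sub>R d + snd x *\<^sub>R n"
  have "convex T" unfolding T_def
    by (intro convex_Int convex_linear_gt linearI) (auto simp: algebra_simps)
  then have "connected (?f ` T)" by (intro convex_connected convex_param_image)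
  moreover have clear: "?f x \<notin> poly_boundary P" if "x \<in> T" for x
  proof
    obtain \<tau> \<sigma> where x: "x = (\<tau>, \<sigma>)" by (cases x)
    have ts: "0 \<le> \<tau>" "0 \<le> \<sigma>" "0 < \<tau> + \<sigma>" "\<tau> + \<sigma> < \<rho>" using that x by (auto simp: T_def)
    assume z: "?f x \<in> poly_boundary P"
    have "norm (\<tau> *\<^sub>R d + \<sigma> *\<^sub>R n) \<le> \<tau> * norm d + \<sigma> * norm n"
      using norm_triangle_ineq[of "\<tau> *\<^sub>R d" "\<sigma> *\<^sub>R n"] ts by simp
    also have "\<dots> \<le> (\<tau> + \<sigma>) * (norm d + norm n)" using ts by (simp add: algebra_simps)
    also have "\<dots> < \<rho> * (norm d + norm n)" using ts nd by (intro mult_strict_right_mono) auto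
    also have "\<dots> \<le> r" by (rule rho)
    finally have "norm (\<tau> *\<^sub>R d + \<sigma> *\<^sub>R n) < r" .
    moreover have "dist u (?f x) = norm (\<tau> *\<^sub>R d + \<sigma> *\<^sub>R n)"
      unfolding x by (metis add.assoc add_diff_cancel_left' dist_commute dist_norm fst_conv snd_conv)
    ultimately have "?f x \<in> ball u r" by simp
    with z bc(4) have "?f x \<in> closed_segment u b \<union> closed_segment u c" by blast
    then obtain e where e: "e \<in> {b, c}" "?f x \<in> closed_segment u e" by blast
    then obtain s where s: "0 \<le> s" "?f x = u + s *\<^sub>R (e - u)" using closed_segment_param by metis
    then have eq: "s *\<^sub>R (e - u) = \<tau> *\<^sub>R d + \<sigma> *\<^sub>R n" by (simp add: x add.assoc)
    have "s \<noteq> 0"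
    proof
      assume "s = 0"
      with eq have "\<tau> *\<^sub>R d + \<sigma> *\<^sub>R n = 0 *\<^sub>R d + 0 *\<^sub>R n" by simp
      then have "\<tau> = 0" "\<sigma> = 0" using cr_coords_unique dn unfolding n_def by blast+
      with ts show False by simp
    qed
    then have s': "s > 0" using s by simp
    have "e - u = (1 / s) *\<^sub>R (s *\<^sub>R (e - u))" using s' by simp
    also have "\<dots> = (\<tau> / s) *\<^sub>R d + (\<sigma> / s) *\<^sub>R (v - u)"
      unfolding eq by (simp add: n_def scaleR_add_right)
    finally have "\<not> \<sigma> / s > 0" using neg e(1) ts s' by (meson divide_nonneg_pos)
    then have "\<sigma> = 0" using ts s' by (simp add: zero_less_divide_iff)
    with ts rho have "?f x \<in> ?I" using d(2)[of \<tau>] by (simp add: x)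
    with z obstacle_interior_disjoint_boundary show False by blast
  qed
  then have "?f ` T \<inter> poly_boundary P = {}" by blast
  moreover have "u + (\<rho> / 2) *\<^sub>R d \<in> ?f ` T"
    using rho by (intro image_eqI[of _ _ "(\<rho> / 2, 0)"]) (auto simp: T_def)
  moreover have "u + (\<rho> / 2) *\<^sub>R d \<in> ?I" using rho by (intro d(2)) auto
  ultimately have sub: "?f ` T \<subseteq> ?I" by (intro connected_subset_obstacle_interior)
  have "u + (\<rho> / 2) *\<^sub>R n \<in> ?f ` T"
    using rho by (intro image_eqI[of _ _ "(0, \<rho> / 2)"]) (auto simp: T_def)
  moreover have "u + (\<rho> / 2) *\<^sub>R n \<in> closed_segment u v"
    unfolding n_def using rho by (intro closed_segment_paramI) auto
  ultimately show False using sub v by blast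
qed

section \<open>Free triangles\<close>

text \<open>From here on differences such as \<open>a - p\<close> act as single vectors and must not
  be multiplied out.\<close>

declare cr_simps(3,4) [simp del]

lemma cr_zero_parallel:
  assumes "cr x y = 0" "x \<noteq> 0"
  obtains k where "y = k *\<^sub>R x"
proof -
  have "cr x (\<i> * x) = (norm x)\<^sup>2"
    using cmod_power2[of x] by (simp add: cr_eq power2_eq_square)
  then have "cr x (\<i> * x) \<noteq> 0" using assms by simp
  from cr_expand[OF this, of y] assms that show thesis by simp
qed

text \<open>The minimum of the three affine functions is continuous, positive at 0 and at most 0 at
  1, so it has a zero.\<close>

lemma affine_exit:
  fixes f g h f' g' h' :: real
  assumes "f > 0" "g > 0" "h > 0" "f' \<le> 0 \<or> g' \<le> 0 \<or> h' \<le> 0"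
  obtains s where "0 < s" "s \<le> 1"
    "f + s * (f' - f) \<ge> 0" "g + s * (g' - g) \<ge> 0" "h + s * (h' - h) \<ge> 0"
    "f + s * (f' - f) = 0 \<or> g + s * (g' - g) = 0 \<or> h + s * (h' - h) = 0"
proof -
  define m where "m s = min (f + s * (f' - f)) (min (g + s * (g' - g)) (h + s * (h' - h)))" for s
  have "continuous_on {0..1} m" unfolding m_def by (intro continuous_intros)
  moreover have "m 0 \<ge> 0" "m 1 \<le> 0" using assms by (auto simp: m_def min_le_iff_disj)
  ultimately obtain s where s: "0 \<le> s" "s \<le> 1" "m s = 0"
    using IVT2'[of m 1 0 0] by auto
  moreover have "s \<noteq> 0" using s(3) assms by (auto simp: m_def min_def split: if_splits)
  ultimately show thesis using that[of s] by (auto simp: m_def min_def split: if_splits)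
qed

lemma triangle_coords:
  assumes "cr (a - p) (b - p) \<noteq> 0"
  obtains \<alpha> \<beta> where "z = p + \<alpha> *\<^sub>R (a - p) + \<beta> *\<^sub>R (b - p)"
proof -
  from cr_expand[OF assms, of "z - p"] that show thesis
    by (metis add.assoc add_diff_cancel_left' diff_add_cancel add.commute)
qed

lemma triangle_coords_unique:
  assumes "cr (a - p) (b - p) \<noteq> 0"
    "p + \<alpha> *\<^sub>R (a - p) + \<beta> *\<^sub>R (b - p) = p + \<alpha>' *\<^sub>R (a - p) + \<beta>' *\<^sub>R (b - p)"
  shows "\<alpha> = \<alpha>'" "\<beta> = \<beta>'"
  using cr_coords_unique[OF assms(1)] assms(2) by (simp_all add: add.assoc)

text \<open>The three functions of \<open>affine_exit\<close> are the barycentric coordinates. The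
  last conclusion keeps the third one explicit, since it lets the user exclude an exit through the
  side opposite \<open>u\<close>.\<close>

lemma triangle_exit:
  fixes u a b t z :: complex
  assumes "t = u + \<alpha> *\<^sub>R a + \<beta> *\<^sub>R b" "\<alpha> > 0" "\<beta> > 0" "\<alpha> + \<beta> < 1"
    and "z = u + \<xi> *\<^sub>R a + \<eta> *\<^sub>R b" "\<not> (\<xi> > 0 \<and> \<eta> > 0 \<and> \<xi> + \<eta> < 1)"
  obtains s \<xi>' \<eta>' where "0 < s" "s \<le> 1" "t + s *\<^sub>R (z - t) = u + \<xi>' *\<^sub>R a + \<eta>' *\<^sub>R b"
    "0 \<le> \<xi>'" "0 \<le> \<eta>'" "\<xi>' + \<eta>' \<le> 1" "\<xi>' = 0 \<or> \<eta>' = 0 \<or> \<xi>' + \<eta>' = 1"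
    "1 - \<xi>' - \<eta>' = (1 - s) * (1 - \<alpha> - \<beta>) + s * (1 - \<xi> - \<eta>)"
proof -
  have "\<xi> \<le> 0 \<or> \<eta> \<le> 0 \<or> 1 - \<xi> - \<eta> \<le> 0" "0 < 1 - \<alpha> - \<beta>" using assms by auto
  then obtain s where s: "0 < s" "s \<le> 1"
    "\<alpha> + s * (\<xi> - \<alpha>) \<ge> 0" "\<beta> + s * (\<eta> - \<beta>) \<ge> 0" "(1 - \<alpha> - \<beta>) + s * ((1 - \<xi> - \<eta>) - (1 - \<alpha> - \<beta>)) \<ge> 0"
    "\<alpha> + s * (\<xi> - \<alpha>) = 0 \<or> \<beta> + s * (\<eta> - \<beta>) = 0 \<or> (1 - \<alpha> - \<beta>) + s * ((1 - \<xi> - \<eta>) - (1 - \<alpha> - \<beta>)) = 0"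
    using affine_exit[OF assms(2,3)] by metis
  have e: "t + s *\<^sub>R (z - t) = u + (\<alpha> + s * (\<xi> - \<alpha>)) *\<^sub>R a + (\<beta> + s * (\<eta> - \<beta>)) *\<^sub>R b"
    unfolding assms(1,5) by (simp add: algebra_simps)
  have e2: "1 - (\<alpha> + s * (\<xi> - \<alpha>)) - (\<beta> + s * (\<eta> - \<beta>)) = (1 - \<alpha> - \<beta>) + s * ((1 - \<xi> - \<eta>) - (1 - \<alpha> - \<beta>))"
    by (simp add: algebra_simps)
  have e3: "(1 - \<alpha> - \<beta>) + s * ((1 - \<xi> - \<eta>) - (1 - \<alpha> - \<beta>)) = (1 - s) * (1 - \<alpha> - \<beta>) + s * (1 - \<xi> - \<eta>)"
    by (simp add: algebra_simps)
  have f1: "(\<alpha> + s * (\<xi> - \<alpha>)) + (\<beta> + s * (\<eta> - \<beta>)) \<le> 1" using s(5) e2 by linarith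
  have f2: "\<alpha> + s * (\<xi> - \<alpha>) = 0 \<or> \<beta> + s * (\<eta> - \<beta>) = 0 \<or> (\<alpha> + s * (\<xi> - \<alpha>)) + (\<beta> + s * (\<eta> - \<beta>)) = 1"
    using s(6) e2 by argo
  from that[OF s(1,2) e s(3,4) f1 f2 trans[OF e2 e3]] show thesis .
qed

lemma in_triangle_iff:
  "z \<in> convex hull {p, a, b} \<longleftrightarrow>
     (\<exists>\<alpha> \<beta>. z = p + \<alpha> *\<^sub>R (a - p) + \<beta> *\<^sub>R (b - p) \<and> 0 \<le> \<alpha> \<and> 0 \<le> \<beta> \<and> \<alpha> + \<beta> \<le> 1)"
  by (auto simp: convex_hull_3_alt)

lemma in_triangleI:
  "0 \<le> \<alpha> \<Longrightarrow> 0 \<le> \<beta> \<Longrightarrow> \<alpha> + \<beta> \<le> 1 \<Longrightarrow> p + \<alpha> *\<^sub>R (a - p) + \<beta> *\<^sub>R (b - p) \<in> convex hull {p, a, b}"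
  unfolding in_triangle_iff by blast

lemma in_triangleE:
  assumes "z \<in> convex hull {p, a, b}"
  obtains \<alpha> \<beta> where "z = p + \<alpha> *\<^sub>R (a - p) + \<beta> *\<^sub>R (b - p)" "0 \<le> \<alpha>" "0 \<le> \<beta>" "\<alpha> + \<beta> \<le> 1"
  using assms unfolding in_triangle_iff by blast

lemma segment_subset_hull3:
  "closed_segment p a \<subseteq> convex hull {p, a, b}" "closed_segment p b \<subseteq> convex hull {p, a, b}"
  "closed_segment a b \<subseteq> convex hull {p, a, b}"
  by (auto simp: segment_convex_hull intro!: hull_mono)

lemma splits_commute: "splits S u v w \<Longrightarrow> splits S u w v"
  unfolding splits_def by (metis add.commute)

text \<open>A direction between \<open>v\<close> and \<open>w'\<close> is also between
  \<open>v\<close> and \<open>w\<close> when \<open>w'\<close> lies in that angle; with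
  \<open>x = 0\<close> it is a rescaling. Mostly used backwards, to pass from an unsplit angle to a
  smaller one.\<close>

lemma splits_mono:
  assumes "splits S u v w'" "w' - u = x *\<^sub>R (v - u) + y *\<^sub>R (w - u)" "x \<ge> 0" "y > 0"
  shows "splits S u v w"
proof -
  obtain P \<alpha> \<beta> \<epsilon> where P: "P \<in> S" "u \<in> set P" "\<alpha> > 0" "\<beta> > 0" "\<epsilon> > 0"
    and I: "\<And>t. 0 < t \<Longrightarrow> t < \<epsilon> \<Longrightarrow> u + t *\<^sub>R (\<alpha> *\<^sub>R (v - u) + \<beta> *\<^sub>R (w' - u)) \<in> obstacle_interior P"
    using assms(1) unfolding splits_def by blast
  have "\<alpha> *\<^sub>R (v - u) + \<beta> *\<^sub>R (w' - u) = (\<alpha> + \<beta> * x) *\<^sub>R (v - u) + (\<beta> * y) *\<^sub>R (w - u)"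
    unfolding assms(2) by (simp add: algebra_simps)
  with I have "\<forall>t. 0 < t \<and> t < \<epsilon> \<longrightarrow>
     u + t *\<^sub>R ((\<alpha> + \<beta> * x) *\<^sub>R (v - u) + (\<beta> * y) *\<^sub>R (w - u)) \<in> obstacle_interior P" by simp
  moreover have "\<alpha> + \<beta> * x > 0" "\<beta> * y > 0" using P assms by (auto simp: add_pos_nonneg)
  ultimately show ?thesis unfolding splits_def using P by blast
qed

text \<open>Every direction strictly between the two sides stays in the triangle for a short
  while.\<close>

lemma free_triangle_not_splits:
  assumes "\<And>P. P \<in> S \<Longrightarrow> convex hull {u, v, w} \<inter> obstacle_interior P = {}"
  shows "\<not> splits S u v w"
proof
  assume "splits S u v w"
  then obtain P \<alpha> \<beta> \<epsilon> where P: "P \<in> S" "\<alpha> > 0" "\<beta> > 0" "\<epsilon> > 0"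
    and I: "\<And>t. 0 < t \<Longrightarrow> t < \<epsilon> \<Longrightarrow> u + t *\<^sub>R (\<alpha> *\<^sub>R (v - u) + \<beta> *\<^sub>R (w - u)) \<in> obstacle_interior P"
    unfolding splits_def by blast
  have "0 < min \<epsilon> (1 / (\<alpha> + \<beta>))" using P by simp
  then obtain t where "0 < t" "t < min \<epsilon> (1 / (\<alpha> + \<beta>))" using dense by blast
  then have t: "0 < t" "t < \<epsilon>" "t * (\<alpha> + \<beta>) < 1" using P by (simp_all add: pos_less_divide_eq)
  have "u + t *\<^sub>R (\<alpha> *\<^sub>R (v - u) + \<beta> *\<^sub>R (w - u)) = u + (t * \<alpha>) *\<^sub>R (v - u) + (t * \<beta>) *\<^sub>R (w - u)"
    by (simp add: scaleR_add_right add.assoc)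
  also have "\<dots> \<in> convex hull {u, v, w}"
    using t P by (intro in_triangleI) (auto simp: algebra_simps)
  finally show False using I[OF t(1,2)] assms[OF P(1)] by blast
qed

section \<open>Obstacle-free triangles in a scene\<close>

locale polygon_scene =
  fixes V :: "complex set" and S :: "complex list set"
  assumes scene: "scene V S"
begin

definition free :: "complex set \<Rightarrow> bool" where
  "free A \<longleftrightarrow> (\<forall>P\<in>S. A \<inter> obstacle_interior P = {})"

lemma visible_iff_free: "visible S p q \<longleftrightarrow> free (closed_segment p q)"
  by (simp add: visible_def free_def)

lemma free_mono: "free B \<Longrightarrow> A \<subseteq> B \<Longrightarrow> free A"
  unfolding free_def by blast

lemma finite_V: "finite V" and simple_S: "P \<in> S \<Longrightarrow> simple_polygon P"
  and corners_V: "P \<in> S \<Longrightarrow> set P \<subseteq> V"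
  using scene unfolding scene_def by auto

lemma noncollinear:
  assumes "a \<in> V" "b \<in> V" "c \<in> V" "a \<noteq> b" "a \<noteq> c" "b \<noteq> c"
  shows "cr (b - a) (c - a) \<noteq> 0"
proof
  assume "cr (b - a) (c - a) = 0"
  then obtain k where k: "c - a = k *\<^sub>R (b - a)" using assms by (metis cr_zero_parallel right_minus_eq)
  then have "collinear {b, a, c}" using assms
    by (subst collinear_3) (auto simp: collinear_lemma)
  moreover have "\<not> collinear {b, a, c}"
    using scene assms unfolding scene_def general_position_def by metis
  ultimately show False by blast
qed

lemma vertex_on_segment:
  assumes "a \<in> V" "b \<in> V" "q \<in> V" "q \<in> closed_segment a b"
  shows "q = a \<or> q = b"
proof (rule ccontr)
  assume h: "\<not> (q = a \<or> q = b)"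
  obtain s where s: "q = a + s *\<^sub>R (b - a)" using assms(4) closed_segment_param by blast
  have "a \<noteq> b" using h assms by auto
  then have "cr (b - a) (q - a) \<noteq> 0" using noncollinear[of a b q] assms h by auto
  moreover have "q - a = s *\<^sub>R (b - a)" using s by simp
  ultimately show False by (simp only: cr_simps(5,9)) 
qed

lemma poly_edge_ends:
  assumes "P \<in> S" "k < length P"
  obtains x y where "poly_edge P k = closed_segment x y" "x \<in> set P" "y \<in> set P" "x \<in> V" "y \<in> V"
proof -
  have "Suc k mod length P < length P" using assms(2) by (intro mod_less_divisor) auto
  then show thesis using that[of "P ! k" "P ! (Suc k mod length P)"] assms corners_V
    by (metis nth_mem poly_edge_def subset_iff)
qed

lemma corner_of_boundary:
  assumes "P \<in> S" "q \<in> V" "q \<in> poly_boundary P"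
  shows "q \<in> set P"
proof -
  obtain k where k: "k < length P" "q \<in> poly_edge P k" using assms by (auto simp: poly_boundary_def)
  then obtain x y where "q \<in> closed_segment x y" "x \<in> set P" "y \<in> set P" "x \<in> V" "y \<in> V"
    using poly_edge_ends[OF assms(1)] by metis
  then show ?thesis using vertex_on_segment assms by blast
qed

text \<open>The first case serves crossing points of visible segments, the second serves vertices,
  which may be corners of an obstacle.\<close>

definition good_apex :: "complex \<Rightarrow> complex \<Rightarrow> complex \<Rightarrow> bool" where
  "good_apex p a b \<longleftrightarrow> (\<forall>P\<in>S. p \<notin> poly_boundary P) \<or> (p \<in> V \<and> \<not> splits S p a b)"

lemma good_apex_commute: "good_apex p a b \<Longrightarrow> good_apex p b a"
  unfolding good_apex_def using splits_commute by blast

text \<open>Such an edge either starts at \<open>p\<close> inside the angle and splits it, or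
  crosses the free side transversally and puts interior points on it. The end \<open>a\<close> is
  exempt by \<open>\<alpha> < 1\<close>, since obstacle edges may well start there.\<close>

lemma no_edge_through_side:
  assumes P: "P \<in> S" "k < length P" and e: "poly_edge P k = closed_segment x y"
    and xy: "x \<in> set P" "y \<in> set P"
    and z: "z \<in> closed_segment x y" "z = p + \<alpha>' *\<^sub>R (a - p) + \<beta>' *\<^sub>R (b - p)" "\<alpha>' > 0" "\<beta>' > 0"
    and q: "q \<in> closed_segment x y" "q = p + \<alpha> *\<^sub>R (a - p)" "0 \<le> \<alpha>" "\<alpha> < 1"
    and nc: "cr (a - p) (b - p) \<noteq> 0"
    and fr: "free (closed_segment p a)" and V: "V \<inter> closed_segment p a \<subseteq> {p, a}"
    and apex: "good_apex p a b"
  shows False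
proof -
  have xyV: "x \<in> V" "y \<in> V" using xy corners_V P by auto
  have pa: "p \<noteq> a" using nc by auto
  show False
  proof (cases "\<alpha> = 0")
    case True
    then have qp: "q = p" using q by simp
    then have "p \<in> poly_boundary P" using q P e by (auto simp: poly_boundary_def)
    then have pV: "p \<in> V" "\<not> splits S p a b" using apex P unfolding good_apex_def by auto
    then have "p = x \<or> p = y" using vertex_on_segment[OF xyV, of p] q(1) qp by simp
    then obtain f where f: "closed_segment x y = closed_segment p f" "p \<in> set P"
      using xy by (metis closed_segment_commute)
    obtain s where s: "0 \<le> s" "z = p + s *\<^sub>R (f - p)" using z(1) f closed_segment_param by metis
    have eq: "s *\<^sub>R (f - p) = \<alpha>' *\<^sub>R (a - p) + \<beta>' *\<^sub>R (b - p)" using s z(2) by (simp add: add.assoc)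
    have "s \<noteq> 0"
    proof
      assume "s = 0"
      then have "\<alpha>' *\<^sub>R (a - p) + \<beta>' *\<^sub>R (b - p) = 0 *\<^sub>R (a - p) + 0 *\<^sub>R (b - p)" using eq by simp
      then show False using cr_coords_unique(1)[OF nc] z(3) by blast
    qed
    then have sp: "s > 0" using s by simp
    have "f - p = (1 / s) *\<^sub>R (s *\<^sub>R (f - p))" using sp by simp
    also have "\<dots> = (\<alpha>' / s) *\<^sub>R (a - p) + (\<beta>' / s) *\<^sub>R (b - p)" unfolding eq by (simp add: scaleR_add_right)
    finally have "splits S p a b"
      using edge_in_cone_splits[OF simple_S[OF P(1)] f(2) P e[unfolded f(1)]] z sp nc by simp
    with pV show False by blast
  next
    case False
    then have a0: "\<alpha> > 0" using q by simp
    have qo: "q \<in> open_segment p a" unfolding q(2) using a0 q pa by (intro open_segment_paramI)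
    then have "q \<notin> V" using V by (auto simp: open_segment_def)
    then have qxy: "q \<in> open_segment x y" using q(1) xyV by (auto simp: open_segment_def)
    obtain s1 s2 where s: "z = x + s1 *\<^sub>R (y - x)" "q = x + s2 *\<^sub>R (y - x)"
      using z(1) q(1) closed_segment_param by metis
    have "(s1 - s2) *\<^sub>R (y - x) = z - q" unfolding s by (simp add: algebra_simps)
    also have "\<dots> = (\<alpha>' - \<alpha>) *\<^sub>R (a - p) + \<beta>' *\<^sub>R (b - p)"
      unfolding z(2) q(2) by (simp add: algebra_simps)
    finally have "(s1 - s2) *\<^sub>R (y - x) = (\<alpha>' - \<alpha>) *\<^sub>R (a - p) + \<beta>' *\<^sub>R (b - p)" .
    then have "cr ((s1 - s2) *\<^sub>R (y - x)) (a - p) = cr ((\<alpha>' - \<alpha>) *\<^sub>R (a - p) + \<beta>' *\<^sub>R (b - p)) (a - p)"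
      by simp
    then have "(s1 - s2) * cr (y - x) (a - p) = \<beta>' * cr (b - p) (a - p)"
      by (simp only: cr_simps(2,6,9) mult_zero_right add_0_left)
    then have "cr (y - x) (a - p) \<noteq> 0" using z(4) nc cr_commute[of "a - p" "b - p"]
      by (metis mult_eq_0_iff neg_equal_0_iff_equal order_less_irrefl)
    then have "open_segment p a \<inter> obstacle_interior P \<noteq> {}"
      using crossing_edge_meets_interior[OF simple_S[OF P(1)] P(2) e qxy qo] by blast
    then show False using fr P open_closed_segment unfolding free_def by fastforce
  qed
qed

text \<open>An obstacle that meets the triangle has an edge inside it or swallows it. Such an edge
  would have to cross a side at \<open>p\<close>, and swallowing is excluded at the apex itself.\<close>

lemma free_triangle:
  assumes nc: "cr (a - p) (b - p) \<noteq> 0"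
    and fa: "free (closed_segment p a)" and fb: "free (closed_segment p b)"
    and V: "V \<inter> convex hull {p, a, b} \<subseteq> {p} \<union> closed_segment a b"
    and apex: "good_apex p a b"
  shows "free (convex hull {p, a, b})"
  unfolding free_def
proof (intro ballI, rule ccontr)
  fix P assume P: "P \<in> S" and meet: "convex hull {p, a, b} \<inter> obstacle_interior P \<noteq> {}"
  let ?I = "obstacle_interior P"
  let ?f = "\<lambda>x::real\<times>real. p + fst x *\<^sub>R (a - p) + snd x *\<^sub>R (b - p)"
  define T where "T = {x::real\<times>real. 0 < fst x} \<inter> {x. 0 < snd x} \<inter> {x. - 1 < - fst x - snd x}"
  have T: "(\<alpha>, \<beta>) \<in> T \<longleftrightarrow> 0 < \<alpha> \<and> 0 < \<beta> \<and> \<alpha> + \<beta> < 1" for \<alpha> \<beta>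
    by (auto simp: T_def)
  have "convex T" unfolding T_def
    by (intro convex_Int convex_linear_gt linearI) (auto simp: algebra_simps)
  then have conn: "connected (?f ` T)" by (intro convex_connected convex_param_image)
  have nc': "cr (b - p) (a - p) \<noteq> 0" using nc cr_commute[of "a - p" "b - p"] by simp
  have ab_coords: "\<alpha> + \<beta> = 1" if "p + \<alpha> *\<^sub>R (a - p) + \<beta> *\<^sub>R (b - p) \<in> closed_segment a b" for \<alpha> \<beta>
  proof -
    from that obtain s where "p + \<alpha> *\<^sub>R (a - p) + \<beta> *\<^sub>R (b - p) = a + s *\<^sub>R (b - a)"
      by (rule closed_segment_param)
    also have "\<dots> = p + (1 - s) *\<^sub>R (a - p) + s *\<^sub>R (b - p)" by (simp add: algebra_simps)
    finally show ?thesis using triangle_coords_unique[OF nc, of \<alpha> \<beta> "1 - s" s] by simp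
  qed
  have Vsides: "V \<inter> closed_segment p a \<subseteq> {p, a}" "V \<inter> closed_segment p b \<subseteq> {p, b}"
  proof -
    show "V \<inter> closed_segment p a \<subseteq> {p, a}"
    proof
      fix q assume q: "q \<in> V \<inter> closed_segment p a"
      then have "q \<in> closed_segment p a" by simp
      then obtain s where "q = p + s *\<^sub>R (a - p)" by (rule closed_segment_param)
      then have s: "q = p + s *\<^sub>R (a - p) + 0 *\<^sub>R (b - p)" by simp
      have "q = p \<or> q \<in> closed_segment a b" using q V segment_subset_hull3(1)[of p a b] by blast
      then show "q \<in> {p, a}" using ab_coords[of s 0] s by auto
    qed
    show "V \<inter> closed_segment p b \<subseteq> {p, b}"
    proof
      fix q assume q: "q \<in> V \<inter> closed_segment p b"
      then have "q \<in> closed_segment p b" by simp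
      then obtain s where "q = p + s *\<^sub>R (b - p)" by (rule closed_segment_param)
      then have s: "q = p + 0 *\<^sub>R (a - p) + s *\<^sub>R (b - p)" by simp
      have "q = p \<or> q \<in> closed_segment a b" using q V segment_subset_hull3(2)[of p b a] by blast
      then show "q \<in> {p, b}" using ab_coords[of 0 s] s by auto
    qed
  qed
  have clear: "?f ` T \<inter> poly_boundary P = {}"
  proof (rule ccontr)
    assume "?f ` T \<inter> poly_boundary P \<noteq> {}"
    then obtain z k where k: "k < length P" "z \<in> poly_edge P k" "z \<in> ?f ` T"
      by (auto simp: poly_boundary_def)
    then obtain \<alpha> \<beta> where z: "z = p + \<alpha> *\<^sub>R (a - p) + \<beta> *\<^sub>R (b - p)" "0 < \<alpha>" "0 < \<beta>" "\<alpha> + \<beta> < 1"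
      using T by force
    obtain x y where e: "poly_edge P k = closed_segment x y" and xy: "x \<in> set P" "y \<in> set P"
      and xyV: "x \<in> V" "y \<in> V" using poly_edge_ends[OF P k(1)] .
    have zxy: "z \<in> closed_segment x y" using k e by simp
    have outT: "\<xi> \<le> 0 \<or> \<eta> \<le> 0 \<or> 1 - \<xi> - \<eta> \<le> 0"
      if "v \<in> V" "v = p + \<xi> *\<^sub>R (a - p) + \<eta> *\<^sub>R (b - p)" for v \<xi> \<eta>
    proof (rule ccontr)
      assume h: "\<not> ?thesis"
      then have "v \<in> convex hull {p, a, b}" unfolding that(2) by (intro in_triangleI) auto
      then have "v = p \<or> v \<in> closed_segment a b" using V that(1) by blast
      then show False
      proof
        assume "v = p"
        then have "p + \<xi> *\<^sub>R (a - p) + \<eta> *\<^sub>R (b - p) = p + 0 *\<^sub>R (a - p) + 0 *\<^sub>R (b - p)" using that by simp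
        from triangle_coords_unique[OF nc this] h show False by simp
      next
        assume "v \<in> closed_segment a b"
        then show False using ab_coords[of \<xi> \<eta>] that(2) h by simp
      qed
    qed
    have ex: "\<exists>s \<xi> \<eta>. 0 < s \<and> s \<le> 1 \<and> z + s *\<^sub>R (v - z) = p + \<xi> *\<^sub>R (a - p) + \<eta> *\<^sub>R (b - p) \<and>
        0 \<le> \<xi> \<and> 0 \<le> \<eta> \<and> \<xi> + \<eta> \<le> 1 \<and> (\<xi> = 0 \<or> \<eta> = 0 \<or> \<xi> + \<eta> = 1)"
      if vV: "v \<in> V" for v
    proof -
      obtain \<xi> \<eta> where v: "v = p + \<xi> *\<^sub>R (a - p) + \<eta> *\<^sub>R (b - p)" using triangle_coords[OF nc] .
      have "\<not> (\<xi> > 0 \<and> \<eta> > 0 \<and> \<xi> + \<eta> < 1)" using outT[OF vV v] by linarith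
      from triangle_exit[OF z v this] obtain s \<xi>' \<eta>' where
        "0 < s" "s \<le> 1" "z + s *\<^sub>R (v - z) = p + \<xi>' *\<^sub>R (a - p) + \<eta>' *\<^sub>R (b - p)"
        "0 \<le> \<xi>'" "0 \<le> \<eta>'" "\<xi>' + \<eta>' \<le> 1" "\<xi>' = 0 \<or> \<eta>' = 0 \<or> \<xi>' + \<eta>' = 1"
        by metis
      then show ?thesis by blast
    qed
    have noside: "\<xi> + \<eta> = 1" if q: "q \<in> closed_segment x y" "q = p + \<xi> *\<^sub>R (a - p) + \<eta> *\<^sub>R (b - p)"
      "0 \<le> \<xi>" "0 \<le> \<eta>" "\<xi> + \<eta> \<le> 1" "\<xi> = 0 \<or> \<eta> = 0 \<or> \<xi> + \<eta> = 1" for q \<xi> \<eta>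
    proof (rule ccontr)
      assume h: "\<xi> + \<eta> \<noteq> 1"
      with q consider "\<eta> = 0" "\<xi> < 1" | "\<xi> = 0" "\<eta> < 1" by force
      then show False
      proof cases
        case 1
        then have "q = p + \<xi> *\<^sub>R (a - p)" using q by simp
        from no_edge_through_side[OF P k(1) e xy zxy z(1,2,3) q(1) this q(3) 1(2) nc fa Vsides(1) apex]
        show False .
      next
        case 2
        then have "q = p + \<eta> *\<^sub>R (b - p)" using q by simp
        note q2 = this
        have z2: "z = p + \<beta> *\<^sub>R (b - p) + \<alpha> *\<^sub>R (a - p)" using z(1) by (simp add: algebra_simps)
        from no_edge_through_side[OF P k(1) e xy zxy z2 z(3,2) q(1) q2 q(4) 2(2) nc' fb Vsides(2) good_apex_commute[OF apex]]
        show False .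
      qed
    qed
    \<comment> \<open>The edge can leave the triangle only through the side \<open>a b\<close>, so
      both of its ends lie on or beyond that line. It then could not contain \<open>z\<close>, which
      lies strictly before it.\<close>
    have side3: "1 - \<xi> - \<eta> \<le> 0" if v: "v \<in> V" "v \<in> {x, y}" "v = p + \<xi> *\<^sub>R (a - p) + \<eta> *\<^sub>R (b - p)" for v \<xi> \<eta>
    proof -
      obtain s \<xi>' \<eta>' where s: "0 < s" "s \<le> 1" "z + s *\<^sub>R (v - z) = p + \<xi>' *\<^sub>R (a - p) + \<eta>' *\<^sub>R (b - p)"
        "0 \<le> \<xi>'" "0 \<le> \<eta>'" "\<xi>' + \<eta>' \<le> 1" "\<xi>' = 0 \<or> \<eta>' = 0 \<or> \<xi>' + \<eta>' = 1"
        using ex[OF v(1)] by blast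
      have "z + s *\<^sub>R (v - z) \<in> closed_segment z v" using s by (intro closed_segment_paramI) auto
      also have "closed_segment z v \<subseteq> closed_segment x y"
        using zxy v(2) by (intro closed_segment_subset) auto
      finally have sum1: "\<xi>' + \<eta>' = 1" by (rule noside[OF _ s(3-7)])
      have "z + s *\<^sub>R (v - z) = p + (\<alpha> + s * (\<xi> - \<alpha>)) *\<^sub>R (a - p) + (\<beta> + s * (\<eta> - \<beta>)) *\<^sub>R (b - p)"
        unfolding v(3) z(1) by (simp add: algebra_simps)
      from triangle_coords_unique[OF nc trans[OF s(3)[symmetric] this]]
      have "s * (1 - \<xi> - \<eta>) = - ((1 - s) * (1 - \<alpha> - \<beta>))" using sum1 by (simp add: algebra_simps)
      moreover have "(1 - s) * (1 - \<alpha> - \<beta>) \<ge> 0" using s z by (intro mult_nonneg_nonneg) auto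
      ultimately have "s * (1 - \<xi> - \<eta>) \<le> 0" by linarith
      then show ?thesis using s(1) by (simp add: mult_le_0_iff)
    qed
    obtain \<xi>1 \<eta>1 where x: "x = p + \<xi>1 *\<^sub>R (a - p) + \<eta>1 *\<^sub>R (b - p)" using triangle_coords[OF nc] .
    obtain \<xi>2 \<eta>2 where y: "y = p + \<xi>2 *\<^sub>R (a - p) + \<eta>2 *\<^sub>R (b - p)" using triangle_coords[OF nc] .
    obtain s where s: "0 \<le> s" "s \<le> 1" "z = x + s *\<^sub>R (y - x)" using zxy closed_segment_param by blast
    have "z = p + (\<xi>1 + s * (\<xi>2 - \<xi>1)) *\<^sub>R (a - p) + (\<eta>1 + s * (\<eta>2 - \<eta>1)) *\<^sub>R (b - p)"
      unfolding s(3) x y by (simp add: algebra_simps)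
    from triangle_coords_unique[OF nc trans[OF z(1)[symmetric] this]]
    have "1 - \<alpha> - \<beta> = (1 - s) * (1 - \<xi>1 - \<eta>1) + s * (1 - \<xi>2 - \<eta>2)" by (simp add: algebra_simps)
    moreover have "(1 - s) * (1 - \<xi>1 - \<eta>1) \<le> 0" "s * (1 - \<xi>2 - \<eta>2) \<le> 0"
      using side3[OF xyV(1) _ x] side3[OF xyV(2) _ y] s by (auto simp: mult_le_0_iff)
    ultimately show False using z by simp
  qed
  \<comment> \<open>The open triangle is now known to avoid the boundary. An interior point in the
    closed triangle can be pushed slightly towards the centroid, into the open one, so the whole
    open triangle is interior and \<open>p\<close> is a limit of interior points.\<close>
  from meet obtain z where zI: "z \<in> ?I" and "z \<in> convex hull {p, a, b}" by blast
  then obtain \<alpha> \<beta> where "z = p + \<alpha> *\<^sub>R (a - p) + \<beta> *\<^sub>R (b - p)" "0 \<le> \<alpha>" "0 \<le> \<beta>" "\<alpha> + \<beta> \<le> 1"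
    by (elim in_triangleE)
  note z = zI this
  obtain \<rho> where rho: "\<rho> > 0" "ball z \<rho> \<subseteq> ?I" using z(1) open_obstacle_interior open_contains_ball by metis
  define c where "c = p + (1/3) *\<^sub>R (a - p) + (1/3) *\<^sub>R (b - p)"
  have "0 < min 1 (\<rho> / (norm (c - z) + 1))" using rho by (simp add: add_nonneg_pos)
  then obtain s where "0 < s" "s < min 1 (\<rho> / (norm (c - z) + 1))" using dense by blast
  then have s: "0 < s" "s < 1" "s * (norm (c - z) + 1) < \<rho>"
    by (simp_all add: pos_less_divide_eq add_nonneg_pos)
  have "dist z (z + s *\<^sub>R (c - z)) = s * norm (c - z)" using s by (simp add: dist_norm)
  also have "\<dots> < \<rho>" using s by (simp add: algebra_simps)
  finally have in1: "z + s *\<^sub>R (c - z) \<in> ?I" using rho by auto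
  have "z + s *\<^sub>R (c - z) = ?f (\<alpha> + s * (1/3 - \<alpha>), \<beta> + s * (1/3 - \<beta>))"
    unfolding z(2) c_def by (simp add: algebra_simps)
  moreover have "(\<alpha> + s * (1/3 - \<alpha>), \<beta> + s * (1/3 - \<beta>)) \<in> T"
  proof -
    have "(1 - s) * \<alpha> \<ge> 0" "(1 - s) * \<beta> \<ge> 0" "(1 - s) * (1 - \<alpha> - \<beta>) \<ge> 0"
      using s z(3-5) by (auto intro!: mult_nonneg_nonneg)
    then show ?thesis unfolding T using s by (auto simp: algebra_simps)
  qed
  ultimately have "z + s *\<^sub>R (c - z) \<in> ?f ` T" by (rule image_eqI)
  then have sub: "?f ` T \<subseteq> ?I" using connected_subset_obstacle_interior[OF conn clear] in1 by blast
  have ray: "p + t *\<^sub>R (1 *\<^sub>R (a - p) + 1 *\<^sub>R (b - p)) \<in> ?I" if "0 < t" "t < 1/2" for t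
  proof -
    have "p + t *\<^sub>R (1 *\<^sub>R (a - p) + 1 *\<^sub>R (b - p)) = ?f (t, t)" by (simp add: algebra_simps)
    moreover have "(t, t) \<in> T" using that T by simp
    ultimately have "p + t *\<^sub>R (1 *\<^sub>R (a - p) + 1 *\<^sub>R (b - p)) \<in> ?f ` T" by (rule image_eqI)
    then show ?thesis by (rule subsetD[OF sub])
  qed
  have "p \<notin> ?I" using fa P unfolding free_def by auto
  moreover have "p \<in> closure ?I"
    unfolding closure_approachable
  proof (intro allI impI)
    fix e :: real assume e: "e > 0"
    let ?w = "1 *\<^sub>R (a - p) + 1 *\<^sub>R (b - p)"
    have "0 < min (1/2) (e / (norm ?w + 1))" using e by (simp add: add_nonneg_pos)
    then obtain t where "0 < t" "t < min (1/2) (e / (norm ?w + 1))" using dense by blast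
    then have t: "0 < t" "t < 1/2" "t * (norm ?w + 1) < e"
      by (simp_all add: pos_less_divide_eq add_nonneg_pos)
    have "dist (p + t *\<^sub>R ?w) p = t * norm ?w" using t by (simp add: dist_norm)
    also have "\<dots> < e" using t by (simp add: algebra_simps)
    finally show "\<exists>y\<in>?I. dist y p < e" using ray[OF t(1,2)] by blast
  qed
  ultimately have pb: "p \<in> poly_boundary P" using closure_obstacle_interior[OF simple_S[OF P]] by blast
  then have pV: "p \<in> V" "\<not> splits S p a b" using apex P unfolding good_apex_def by auto
  have "p \<in> set P" using corner_of_boundary P pV pb by blast
  then have "splits S p a b" unfolding splits_def using P ray
    by (intro bexI[OF _ P] conjI exI[of _ "1::real"] exI[of _ "1/2::real"]) auto
  with pV show False by blast
qed

text \<open>Rotating a ray around \<open>a\<close> from \<open>p\<close> towards \<open>b\<close>, take the first vertex that it hits.\<close>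

lemma first_vertex:
  assumes aV: "a \<in> V" and bV: "b \<in> V" and nc: "cr (a - p) (b - p) \<noteq> 0"
    and fa: "free (closed_segment p a)" and fb: "free (closed_segment p b)"
    and Vpa: "V \<inter> closed_segment p a \<subseteq> {p, a}" and apex: "good_apex p a b"
  obtains t \<alpha> \<beta> where "t \<in> V" "t \<noteq> a" "t \<noteq> p"
    "t = p + \<alpha> *\<^sub>R (a - p) + \<beta> *\<^sub>R (b - p)" "0 \<le> \<alpha>" "0 < \<beta>" "\<alpha> + \<beta> \<le> 1"
    "V \<inter> convex hull {p, a, t} \<subseteq> {p, a, t}" "free (convex hull {p, a, t})"
    "\<And>q \<xi> \<eta>. q \<in> V \<Longrightarrow> q \<noteq> p \<Longrightarrow> q = p + \<xi> *\<^sub>R (a - p) + \<eta> *\<^sub>R (b - p) \<Longrightarrow>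
       0 \<le> \<xi> \<Longrightarrow> 0 \<le> \<eta> \<Longrightarrow> \<xi> + \<eta> \<le> 1 \<Longrightarrow> \<beta> * (1 - \<xi>) \<le> \<eta> * (1 - \<alpha>)"
proof -
  let ?N = "cr (a - p) (b - p)"
  \<comment> \<open>The slope of the ray from \<open>a\<close> through \<open>q\<close>: the
    coordinate along \<open>b - p\<close> over one minus the coordinate along \<open>a - p\<close>.
    It is 0 towards \<open>p\<close> and 1 towards \<open>b\<close>, so the least slope belongs to
    the first vertex hit.\<close>
  define M where "M q = (cr (a - p) (q - p) / ?N) / (1 - cr (q - p) (b - p) / ?N)" for q
  have M: "M (p + \<xi> *\<^sub>R (a - p) + \<eta> *\<^sub>R (b - p)) = \<eta> / (1 - \<xi>)" for \<xi> \<eta>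
  proof -
    have "p + \<xi> *\<^sub>R (a - p) + \<eta> *\<^sub>R (b - p) - p = \<xi> *\<^sub>R (a - p) + \<eta> *\<^sub>R (b - p)" by simp
    moreover have "cr (a - p) (\<xi> *\<^sub>R (a - p) + \<eta> *\<^sub>R (b - p)) = \<eta> * ?N"
      "cr (\<xi> *\<^sub>R (a - p) + \<eta> *\<^sub>R (b - p)) (b - p) = \<xi> * ?N"
      by (simp_all only: cr_simps(1,2,5,6,9) mult_zero_right add_0_left add_0_right)
    ultimately show ?thesis unfolding M_def using nc by (simp del: cr_simps)
  qed
  define W where "W = V \<inter> convex hull {p, a, b} - {p, a}"
  have ab: "a \<noteq> b" "b \<noteq> p" "a \<noteq> p" using nc by auto
  have "b \<in> W" unfolding W_def using bV ab by (auto intro: hull_inc)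
  moreover have finW: "finite W" unfolding W_def using finite_V by simp
  ultimately have "Min (M ` W) \<in> M ` W" by (intro Min_in) auto
  then obtain t where t: "t \<in> W" "M t = Min (M ` W)" by auto
  have tmin: "M t \<le> M q" if "q \<in> W" for q using that t(2) finW by simp
  have tV: "t \<in> V" "t \<noteq> p" "t \<noteq> a" "t \<in> convex hull {p, a, b}" using t(1) by (auto simp: W_def)
  obtain \<alpha> \<beta> where c: "t = p + \<alpha> *\<^sub>R (a - p) + \<beta> *\<^sub>R (b - p)" "0 \<le> \<alpha>" "0 \<le> \<beta>" "\<alpha> + \<beta> \<le> 1"
    using tV(4) by (rule in_triangleE)
  have "\<beta> \<noteq> 0"
  proof
    assume b0: "\<beta> = 0"
    then have "t = p + \<alpha> *\<^sub>R (a - p)" using c(1) by simp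
    then have "t \<in> closed_segment p a" using closed_segment_paramI[of \<alpha> p a] c b0 by simp
    then show False using Vpa tV by blast
  qed
  then have b0: "\<beta> > 0" and a1: "\<alpha> < 1" using c by auto
  define m where "m = \<beta> / (1 - \<alpha>)"
  have m: "0 < m" "m \<le> 1" "m * (1 - \<alpha>) = \<beta>" using b0 a1 c by (auto simp: m_def)
  have Mt: "M t = m" unfolding c(1) M m_def ..
  have slope: "\<beta> * (1 - \<xi>) \<le> \<eta> * (1 - \<alpha>)"
    if q: "q \<in> V" "q \<noteq> p" "q = p + \<xi> *\<^sub>R (a - p) + \<eta> *\<^sub>R (b - p)" "0 \<le> \<xi>" "0 \<le> \<eta>" "\<xi> + \<eta> \<le> 1" for q \<xi> \<eta>
  proof (cases "\<xi> = 1")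
    case True
    then show ?thesis using q a1 by simp
  next
    case False
    then have x1: "\<xi> < 1" using q by simp
    have "q \<noteq> a"
    proof
      assume "q = a"
      then have "p + \<xi> *\<^sub>R (a - p) + \<eta> *\<^sub>R (b - p) = p + 1 *\<^sub>R (a - p) + 0 *\<^sub>R (b - p)" using q(3) by simp
      from triangle_coords_unique[OF nc this] False show False by simp
    qed
    moreover have "q \<in> convex hull {p, a, b}" unfolding q(3) using q by (intro in_triangleI)
    ultimately have "q \<in> W" using q unfolding W_def by blast
    from tmin[OF this] have "\<beta> / (1 - \<alpha>) \<le> \<eta> / (1 - \<xi>)" unfolding Mt m_def using M q(3) by simp
    then show ?thesis using x1 a1 by (simp add: field_simps)
  qed
  \<comment> \<open>The point where the ray from \<open>a\<close> through \<open>t\<close> meets the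
    side \<open>p b\<close>. By minimality of the slope all vertices of the triangle
    \<open>p a t'\<close> except \<open>p\<close> lie on the segment \<open>a t'\<close>, which is
    what \<open>free_triangle\<close> asks for.\<close>
  define t' where "t' = p + m *\<^sub>R (b - p)"
  have t'p: "t' - p = m *\<^sub>R (b - p)" by (simp add: t'_def)
  have t'pb: "t' \<in> closed_segment p b" unfolding t'_def using m by (intro closed_segment_paramI) auto
  have nc': "cr (a - p) (t' - p) \<noteq> 0" unfolding t'p using nc m by (simp only: cr_simps(5)) simp
  have ft': "free (closed_segment p t')"
    using fb t'pb by (elim free_mono) (simp add: closed_segment_subset)
  have seg': "q \<in> closed_segment a t'" if q: "q \<in> V" "q \<noteq> p" "q \<in> convex hull {p, a, t'}" for q
  proof -
    obtain \<xi> \<eta> where x: "q = p + \<xi> *\<^sub>R (a - p) + \<eta> *\<^sub>R (t' - p)" "0 \<le> \<xi>" "0 \<le> \<eta>" "\<xi> + \<eta> \<le> 1"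
      using q(3) by (rule in_triangleE)
    have x': "q = p + \<xi> *\<^sub>R (a - p) + (\<eta> * m) *\<^sub>R (b - p)" using x(1) unfolding t'p by simp
    have em: "\<eta> * m \<le> \<eta>" using m x by (simp add: mult_left_le)
    have "\<beta> * (1 - \<xi>) \<le> \<eta> * m * (1 - \<alpha>)" using slope[OF q(1,2) x'] x m em by simp
    then have "\<beta> * (1 - \<xi>) \<le> \<eta> * \<beta>" using m(3) by (simp add: mult.assoc)
    then have "1 - \<xi> \<le> \<eta>" using b0 by (simp add: mult.commute)
    then have "\<xi> = 1 - \<eta>" using x by simp
    then have "q = p + (1 - \<eta>) *\<^sub>R (a - p) + \<eta> *\<^sub>R (t' - p)" using x(1) by simp
    also have "\<dots> = a + \<eta> *\<^sub>R (t' - a)" by (simp add: algebra_simps)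
    finally show ?thesis using closed_segment_paramI[of \<eta> a t'] x by simp
  qed
  have "good_apex p a t'"
    using apex splits_mono[of S p a t' 0 m b] t'p m unfolding good_apex_def by auto
  then have free': "free (convex hull {p, a, t'})"
    using free_triangle[OF nc' fa ft'] seg' by blast
  have "t = p + \<alpha> *\<^sub>R (a - p) + (1 - \<alpha>) *\<^sub>R (t' - p)"
    using c(1) m(3) unfolding t'p by (simp add: mult.commute)
  then have tin: "t \<in> convex hull {p, a, t'}"
    using in_triangleI[of \<alpha> "1 - \<alpha>" p a t'] c a1 by simp
  then have sub: "convex hull {p, a, t} \<subseteq> convex hull {p, a, t'}"
    by (intro hull_minimal convex_convex_hull) (auto intro: hull_inc)
  have "V \<inter> convex hull {p, a, t} \<subseteq> {p, a, t}"
  proof (rule ccontr)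
    assume "\<not> ?thesis"
    then obtain q where q: "q \<in> V" "q \<in> convex hull {p, a, t}" "q \<noteq> p" "q \<noteq> a" "q \<noteq> t" by auto
    have "q \<in> closed_segment a t'" "t \<in> closed_segment a t'"
      using seg' q sub tV tin by blast+
    then obtain s s' where s: "q = a + s *\<^sub>R (t' - a)" "t = a + s' *\<^sub>R (t' - a)"
      using closed_segment_param by metis
    have d: "q - a = s *\<^sub>R (t' - a)" "t - a = s' *\<^sub>R (t' - a)" using s by simp_all
    have "cr (t - a) (q - a) = 0" unfolding d by (simp only: cr_simps(5,6,9) mult_zero_right)
    then show False using noncollinear[of a t q] aV tV q by auto
  qed
  from that[OF tV(1,3,2) c(1,2) b0 c(4) this free_mono[OF free' sub] slope] show thesis .
qed

end

section \<open>Cones and arcs\<close>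

text \<open>\<open>ht k\<close> is the projection onto the bisector of the positive cone \<open>C\<^sub>k\<close>; the cone boundaries are
  the zero lines of the three functions.\<close>

definition ht :: "nat \<Rightarrow> complex \<Rightarrow> real" where
  "ht k z = (if k = 0 then Im z else if k = 1 then - (sqrt 3 / 2) * Re z - Im z / 2
             else (sqrt 3 / 2) * Re z - Im z / 2)"

lemma ht_add [simp]: "ht k (a + b) = ht k a + ht k b"
  and ht_diff [simp]: "ht k (a - b) = ht k a - ht k b"
  and ht_scaleR [simp]: "ht k (x *\<^sub>R a) = x * ht k a"
  and ht_zero [simp]: "ht k 0 = 0"
  by (auto simp: ht_def field_simps)

text \<open>A permutation of the three cones. Both orders of the last two occur, so that mirror
  images need no separate argument.\<close>

definition idx :: "nat \<Rightarrow> nat \<Rightarrow> nat \<Rightarrow> bool" where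
  "idx i j k \<longleftrightarrow> i < 3 \<and> j < 3 \<and> k < 3 \<and> i \<noteq> j \<and> j \<noteq> k \<and> i \<noteq> k"

lemma idx_cases:
  assumes "idx i j k"
  obtains "i = 0" "j = 1" "k = 2" | "i = 0" "j = 2" "k = 1" | "i = 1" "j = 0" "k = 2"
    | "i = 1" "j = 2" "k = 0" | "i = 2" "j = 0" "k = 1" | "i = 2" "j = 1" "k = 0"
proof -
  have "i \<in> {0,1,2}" "j \<in> {0,1,2}" "k \<in> {0,1,2}" using assms by (auto simp: idx_def)
  then show thesis using assms that by (auto simp: idx_def)
qed

lemma idx_perm: "idx i j k \<Longrightarrow> idx i k j" "idx i j k \<Longrightarrow> idx j i k" "idx i j k \<Longrightarrow> idx j k i"
  "idx i j k \<Longrightarrow> idx k i j" "idx i j k \<Longrightarrow> idx k j i"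
  by (auto simp: idx_def)

lemma idx_exists: "i < 3 \<Longrightarrow> \<exists>j k. idx i j k"
proof -
  assume "i < 3"
  then consider "i = 0" | "i = 1" | "i = 2" by linarith
  then show ?thesis
  proof cases
    case 1 then show ?thesis by (intro exI[of _ 1] exI[of _ 2]) (simp add: idx_def)
  next
    case 2 then show ?thesis by (intro exI[of _ 0] exI[of _ 2]) (simp add: idx_def)
  next
    case 3 then show ?thesis by (intro exI[of _ 0] exI[of _ 1]) (simp add: idx_def)
  qed
qed

lemma idx_third: "i < 3 \<Longrightarrow> j < 3 \<Longrightarrow> i \<noteq> j \<Longrightarrow> \<exists>k. idx i j k"
proof -
  assume h: "i < 3" "j < 3" "i \<noteq> j"
  then have "idx i j (3 - i - j)" unfolding idx_def by presburger
  then show ?thesis ..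
qed

lemma ht_sum: "idx i j k \<Longrightarrow> ht i z + ht j z + ht k z = 0"
  by (erule idx_cases) (auto simp: ht_def)

lemma ht_norm:
  assumes "idx i j k"
  shows "(norm z)\<^sup>2 = 2 / 3 * ((ht i z)\<^sup>2 + (ht j z)\<^sup>2 + (ht k z)\<^sup>2)"
proof -
  have "(norm z)\<^sup>2 = 2 / 3 * ((ht 0 z)\<^sup>2 + (ht 1 z)\<^sup>2 + (ht 2 z)\<^sup>2)"
    using cmod_power2[of z] by (simp add: ht_def power2_eq_square algebra_simps)
  with assms show ?thesis by (auto elim!: idx_cases)
qed

text \<open>Two of the heights are linear coordinates, so their determinant is a fixed multiple of
  the cross product. The sign of \<open>c\<close> depends on the permutation; the uses need only
  non-parallelism and ratios.\<close>

lemma ht_cr: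
  assumes "idx i j k"
  obtains c where "c \<noteq> 0" "\<And>a b. ht j a * ht k b - ht k a * ht j b = c * cr a b"
proof -
  have "ht 1 a * ht 2 b - ht 2 a * ht 1 b = (sqrt 3 / 2) * cr a b"
       "ht 2 a * ht 0 b - ht 0 a * ht 2 b = (sqrt 3 / 2) * cr a b"
       "ht 0 a * ht 1 b - ht 1 a * ht 0 b = (sqrt 3 / 2) * cr a b" for a b
    by (simp_all add: ht_def cr_eq algebra_simps)
  note e = this
  have e': "ht 2 a * ht 1 b - ht 1 a * ht 2 b = - (sqrt 3 / 2) * cr a b"
       "ht 0 a * ht 2 b - ht 2 a * ht 0 b = - (sqrt 3 / 2) * cr a b"
       "ht 1 a * ht 0 b - ht 0 a * ht 1 b = - (sqrt 3 / 2) * cr a b" for a b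
    using e[of a b] by linarith+
  show thesis using assms
  proof (cases rule: idx_cases)
    case 1 then show ?thesis using that[of "sqrt 3 / 2"] e by simp
  next
    case 2 then show ?thesis using that[of "- (sqrt 3 / 2)"] e' by simp
  next
    case 3 then show ?thesis using that[of "- (sqrt 3 / 2)"] e' by simp
  next
    case 4 then show ?thesis using that[of "sqrt 3 / 2"] e by simp
  next
    case 5 then show ?thesis using that[of "sqrt 3 / 2"] e by simp
  next
    case 6 then show ?thesis using that[of "- (sqrt 3 / 2)"] e' by simp
  qed
qed

text \<open>The open positive cone; \<open>pos i (u - v)\<close> puts \<open>v\<close> into the
  negative cone \<open>i\<close> of \<open>u\<close>. In general position no two vertices differ by
  a boundary direction.\<close>

definition pos :: "nat \<Rightarrow> complex \<Rightarrow> bool" where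
  "pos i d \<longleftrightarrow> i < 3 \<and> ht i d > 0 \<and> (\<forall>j<3. j \<noteq> i \<longrightarrow> ht j d < 0)"

lemma pos_idx:
  assumes "idx i j k"
  shows "pos i d \<longleftrightarrow> ht j d < 0 \<and> ht k d < 0"
proof -
  have other: "m = j \<or> m = k" if "m < 3" "m \<noteq> i" for m using assms that unfolding idx_def by linarith
  have lt: "i < 3" "j < 3" "k < 3" "j \<noteq> i" "k \<noteq> i" using assms by (auto simp: idx_def)
  have "pos i d \<longleftrightarrow> ht i d > 0 \<and> ht j d < 0 \<and> ht k d < 0"
    unfolding pos_def using other lt by blast
  then show ?thesis using ht_sum[OF assms, of d] by linarith
qed

lemma pos_ht: "pos i d \<Longrightarrow> ht i d > 0"
  by (simp add: pos_def)

lemma pos_comb: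
  assumes "pos i a" "pos i b" "x \<ge> 0" "y \<ge> 0" "x + y > 0"
  shows "pos i (x *\<^sub>R a + y *\<^sub>R b)"
proof -
  have *: "x * s + y * t < 0" if "s < 0" "t < 0" for s t :: real
  proof (cases "x > 0")
    case True
    then have "x * s < 0" "y * t \<le> 0" using that assms by (auto simp: mult_pos_neg mult_nonneg_nonpos)
    then show ?thesis by simp
  next
    case False
    then show ?thesis using assms that by (auto simp: mult_pos_neg)
  qed
  have "ht i (x *\<^sub>R a + y *\<^sub>R b) > 0"
    using *[of "- ht i a" "- ht i b"] assms by (simp add: pos_def)
  moreover have "ht j (x *\<^sub>R a + y *\<^sub>R b) < 0" if "j < 3" "j \<noteq> i" for j
    using *[of "ht j a" "ht j b"] assms that by (simp add: pos_def)
  ultimately show ?thesis using assms(1) by (simp add: pos_def)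
qed

lemma pos_scale: "pos i a \<Longrightarrow> x > 0 \<Longrightarrow> pos i (x *\<^sub>R a)"
  using pos_comb[of i a a x 0] by simp

lemma cr_three: "cr b c *\<^sub>R a + cr c a *\<^sub>R b + cr a b *\<^sub>R c = 0"
  by (simp add: complex_eq_iff cr_eq algebra_simps)

lemma in_cone_of_cr:
  assumes "cr b c > 0 \<and> cr c a \<le> 0 \<and> cr a b \<le> 0 \<or> cr b c < 0 \<and> cr c a \<ge> 0 \<and> cr a b \<ge> 0"
  shows "\<exists>x y. x \<ge> 0 \<and> y \<ge> 0 \<and> a = x *\<^sub>R b + y *\<^sub>R c"
proof -
  have nz: "cr b c \<noteq> 0" using assms by auto
  have "a = (cr a c / cr b c) *\<^sub>R b + (cr b a / cr b c) *\<^sub>R c" by (rule cr_expand[OF nz])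
  moreover have "cr a c / cr b c \<ge> 0" "cr b a / cr b c \<ge> 0"
    using assms cr_commute[of a c] cr_commute[of b a] by (auto simp: divide_le_0_iff)
  ultimately show ?thesis by blast
qed

text \<open>By \<open>cr_three\<close> the cross products, weighted with the positive heights, sum
  to zero, so they do not all have the same sign. The pair whose sign stands alone consists of the
  two outer vectors.\<close>

lemma cone_three:
  assumes "ht i a > 0" "ht i b > 0" "ht i c > 0" "cr a b \<noteq> 0" "cr b c \<noteq> 0" "cr c a \<noteq> 0"
  shows "(\<exists>x y. x \<ge> 0 \<and> y \<ge> 0 \<and> a = x *\<^sub>R b + y *\<^sub>R c) \<or>
         (\<exists>x y. x \<ge> 0 \<and> y \<ge> 0 \<and> b = x *\<^sub>R c + y *\<^sub>R a) \<or>
         (\<exists>x y. x \<ge> 0 \<and> y \<ge> 0 \<and> c = x *\<^sub>R a + y *\<^sub>R b)"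
proof -
  have "ht i (cr b c *\<^sub>R a + cr c a *\<^sub>R b + cr a b *\<^sub>R c) = 0" by (simp only: cr_three ht_zero)
  then have eq: "cr b c * ht i a + cr c a * ht i b + cr a b * ht i c = 0" by simp
  have "\<not> (cr b c > 0 \<and> cr c a > 0 \<and> cr a b > 0)"
  proof
    assume "cr b c > 0 \<and> cr c a > 0 \<and> cr a b > 0"
    then have "cr b c * ht i a > 0" "cr c a * ht i b > 0" "cr a b * ht i c > 0" using assms by auto
    with eq show False by linarith
  qed
  moreover have "\<not> (cr b c < 0 \<and> cr c a < 0 \<and> cr a b < 0)"
  proof
    assume "cr b c < 0 \<and> cr c a < 0 \<and> cr a b < 0"
    then have "cr b c * ht i a < 0" "cr c a * ht i b < 0" "cr a b * ht i c < 0"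
      using assms by (auto simp: mult_neg_pos)
    with eq show False by linarith
  qed
  ultimately consider
      "cr b c > 0 \<and> cr c a \<le> 0 \<and> cr a b \<le> 0 \<or> cr b c < 0 \<and> cr c a \<ge> 0 \<and> cr a b \<ge> 0"
    | "cr c a > 0 \<and> cr a b \<le> 0 \<and> cr b c \<le> 0 \<or> cr c a < 0 \<and> cr a b \<ge> 0 \<and> cr b c \<ge> 0"
    | "cr a b > 0 \<and> cr b c \<le> 0 \<and> cr c a \<le> 0 \<or> cr a b < 0 \<and> cr b c \<ge> 0 \<and> cr c a \<ge> 0"
    using assms(4-6) by linarith
  then show ?thesis
    by cases (use in_cone_of_cr[of b c a] in_cone_of_cr[of c a b] in_cone_of_cr[of a b c] in blast)+
qed

lemma not_splits_self:
  assumes "\<And>P. P \<in> S \<Longrightarrow> closed_segment u v \<inter> obstacle_interior P = {}"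
  shows "\<not> splits S u v v"
  by (rule free_triangle_not_splits) (use assms in \<open>simp add: segment_convex_hull\<close>)

text \<open>The direction into the obstacle cannot be that of \<open>v\<close>, because the segment
  to \<open>v\<close> is free; so it lies strictly on one side of \<open>v\<close>.\<close>

lemma splits_between:
  assumes sp: "splits S u w w'"
    and v: "\<And>P. P \<in> S \<Longrightarrow> closed_segment u v \<inter> obstacle_interior P = {}"
    and vu: "v - u = x *\<^sub>R (w - u) + y *\<^sub>R (w' - u)" "x \<ge> 0" "y \<ge> 0" "v \<noteq> u"
  shows "splits S u w v \<or> splits S u v w'"
proof -
  obtain P \<alpha> \<beta> \<epsilon> where P: "P \<in> S" "u \<in> set P" "\<alpha> > 0" "\<beta> > 0" "\<epsilon> > 0"
    and I: "\<And>t. 0 < t \<Longrightarrow> t < \<epsilon> \<Longrightarrow> u + t *\<^sub>R (\<alpha> *\<^sub>R (w - u) + \<beta> *\<^sub>R (w' - u)) \<in> obstacle_interior P"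
    using sp unfolding splits_def by blast
  let ?d = "\<alpha> *\<^sub>R (w - u) + \<beta> *\<^sub>R (w' - u)"
  have spl: "splits S u a b" if "?d = \<xi> *\<^sub>R (a - u) + \<eta> *\<^sub>R (b - u)" "\<xi> > 0" "\<eta> > 0" for a b \<xi> \<eta>
    unfolding splits_def using P(1,2,5) I that by metis
  have xy: "x > 0 \<or> y > 0"
  proof (rule ccontr)
    assume "\<not> (x > 0 \<or> y > 0)"
    then have "x = 0" "y = 0" using vu by auto
    then show False using vu by simp
  qed
  consider "\<alpha> * y > \<beta> * x" | "\<alpha> * y < \<beta> * x" | "\<alpha> * y = \<beta> * x" by linarith
  then show ?thesis
  proof cases
    case 1
    then have y: "y > 0" using P vu by (smt (verit) mult_nonneg_nonneg mult_nonneg_nonpos)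
    have "?d = (\<alpha> - \<beta> * x / y) *\<^sub>R (w - u) + (\<beta> / y) *\<^sub>R (v - u)"
      unfolding vu(1) using y by (simp add: algebra_simps)
    moreover have "\<alpha> - \<beta> * x / y > 0" "\<beta> / y > 0" using 1 y P by (auto simp: field_simps)
    ultimately show ?thesis using spl by blast
  next
    case 2
    then have x: "x > 0" using P vu by (smt (verit) mult_nonneg_nonneg mult_nonneg_nonpos)
    have "?d = (\<alpha> / x) *\<^sub>R (v - u) + (\<beta> - \<alpha> * y / x) *\<^sub>R (w' - u)"
      unfolding vu(1) using x by (simp add: algebra_simps)
    moreover have "\<alpha> / x > 0" "\<beta> - \<alpha> * y / x > 0" using 2 x P by (auto simp: field_simps)
    ultimately show ?thesis using spl by blast
  next
    case 3
    then have xp: "x > 0" and yp: "y > 0" using xy P vu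
      by (metis less_eq_real_def mult_eq_0_iff mult_zero_right order_less_irrefl)+
    have "\<beta> = \<alpha> / x * y" using 3 xp by (simp add: field_simps)
    then have d: "?d = (\<alpha> / x) *\<^sub>R (v - u)" unfolding vu(1) using xp by (simp add: scaleR_add_right)
    have "0 < min \<epsilon> (x / \<alpha>)" using P xp by simp
    then obtain t where "0 < t" "t < min \<epsilon> (x / \<alpha>)" using dense by blast
    then have t: "0 < t" "t < \<epsilon>" "t * (\<alpha> / x) < 1" using P xp by (auto simp: field_simps)
    have "u + (t * (\<alpha> / x)) *\<^sub>R (v - u) \<in> closed_segment u v"
      using t P xp by (intro closed_segment_paramI) auto
    then have False using I[OF t(1,2)] v[OF P(1)] unfolding d by auto
    then show ?thesis ..
  qed
qed

section \<open>Arcs of the half-theta graph and their crossings\<close>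

context polygon_scene
begin

definition vis :: "complex \<Rightarrow> complex \<Rightarrow> bool" where
  "vis u v \<longleftrightarrow> u \<in> V \<and> v \<in> V \<and> u \<noteq> v \<and> free (closed_segment u v)"

text \<open>Heights of \<open>v\<close> and \<open>w\<close> themselves are compared, since
  subtracting the height of \<open>u\<close> changes both sides alike.\<close>

definition cone_arc :: "nat \<Rightarrow> complex \<Rightarrow> complex \<Rightarrow> bool" where
  "cone_arc i u v \<longleftrightarrow> vis u v \<and> pos i (v - u) \<and>
     (\<forall>w. vis u w \<and> pos i (w - u) \<and> \<not> splits S u v w \<longrightarrow> ht i v \<le> ht i w)"

lemma vis_edge_iff: "vis_edge V S u v \<longleftrightarrow> vis u v"
  by (simp add: vis_edge_def vis_def visible_iff_free)

lemma vis_sym: "vis u v \<longleftrightarrow> vis v u"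
  by (auto simp: vis_def closed_segment_commute)

lemma arc_vis: "cone_arc i u v \<Longrightarrow> vis u v" and arc_pos: "cone_arc i u v \<Longrightarrow> pos i (v - u)"
  by (auto simp: cone_arc_def)

text \<open>The zero lines of \<open>ht 0\<close>, \<open>ht 2\<close> and \<open>ht 1\<close> have
  the directions 0, pi/3 and 2 pi/3 of the general position assumption.\<close>

lemma gen_pos_ht:
  assumes "u \<in> V" "v \<in> V" "u \<noteq> v" "k < 3"
  shows "ht k u \<noteq> ht k v"
proof -
  have gp: "Im ((v - u) / cis (real m * pi / 3)) \<noteq> 0" if "m < 3" for m :: nat
    using scene assms that unfolding scene_def general_position_def by blast
  have im: "Im (z / cis \<phi>) = Im z * cos \<phi> - Re z * sin \<phi>" for z \<phi>
    by (simp add: divide_inverse)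
  have c: "cos (2 * pi / 3) = - (1/2)" "sin (2 * pi / 3) = sqrt 3 / 2"
    using cos_120 sin_120 by (simp_all add: mult.commute)
  consider "k = 0" | "k = 1" | "k = 2" using assms(4) by linarith
  then show ?thesis
  proof cases
    case 1 then show ?thesis using gp[of 0] by (auto simp: im ht_def)
  next
    case 2
    have "Im ((v - u) / cis (2 * pi / 3)) \<noteq> 0" using gp[of 2] by simp
    then have "Im (v - u) * - (1/2) - Re (v - u) * (sqrt 3 / 2) \<noteq> 0" unfolding im c .
    moreover have "Im (v - u) * - (1/2) - Re (v - u) * (sqrt 3 / 2) = ht 1 v - ht 1 u"
      by (simp add: ht_def field_simps)
    ultimately have "ht 1 v - ht 1 u \<noteq> 0" by argo
    then show ?thesis using 2 by simp
  next
    case 3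
    have "(1::nat) < 3" by simp
    from gp[OF this] have "Im ((v - u) / cis (pi / 3)) \<noteq> 0" by (simp only: of_nat_1 mult_1_left not_False_eq_True)
    then have "Im (v - u) * (1/2) - Re (v - u) * (sqrt 3 / 2) \<noteq> 0" unfolding im cos_60 sin_60 .
    moreover have "Im (v - u) * (1/2) - Re (v - u) * (sqrt 3 / 2) = - (ht 2 v - ht 2 u)"
      by (simp add: ht_def field_simps)
    ultimately have "ht 2 v - ht 2 u \<noteq> 0" by argo
    then show ?thesis using 3 by simp
  qed
qed

lemma not_splits_vis: "vis u v \<Longrightarrow> \<not> splits S u v v"
  by (rule not_splits_self) (auto simp: vis_def free_def)

text \<open>This makes the subcones of a cone equivalence classes. In a half-plane one of three
  directions lies between the other two, and each of the three cases is settled by widening or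
  dividing an angle. For directions that surround \<open>u\<close> there is no such order.\<close>

lemma not_splits_trans:
  assumes v: "vis u v" "vis u w" "vis u x" and h: "ht i (v - u) > 0" "ht i (w - u) > 0" "ht i (x - u) > 0"
    and n: "\<not> splits S u w v" "\<not> splits S u v x"
  shows "\<not> splits S u w x"
proof
  assume sp: "splits S u w x"
  have V: "u \<in> V" "v \<in> V" "w \<in> V" "x \<in> V" "v \<noteq> u" "w \<noteq> u" "x \<noteq> u" using v by (auto simp: vis_def)
  have ne: "w \<noteq> v" "v \<noteq> x" using sp n by auto
  have "w \<noteq> x" using sp not_splits_vis v by blast
  then have nc: "cr (v - u) (w - u) \<noteq> 0" "cr (w - u) (x - u) \<noteq> 0" "cr (x - u) (v - u) \<noteq> 0"
    using noncollinear V ne by metis+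
  from cone_three[OF h nc]
  consider a b where "a \<ge> 0" "b \<ge> 0" "v - u = a *\<^sub>R (w - u) + b *\<^sub>R (x - u)"
    | a b where "a \<ge> 0" "b \<ge> 0" "w - u = a *\<^sub>R (x - u) + b *\<^sub>R (v - u)"
    | a b where "a \<ge> 0" "b \<ge> 0" "x - u = a *\<^sub>R (v - u) + b *\<^sub>R (w - u)" by blast
  then show False
  proof cases
    case 1
    have "free (closed_segment u v)" using v by (simp add: vis_def)
    then show False using splits_between[OF sp _ 1(3,1,2) V(5)] n unfolding free_def by blast
  next
    case 2
    have "b \<noteq> 0"
    proof
      assume "b = 0"
      then have "w - u = a *\<^sub>R (x - u)" using 2 by simp
      then have "cr (w - u) (x - u) = 0" by simp
      then show False using nc by simp
    qed
    then have "splits S u x v" using splits_mono[OF splits_commute[OF sp] 2(3)] 2 by simp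
    then show False using n splits_commute by blast
  next
    case 3
    have "a \<noteq> 0"
    proof
      assume "a = 0"
      then have "x - u = b *\<^sub>R (w - u)" using 3 by simp
      then have "cr (w - u) (x - u) = 0" by simp
      then show False using nc by simp
    qed
    moreover have e: "x - u = b *\<^sub>R (w - u) + a *\<^sub>R (v - u)" using 3(3) by (simp add: add.commute)
    ultimately have "splits S u w v" using splits_mono[OF sp e] 3(1,2) by simp
    then show False using n by blast
  qed
qed

text \<open>The target is the lowest vertex in the subcone of \<open>w\<close>; transitivity
  identifies the subcone of that target with the one of \<open>w\<close>.\<close>

lemma arc_exists:
  assumes "vis u w" "pos i (w - u)"
  obtains v where "cone_arc i u v" "\<not> splits S u v w"
proof -
  define W where "W = {v. vis u v \<and> pos i (v - u) \<and> \<not> splits S u w v}"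
  have "W \<subseteq> V" by (auto simp: W_def vis_def)
  then have fin: "finite W" using finite_V finite_subset by blast
  have "w \<in> W" using assms not_splits_vis by (simp add: W_def)
  then have "Min (ht i ` W) \<in> ht i ` W" using fin by (intro Min_in) auto
  then obtain v where v: "v \<in> W" "ht i v = Min (ht i ` W)" by auto
  have "ht i v \<le> ht i x" if x: "vis u x" "pos i (x - u)" "\<not> splits S u v x" for x
  proof -
    have vv: "vis u v" "pos i (v - u)" "\<not> splits S u w v" using v(1) by (auto simp: W_def)
    have "\<not> splits S u w x"
      by (rule not_splits_trans[OF vv(1) assms(1) x(1) pos_ht[OF vv(2)] pos_ht[OF assms(2)]
            pos_ht[OF x(2)] vv(3) x(3)])
    then have "x \<in> W" using x by (simp add: W_def)
    then show ?thesis using v(2) fin by simp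
  qed
  then have "cone_arc i u v" using v(1) by (simp add: cone_arc_def W_def)
  moreover have "\<not> splits S u v w" using v(1) splits_commute by (auto simp: W_def)
  ultimately show thesis by (rule that)
qed

text \<open>\<open>first_vertex\<close> with the apex \<open>p\<close> on the segment from
  \<open>a\<close> to \<open>v\<close>: the vertex \<open>v\<close> itself for \<open>l = 1\<close>,
  a crossing point for \<open>l < 1\<close>.\<close>

lemma visible_between:
  assumes av: "vis a v" and p: "p = a + l *\<^sub>R (v - a)" "0 < l" "l \<le> 1"
    and b: "b \<in> V" "free (closed_segment p b)"
    and apex: "good_apex p a b" and nc: "cr (a - p) (b - p) \<noteq> 0"
  obtains t m \<beta> where "vis a t" "\<not> splits S a v t" "t - a = m *\<^sub>R (v - a) + \<beta> *\<^sub>R (b - a)"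
    "0 \<le> m" "0 < \<beta>" "m + \<beta> \<le> 1"
proof -
  have V: "a \<in> V" "v \<in> V" "a \<noteq> v" and fr: "free (closed_segment a v)"
    using av by (auto simp: vis_def)
  have pin: "p \<in> closed_segment a v" unfolding p(1) using p by (intro closed_segment_paramI) auto
  then have sub: "closed_segment p a \<subseteq> closed_segment a v" by (simp add: closed_segment_subset)
  have Vpa: "V \<inter> closed_segment p a \<subseteq> {p, a}"
  proof
    fix q assume q: "q \<in> V \<inter> closed_segment p a"
    then have "q = a \<or> q = v" using sub vertex_on_segment[OF V(1,2)] by blast
    moreover have "v = p" if "v \<in> closed_segment p a"
    proof -
      have "v \<in> closed_segment a p" using that by (simp add: closed_segment_commute)
      then obtain s where s: "0 \<le> s" "s \<le> 1" "v = a + s *\<^sub>R (p - a)" by (rule closed_segment_param)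
      have "v - a = s *\<^sub>R (p - a)" using s(3) by (metis add_diff_cancel_left')
      also have "p - a = l *\<^sub>R (v - a)" unfolding p(1) by simp
      finally have "v - a = (s * l) *\<^sub>R (v - a)" by simp
      then have "(1 - s * l) *\<^sub>R (v - a) = 0" by (simp add: algebra_simps)
      then have "s * l = 1" using V by simp
      then have "l = 1" using s p by (smt (verit) mult_left_le_one_le)
      then show ?thesis using p(1) by simp
    qed
    ultimately show "q \<in> {p, a}" using q by blast
  qed
  obtain t \<alpha> \<beta> where t: "t \<in> V" "t \<noteq> a" "t = p + \<alpha> *\<^sub>R (a - p) + \<beta> *\<^sub>R (b - p)"
    "0 \<le> \<alpha>" "0 < \<beta>" "\<alpha> + \<beta> \<le> 1" "free (convex hull {p, a, t})"
    using first_vertex[OF V(1) b(1) nc free_mono[OF fr sub] b(2) Vpa apex] by metis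
  have ta: "t - a = ((1 - \<alpha> - \<beta>) * l) *\<^sub>R (v - a) + \<beta> *\<^sub>R (b - a)"
  proof -
    have "t - a = (1 - \<alpha> - \<beta>) *\<^sub>R (p - a) + \<beta> *\<^sub>R (b - a)" unfolding t(3) by (simp add: algebra_simps)
    also have "p - a = l *\<^sub>R (v - a)" unfolding p(1) by simp
    finally show ?thesis by simp
  qed
  have m: "0 \<le> (1 - \<alpha> - \<beta>) * l" "(1 - \<alpha> - \<beta>) * l + \<beta> \<le> 1"
    using t p mult_left_le[of l "1 - \<alpha> - \<beta>"] by auto
  have vist: "vis a t" using t V free_mono[OF t(7)] segment_subset_hull3(3)[of a t p]
    by (auto simp: vis_def)
  have "\<not> splits S a p t"
    using t(7) by (intro free_triangle_not_splits) (auto simp: free_def insert_commute)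
  moreover have "splits S a p t" if "splits S a v t"
  proof -
    have "p - a = l *\<^sub>R (v - a)" unfolding p(1) by simp
    then have "v - a = 0 *\<^sub>R (t - a) + (1 / l) *\<^sub>R (p - a)" using p by simp
    from splits_mono[OF splits_commute[OF that] this] p splits_commute show ?thesis by simp
  qed
  ultimately have "\<not> splits S a v t" by blast
  from that[OF vist this ta m(1) t(5) m(2)] show thesis .
qed

text \<open>The height of \<open>t\<close> over \<open>a\<close> combines those of \<open>v\<close>
  and \<open>b\<close> with total weight at most 1 and positive weight on the lower point
  \<open>b\<close>, so \<open>t\<close> would be a better target than \<open>v\<close>.\<close>

lemma arc_minimal:
  assumes arc: "cone_arc i a v" and b: "pos i (b - a)" "ht i b < ht i v"
    and t: "vis a t" "\<not> splits S a v t" "t - a = m *\<^sub>R (v - a) + \<beta> *\<^sub>R (b - a)"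
      "0 \<le> m" "0 < \<beta>" "m + \<beta> \<le> 1"
  shows False
proof -
  have pv: "pos i (v - a)" using arc by (simp add: cone_arc_def)
  have "pos i (t - a)" unfolding t(3) using pv b t by (intro pos_comb) auto
  then have "ht i v \<le> ht i t" using arc t unfolding cone_arc_def by blast
  then have "ht i (v - a) \<le> ht i (t - a)" by simp
  also have "\<dots> = m * ht i (v - a) + \<beta> * ht i (b - a)" unfolding t(3) by simp
  also have "\<dots> < m * ht i (v - a) + \<beta> * ht i (v - a)" using b t by simp
  also have "\<dots> = (m + \<beta>) * ht i (v - a)" by (simp add: algebra_simps)
  also have "\<dots> \<le> ht i (v - a)" using t pos_ht[OF pv] by (simp add: mult_left_le_one_le t(5) less_imp_le)
  finally show False by simp
qed

lemma arc_blocks: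
  assumes arc: "cone_arc i a v" and p: "p = a + l *\<^sub>R (v - a)" "0 < l" "l \<le> 1"
    and b: "b \<in> V" "pos i (b - a)" "ht i b < ht i v" "free (closed_segment p b)"
    and apex: "good_apex p a b" and nc: "cr (a - p) (b - p) \<noteq> 0"
  shows False
proof -
  obtain t m \<beta> where "vis a t" "\<not> splits S a v t" "t - a = m *\<^sub>R (v - a) + \<beta> *\<^sub>R (b - a)"
    "0 \<le> m" "0 < \<beta>" "m + \<beta> \<le> 1"
    using visible_between[OF arc_vis[OF arc] p b(1,4) apex nc] .
  then show False by (rule arc_minimal[OF arc b(2,3)])
qed

text \<open>In general position two segments with a common inner point coincide as soon as they
  share an end or a line.\<close>

lemma crossing_distinct:
  assumes V: "a \<in> V" "b \<in> V" "c \<in> V" "d \<in> V"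
    and p: "p \<in> open_segment a b" "p \<in> open_segment c d" and ne: "{a, b} \<noteq> {c, d}"
  shows "a \<noteq> c" "a \<noteq> d" "b \<noteq> c" "b \<noteq> d" "cr (b - a) (d - c) \<noteq> 0" "p \<notin> V"
proof -
  obtain s where s: "0 < s" "s < 1" "p = a + s *\<^sub>R (b - a)" "a \<noteq> b" using p(1) by (rule open_segment_param)
  obtain t where t: "0 < t" "t < 1" "p = c + t *\<^sub>R (d - c)" "c \<noteq> d" using p(2) by (rule open_segment_param)
  show "p \<notin> V" using vertex_on_segment[OF V(1,2), of p] p(1) by (auto simp: open_segment_def)
  show nc: "cr (b - a) (d - c) \<noteq> 0"
  proof
    assume "cr (b - a) (d - c) = 0"
    then obtain k where k: "d - c = k *\<^sub>R (b - a)" using s(4) by (metis cr_zero_parallel right_minus_eq)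
    have on: "x = a \<or> x = b" if "x \<in> V" "x - a = m *\<^sub>R (b - a)" for x m
    proof (rule ccontr)
      assume "\<not> (x = a \<or> x = b)"
      then have "cr (b - a) (x - a) \<noteq> 0" using noncollinear[of a b x] V that s(4) by auto
      then show False unfolding that(2) by simp
    qed
    have "c - a = (p - a) - (p - c)" by simp
    also have "p - a = s *\<^sub>R (b - a)" using s(3) by simp
    also have "p - c = (t * k) *\<^sub>R (b - a)" using t(3) k by simp
    finally have c: "c - a = (s - t * k) *\<^sub>R (b - a)" by (simp add: algebra_simps)
    have "d - a = (d - c) + (c - a)" by simp
    also have "\<dots> = (k + (s - t * k)) *\<^sub>R (b - a)" unfolding c k by (simp add: algebra_simps)
    finally have "d = a \<or> d = b" using on V by blast
    moreover have "c = a \<or> c = b" using on V c by blast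
    ultimately show False using ne t(4) s(4) by blast
  qed
  have sh: "x \<noteq> y" if "p - x = m *\<^sub>R (b - a)" "p - y = n *\<^sub>R (d - c)" "m \<noteq> 0" for x y m n
  proof
    assume "x = y"
    then have "m *\<^sub>R (b - a) = n *\<^sub>R (d - c)" using that by simp
    then have "cr (m *\<^sub>R (b - a)) (d - c) = cr (n *\<^sub>R (d - c)) (d - c)" by simp
    then show False using nc that(3) by simp
  qed
  have e1: "p - a = s *\<^sub>R (b - a)" unfolding s(3) by simp
  have e2: "p - c = t *\<^sub>R (d - c)" unfolding t(3) by simp
  note e = e1 e2
  have e': "p - b = (s - 1) *\<^sub>R (b - a)" unfolding s(3) by (simp add: algebra_simps)
  have e'': "p - d = (t - 1) *\<^sub>R (d - c)" unfolding t(3) by (simp add: algebra_simps)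
  show "a \<noteq> c" "a \<noteq> d" "b \<noteq> c" "b \<noteq> d"
    using sh[OF e] sh[OF e(1) e''] sh[OF e' e(2)] sh[OF e' e''] s by auto
qed

text \<open>At a boundary point that is not a corner, both visible segments would have to run along
  the obstacle edge and so be parallel.\<close>

lemma crossing_not_on_boundary:
  assumes ab: "vis a b" and cd: "vis c d"
    and p: "p \<in> open_segment a b" "p \<in> open_segment c d" and nc: "cr (b - a) (d - c) \<noteq> 0"
    and pV: "p \<notin> V" and P: "P \<in> S"
  shows "p \<notin> poly_boundary P"
proof
  assume "p \<in> poly_boundary P"
  then obtain k where k: "k < length P" "p \<in> poly_edge P k" by (auto simp: poly_boundary_def)
  obtain x y where e: "poly_edge P k = closed_segment x y" "x \<in> V" "y \<in> V"
    using poly_edge_ends[OF P k(1)] by metis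
  have px: "p \<in> open_segment x y" using k(2) e pV by (auto simp: open_segment_def)
  have no: "cr (y - x) (g - f) = 0" if "vis f g" "p \<in> open_segment f g" for f g
  proof (rule ccontr)
    assume "cr (y - x) (g - f) \<noteq> 0"
    from crossing_edge_meets_interior[OF simple_S[OF P] k(1) e(1) px that(2) this]
    have "open_segment f g \<inter> obstacle_interior P \<noteq> {}" .
    then show False using that(1) P open_closed_segment unfolding vis_def free_def by fastforce
  qed
  have "y - x \<noteq> 0" using px by (auto simp: open_segment_def)
  then obtain m n where "b - a = m *\<^sub>R (y - x)" "d - c = n *\<^sub>R (y - x)"
    using no[OF ab p(1)] no[OF cd p(2)] by (metis cr_zero_parallel)
  then have "cr (b - a) (d - c) = 0" by simp
  then show False using nc by simp
qed

lemma crossing_visible: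
  assumes ac: "vis a c" and bd: "vis b d"
    and p: "p \<in> open_segment a c" "p \<in> open_segment b d" and ne: "{a, c} \<noteq> {b, d}"
  obtains t m \<beta> where "vis a t" "\<not> splits S a c t" "t - a = m *\<^sub>R (c - a) + \<beta> *\<^sub>R (b - a)"
    "0 \<le> m" "0 < \<beta>" "m + \<beta> \<le> 1"
proof -
  have V: "a \<in> V" "c \<in> V" "b \<in> V" "d \<in> V" using ac bd by (auto simp: vis_def)
  note D = crossing_distinct[OF V p ne]
  have good: "good_apex p a b"
    unfolding good_apex_def using crossing_not_on_boundary[OF ac bd p D(5,6)] by blast
  obtain s where s: "0 < s" "s < 1" "p = a + s *\<^sub>R (c - a)" using p(1) by (rule open_segment_param)
  obtain t where t: "0 < t" "t < 1" "p = b + t *\<^sub>R (d - b)" using p(2) by (rule open_segment_param)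
  have "a - p = (- s) *\<^sub>R (c - a)" unfolding s(3) by simp
  moreover have "b - p = (- t) *\<^sub>R (d - b)" unfolding t(3) by simp
  ultimately have "cr (a - p) (b - p) = s * t * cr (c - a) (d - b)" by simp
  then have nc: "cr (a - p) (b - p) \<noteq> 0" using s t D(5) by simp
  have "free (closed_segment b d)" using bd by (simp add: vis_def)
  moreover have "p \<in> closed_segment b d" using p(2) by (simp add: open_closed_segment)
  ultimately have "free (closed_segment p b)"
    by (elim free_mono) (simp add: closed_segment_subset)
  from visible_between[OF ac s(3,1) less_imp_le[OF s(2)] V(3) this good nc] that show thesis .
qed

lemma arc_cross_blocks:
  assumes arc: "cone_arc i a c" and bd: "vis b d"
    and p: "p \<in> open_segment a c" "p \<in> open_segment b d" and ne: "{a, c} \<noteq> {b, d}"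
    and b: "pos i (b - a)" "ht i b < ht i c"
  shows False
proof -
  obtain t m \<beta> where "vis a t" "\<not> splits S a c t" "t - a = m *\<^sub>R (c - a) + \<beta> *\<^sub>R (b - a)"
    "0 \<le> m" "0 < \<beta>" "m + \<beta> \<le> 1"
    using crossing_visible[OF arc_vis[OF arc] bd p ne] .
  then show False by (rule arc_minimal[OF arc b])
qed

text \<open>If two arcs cross, then an endpoint of one of them lies in the cone of the other and below
  its target.\<close>

lemma arcs_plane:
  assumes arcs: "cone_arc i u v" "cone_arc j u' v'"
    and p: "p \<in> open_segment u v" "p \<in> open_segment u' v'"
  shows "{u, v} = {u', v'}"
proof (rule ccontr)
  assume ne: "{u, v} \<noteq> {u', v'}"
  have V: "u \<in> V" "v \<in> V" "u' \<in> V" "v' \<in> V" and vs: "vis u v" "vis u' v'"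
    using arcs by (auto simp: cone_arc_def vis_def)
  note D = crossing_distinct[OF V p ne]
  have ne2: "{u, v} \<noteq> {v', u'}" "{u', v'} \<noteq> {u, v}" "{u', v'} \<noteq> {v, u}" using ne by (auto simp: insert_commute)
  have ps: "p \<in> open_segment v u" "p \<in> open_segment v' u'" using p by (simp_all add: open_segment_commute)
  have vs': "vis v u" "vis v' u'" using vs vis_sym by auto
  \<comment> \<open>The four ways in which an end of one segment lies in the cone of the other
    source and below its target. Once they are excluded, the signs of the heights of
    \<open>p\<close> relative to the four ends are contradictory by linear arithmetic.\<close>
  have b1: "\<not> (pos i (u' - u) \<and> ht i u' < ht i v)" using arc_cross_blocks[OF arcs(1) vs(2) p ne] by blast
  have b2: "\<not> (pos i (v' - u) \<and> ht i v' < ht i v)" using arc_cross_blocks[OF arcs(1) vs'(2) p(1) ps(2) ne2(1)] by blast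
  have b3: "\<not> (pos j (u - u') \<and> ht j u < ht j v')" using arc_cross_blocks[OF arcs(2) vs(1) p(2,1) ne2(2)] by blast
  have b4: "\<not> (pos j (v - u') \<and> ht j v < ht j v')" using arc_cross_blocks[OF arcs(2) vs'(1) p(2) ps(1) ne2(3)] by blast
  obtain s where s: "0 < s" "s < 1" "p = u + s *\<^sub>R (v - u)" using p(1) by (rule open_segment_param)
  obtain t where t: "0 < t" "t < 1" "p = u' + t *\<^sub>R (v' - u')" using p(2) by (rule open_segment_param)
  have "p - u = s *\<^sub>R (v - u)" unfolding s(3) by simp
  moreover have "p - u' = t *\<^sub>R (v' - u')" unfolding t(3) by simp
  moreover have "v - p = (1 - s) *\<^sub>R (v - u)" unfolding s(3) by (simp add: algebra_simps)
  moreover have "v' - p = (1 - t) *\<^sub>R (v' - u')" unfolding t(3) by (simp add: algebra_simps)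
  ultimately have q: "pos i (p - u)" "pos i (v - p)" "pos j (p - u')" "pos j (v' - p)"
    using pos_scale[OF arc_pos[OF arcs(1)]] pos_scale[OF arc_pos[OF arcs(2)]] s t by simp_all
  have ij: "i < 3" "j < 3" using arc_pos[OF arcs(1)] arc_pos[OF arcs(2)] by (auto simp: pos_def)
  show False
  proof (cases "i = j")
    case True
    obtain j' k' where id: "idx i j' k'" using idx_exists[OF ij(1)] by blast
    have "ht i v \<noteq> ht i v'" using gen_pos_ht V D(4) ij by blast
    with b2 b4 q show False
      unfolding True[symmetric] pos_idx[OF id] by (auto simp: not_less)
  next
    case False
    then obtain k where id: "idx i j k" using idx_third ij by blast
    note id' = idx_perm(2)[OF id]
    have g: "ht k u \<noteq> ht k u'" "ht i u' \<noteq> ht i v" "ht j u \<noteq> ht j v'"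
      using gen_pos_ht V D ij id by (auto simp: idx_def)
    note sums = ht_sum[OF id, of u] ht_sum[OF id, of v] ht_sum[OF id, of u'] ht_sum[OF id, of v'] ht_sum[OF id, of p]
    from b1 b2 b3 b4 q g sums show False
      unfolding pos_idx[OF id] pos_idx[OF id'] ht_diff by argo
  qed
qed

end

section \<open>Canonical paths and planarity\<close>

text \<open>A vector of a positive cone has two negative heights, its opposite has only one.\<close>

lemma pos_opposite: "pos i d \<Longrightarrow> \<not> pos j (- d)"
proof
  assume h: "pos i d" "pos j (- d)"
  have neg: "ht m (- d) = - ht m d" for m using ht_diff[of m 0 d] by simp
  have "i < 3" using h by (simp add: pos_def)
  then obtain j' k' where id: "idx i j' k'" using idx_exists by blast
  have "ht i d > 0" "ht j' d < 0" "ht k' d < 0" using h(1) id by (auto simp: pos_def idx_def)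
  moreover have "\<exists>m. m \<in> {j', k'} \<and> m \<noteq> j" using id by (auto simp: idx_def)
  then obtain m where "m \<in> {j', k'}" "m \<noteq> j" by blast
  moreover have "ht m (- d) < 0" using h(2) \<open>m \<noteq> j\<close> \<open>m \<in> {j', k'}\<close> id by (auto simp: pos_def idx_def)
  ultimately show False using neg by auto
qed

lemma pos_unique:
  assumes "pos i d" "pos j d"
  shows "i = j"
proof (rule ccontr)
  assume "i \<noteq> j"
  then have "ht i d < 0" "ht i d > 0" using assms by (auto simp: pos_def)
  then show False by simp
qed

context polygon_scene
begin

text \<open>Betweenness is expressed by positive coefficients instead of an orientation, which makes
  the relation symmetric in \<open>v\<close> and \<open>w\<close>. That \<open>x\<close> is in the
  same subcone follows by \<open>splits_mono\<close>.\<close>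

definition consec :: "nat \<Rightarrow> complex \<Rightarrow> complex \<Rightarrow> complex \<Rightarrow> bool" where
  "consec i u v w \<longleftrightarrow> cone_arc i v u \<and> cone_arc i w u \<and> v \<noteq> w \<and> \<not> splits S u v w \<and>
     \<not> (\<exists>x \<alpha> \<beta>. cone_arc i x u \<and> \<alpha> > 0 \<and> \<beta> > 0 \<and> x - u = \<alpha> *\<^sub>R (v - u) + \<beta> *\<^sub>R (w - u))"

lemma consec_sym:
  assumes "consec i u v w"
  shows "consec i u w v"
proof -
  have "\<not> (\<exists>x \<alpha> \<beta>. cone_arc i x u \<and> \<alpha> > 0 \<and> \<beta> > 0 \<and> x - u = \<alpha> *\<^sub>R (w - u) + \<beta> *\<^sub>R (v - u))"
  proof
    assume "\<exists>x \<alpha> \<beta>. cone_arc i x u \<and> \<alpha> > 0 \<and> \<beta> > 0 \<and> x - u = \<alpha> *\<^sub>R (w - u) + \<beta> *\<^sub>R (v - u)"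
    then obtain x \<alpha> \<beta> where x: "cone_arc i x u" "\<alpha> > 0" "\<beta> > 0" "x - u = \<alpha> *\<^sub>R (w - u) + \<beta> *\<^sub>R (v - u)"
      by blast
    have "x - u = \<beta> *\<^sub>R (v - u) + \<alpha> *\<^sub>R (w - u)" unfolding x(4) by (rule add.commute)
    then show False using assms x(1-3) unfolding consec_def by blast
  qed
  moreover have "cone_arc i w u" "cone_arc i v u" "w \<noteq> v" "\<not> splits S u w v"
    using assms splits_commute unfolding consec_def by blast+
  ultimately show ?thesis unfolding consec_def by blast
qed

text \<open>Otherwise \<open>v\<close> would lie in the cone of \<open>w\<close> and lower than the
  target \<open>u\<close>. The blocking argument applies with \<open>u\<close> itself as apex, where
  the angle is not split.\<close>

lemma siblings_not_pos:
  assumes v: "cone_arc i v u" and w: "cone_arc i w u" and ne: "v \<noteq> w" and n: "\<not> splits S u v w"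
  shows "\<not> pos i (v - w)"
proof
  assume p: "pos i (v - w)"
  have V: "v \<in> V" "w \<in> V" "u \<in> V" "v \<noteq> u" "w \<noteq> u" "free (closed_segment u v)"
    using v w by (auto simp: cone_arc_def vis_def closed_segment_commute)
  have "good_apex u w v" using V n splits_commute by (auto simp: good_apex_def)
  moreover have "cr (w - u) (v - u) \<noteq> 0" using noncollinear[of u w v] V ne by auto
  moreover have "ht i v < ht i u" using pos_ht[OF arc_pos[OF v]] by simp
  moreover have "u = w + 1 *\<^sub>R (u - w)" by simp
  ultimately show False using arc_blocks[OF w _ _ _ V(1) p _ V(6)] by (metis order_refl zero_less_one)
qed

text \<open>Neither sibling lies in the positive cone \<open>i\<close> of the other, so the two
  remaining heights order them oppositely. This is the monotonicity of the canonical path.\<close>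

lemma siblings_side:
  assumes id: "idx i j k" and v: "cone_arc i v u" and w: "cone_arc i w u" and ne: "v \<noteq> w" and n: "\<not> splits S u v w"
  shows "ht j w < ht j v \<and> ht k v < ht k w \<or> ht j v < ht j w \<and> ht k w < ht k v"
proof -
  have V: "v \<in> V" "w \<in> V" using v w by (auto simp: cone_arc_def vis_def)
  have "j < 3" "k < 3" using id by (auto simp: idx_def)
  then have g: "ht j v \<noteq> ht j w" "ht k v \<noteq> ht k w" using gen_pos_ht V ne by blast+
  have "\<not> pos i (v - w)" "\<not> pos i (w - v)"
    using siblings_not_pos[OF v w ne n] siblings_not_pos[OF w v] ne n splits_commute by blast+
  then show ?thesis using g unfolding pos_idx[OF id] ht_diff by linarith
qed

text \<open>Otherwise the highest vertex of the triangle that \<open>u\<close> sees has its own arc to \<open>u\<close>,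
  because this arc cannot leave the triangle.\<close>

lemma consec_triangle:
  assumes c: "consec i u v w"
  shows "V \<inter> convex hull {u, v, w} \<subseteq> {u, v, w} \<and> free (convex hull {u, v, w})"
proof -
  have v: "cone_arc i v u" and w: "cone_arc i w u" and ne: "v \<noteq> w" and ns: "\<not> splits S u v w"
    and nob: "\<And>x \<alpha> \<beta>. cone_arc i x u \<Longrightarrow> \<alpha> > 0 \<Longrightarrow> \<beta> > 0 \<Longrightarrow> x - u = \<alpha> *\<^sub>R (v - u) + \<beta> *\<^sub>R (w - u) \<Longrightarrow> False"
    using c unfolding consec_def by blast+
  have V: "v \<in> V" "w \<in> V" "u \<in> V" "v \<noteq> u" "w \<noteq> u" and fr: "free (closed_segment u v)" "free (closed_segment u w)"
    using v w by (auto simp: cone_arc_def vis_def closed_segment_commute)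
  have "i < 3" using arc_pos[OF v] by (simp add: pos_def)
  then obtain j0 k0 where id0: "idx i j0 k0" using idx_exists by blast
  obtain j k where id: "idx i j k" and jk: "ht j w < ht j v" "ht k v < ht k w"
    using siblings_side[OF id0 v w ne ns] id0 idx_perm(1)[OF id0] by blast
  have nc: "cr (v - u) (w - u) \<noteq> 0" using noncollinear[of u v w] V ne by auto
  have pv: "pos i (u - v)" "pos i (u - w)" using v w by (auto simp: cone_arc_def)
  then have hts: "ht j u < ht j v" "ht k u < ht k v" "ht j u < ht j w" "ht k u < ht k w"
    unfolding pos_idx[OF id] by auto
  \<comment> \<open>An arc in cone \<open>i\<close> that starts in the triangle cannot leave it
    through the side \<open>v w\<close>.\<close>
  have noup: "\<not> pos i (q - t)"
    if t: "t = u + \<alpha> *\<^sub>R (v - u) + \<beta> *\<^sub>R (w - u)" "\<alpha> \<ge> 0" "\<beta> \<ge> 0" "\<alpha> + \<beta> < 1"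
      and q: "q = u + \<xi> *\<^sub>R (v - u) + \<eta> *\<^sub>R (w - u)" "\<xi> + \<eta> = 1" for t q \<alpha> \<beta> \<xi> \<eta>
  proof -
    have eta: "\<eta> = 1 - \<xi>" using q(2) by simp
    have e: "ht m (q - t) = (\<xi> - \<alpha>) * (ht m v - ht m u) + (\<eta> - \<beta>) * (ht m w - ht m u)" for m
      unfolding t(1) q(1) by (simp add: algebra_simps)
    consider "\<xi> \<ge> \<alpha> \<and> \<eta> \<ge> \<beta>" | "\<xi> < \<alpha>" | "\<eta> < \<beta>" by linarith
    then show ?thesis
    proof cases
      case 1
      then have "(\<xi> - \<alpha>) * (ht j v - ht j u) \<ge> 0" "(\<eta> - \<beta>) * (ht j w - ht j u) \<ge> 0"
        using hts by (auto intro!: mult_nonneg_nonneg)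
      then show ?thesis unfolding pos_idx[OF id] e by linarith
    next
      case 2
      have "(\<xi> - \<alpha>) * (ht k v - ht k u) + (\<eta> - \<beta>) * (ht k w - ht k u)
          = (1 - \<alpha> - \<beta>) * (ht k w - ht k u) + (\<alpha> - \<xi>) * (ht k w - ht k v)"
        unfolding eta by (simp add: algebra_simps)
      moreover have "(1 - \<alpha> - \<beta>) * (ht k w - ht k u) > 0" "(\<alpha> - \<xi>) * (ht k w - ht k v) > 0"
        using 2 t hts jk by (auto intro!: mult_pos_pos)
      ultimately show ?thesis unfolding pos_idx[OF id] e by linarith
    next
      case 3
      have "(\<xi> - \<alpha>) * (ht j v - ht j u) + (\<eta> - \<beta>) * (ht j w - ht j u)
          = (1 - \<alpha> - \<beta>) * (ht j v - ht j u) + (\<beta> - \<eta>) * (ht j v - ht j w)"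
        unfolding eta by (simp add: algebra_simps)
      moreover have "(1 - \<alpha> - \<beta>) * (ht j v - ht j u) > 0" "(\<beta> - \<eta>) * (ht j v - ht j w) > 0"
        using 3 t hts jk by (auto intro!: mult_pos_pos)
      ultimately show ?thesis unfolding pos_idx[OF id] e by linarith
    qed
  qed
  have "V \<inter> closed_segment u v \<subseteq> {u, v}" using vertex_on_segment[OF V(3,1)] by blast
  moreover have "good_apex u v w" using V ns by (simp add: good_apex_def)
  ultimately obtain t \<alpha> \<beta> where t: "t \<in> V" "t \<noteq> v" "t \<noteq> u"
    "t = u + \<alpha> *\<^sub>R (v - u) + \<beta> *\<^sub>R (w - u)" "0 \<le> \<alpha>" "0 < \<beta>" "\<alpha> + \<beta> \<le> 1"
    "V \<inter> convex hull {u, v, t} \<subseteq> {u, v, t}" "free (convex hull {u, v, t})"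
    using first_vertex[OF V(1,2) nc fr] by metis
  show ?thesis
  proof (cases "t = w")
    case True
    then show ?thesis using t by simp
  next
    case False
    \<comment> \<open>The vertices strictly inside the triangle that \<open>u\<close> sees;
      \<open>t\<close> is one of them. The highest one, \<open>y\<close>, will be beaten by another
      member.\<close>
    define Z where "Z = {z \<in> V. free (closed_segment u z) \<and>
       (\<exists>\<alpha> \<beta>. z = u + \<alpha> *\<^sub>R (v - u) + \<beta> *\<^sub>R (w - u) \<and> 0 < \<alpha> \<and> 0 < \<beta> \<and> \<alpha> + \<beta> < 1)}"
    have "\<alpha> \<noteq> 0"
    proof
      assume "\<alpha> = 0"
      then have "t = u + \<beta> *\<^sub>R (w - u)" using t(4) by simp
      then have "t \<in> closed_segment u w" using closed_segment_paramI[of \<beta> u w] t \<open>\<alpha> = 0\<close> by simp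
      then show False using vertex_on_segment[OF V(3,2) t(1)] t False by blast
    qed
    moreover have "\<alpha> + \<beta> \<noteq> 1"
    proof
      assume ab: "\<alpha> + \<beta> = 1"
      then have "\<alpha> = 1 - \<beta>" by simp
      then have "t = u + (1 - \<beta>) *\<^sub>R (v - u) + \<beta> *\<^sub>R (w - u)" using t(4) by simp
      also have "\<dots> = v + \<beta> *\<^sub>R (w - v)" by (simp add: algebra_simps)
      finally have "t \<in> closed_segment v w" using closed_segment_paramI[of \<beta> v w] t(5,6) ab by simp
      then show False using vertex_on_segment[OF V(1,2) t(1)] t(2) False by blast
    qed
    ultimately have "0 < \<alpha>" "\<alpha> + \<beta> < 1" using t(5,7) by auto
    moreover have "free (closed_segment u t)" using t(9) free_mono segment_subset_hull3(2) by blast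
    ultimately have "t \<in> Z" unfolding Z_def using t(1,4,6) by blast
    moreover have finZ: "finite Z" unfolding Z_def using finite_V by simp
    ultimately have "Max (ht i ` Z) \<in> ht i ` Z" by (intro Max_in) auto
    then obtain y where y: "y \<in> Z" "ht i y = Max (ht i ` Z)" by auto
    have ymax: "ht i z \<le> ht i y" if "z \<in> Z" for z using that y(2) finZ by simp
    obtain a b where yc: "y = u + a *\<^sub>R (v - u) + b *\<^sub>R (w - u)" "0 < a" "0 < b" "a + b < 1"
      and yV: "y \<in> V" "free (closed_segment u y)" using y(1) unfolding Z_def by blast
    have yu: "u - y = a *\<^sub>R (u - v) + b *\<^sub>R (u - w)" unfolding yc(1) by (simp add: algebra_simps)
    have py: "pos i (u - y)" unfolding yu using pv yc by (intro pos_comb) auto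
    then have "y \<noteq> u" by (auto simp: pos_def)
    then have vy: "vis y u" using yV V by (simp add: vis_def closed_segment_commute)
    obtain z where z: "cone_arc i y z" "\<not> splits S y z u" using arc_exists[OF vy py] .
    have zV: "z \<in> V" "y \<noteq> z" "free (closed_segment y z)" using z by (auto simp: cone_arc_def vis_def)
    have pz: "pos i (z - y)" using z by (simp add: cone_arc_def)
    \<comment> \<open>An arc from \<open>y\<close> to \<open>u\<close> would put \<open>y\<close>
      between \<open>v\<close> and \<open>w\<close> in the canonical sequence.\<close>
    have zu: "z \<noteq> u"
    proof
      assume "z = u"
      moreover have "y - u = a *\<^sub>R (v - u) + b *\<^sub>R (w - u)" unfolding yc(1) by simp
      ultimately show False using nob z(1) yc by blast
    qed
    obtain \<xi> \<eta> where zc: "z = u + \<xi> *\<^sub>R (v - u) + \<eta> *\<^sub>R (w - u)" using triangle_coords[OF nc] .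
    \<comment> \<open>Leaving through the sides at \<open>u\<close> would cross the arc from
      \<open>v\<close> or from \<open>w\<close>, and \<open>noup\<close> closes the third
      side.\<close>
    have zin: "\<xi> > 0 \<and> \<eta> > 0 \<and> \<xi> + \<eta> < 1"
    proof (rule ccontr)
      assume "\<not> ?thesis"
      then obtain s \<xi>' \<eta>' where s: "0 < s" "s \<le> 1" "y + s *\<^sub>R (z - y) = u + \<xi>' *\<^sub>R (v - u) + \<eta>' *\<^sub>R (w - u)"
        "0 \<le> \<xi>'" "0 \<le> \<eta>'" "\<xi>' + \<eta>' \<le> 1" "\<xi>' = 0 \<or> \<eta>' = 0 \<or> \<xi>' + \<eta>' = 1"
        using triangle_exit[OF yc zc] by metis
      let ?q = "y + s *\<^sub>R (z - y)"
      have "?q - y = s *\<^sub>R (z - y)" by simp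
      then have pq: "pos i (?q - y)" using pos_scale[OF pz s(1)] by simp
      then have "\<xi>' + \<eta>' \<noteq> 1" using noup[OF yc(1) _ _ yc(4) s(3)] yc by auto
      then have s1: "\<xi>' + \<eta>' < 1" using s by simp
      have key: False if x: "?q = u + m *\<^sub>R (x - u)" "0 \<le> m" "m < 1" "cone_arc i x u" "y \<noteq> x" for x m
      proof -
        have xV: "x \<in> V" "x \<noteq> u" using x by (auto simp: cone_arc_def vis_def)
        have qx: "?q \<in> closed_segment u x" unfolding x(1) using x by (intro closed_segment_paramI) auto
        have "s \<noteq> 1"
        proof
          assume "s = 1"
          then have "z \<in> closed_segment u x" using qx by simp
          then have "z = x" using vertex_on_segment[OF V(3) xV(1) zV(1)] zu by blast
          then have "x = u + m *\<^sub>R (x - u)" using x(1) \<open>s = 1\<close> by simp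
          then have "(1 - m) *\<^sub>R (x - u) = 0" by (simp add: algebra_simps)
          then show False using x(3) xV by simp
        qed
        then have qyz: "?q \<in> open_segment y z" using s zV by (intro open_segment_paramI) auto
        have "m \<noteq> 0"
        proof
          assume "m = 0"
          then have "u \<in> open_segment y z" using x(1) qyz by simp
          then show False using vertex_on_segment[OF yV(1) zV(1) V(3)] \<open>y \<noteq> u\<close> zu
            by (auto simp: open_segment_def)
        qed
        then have "?q \<in> open_segment u x" unfolding x(1) using x xV by (intro open_segment_paramI) auto
        then have "?q \<in> open_segment x u" by (simp add: open_segment_commute)
        from arcs_plane[OF z(1) x(4) qyz this] show False using x(5) \<open>y \<noteq> u\<close> zu by blast
      qed
      have "y \<noteq> v"
      proof
        assume "y = v"
        then have "u + a *\<^sub>R (v - u) + b *\<^sub>R (w - u) = u + 1 *\<^sub>R (v - u) + 0 *\<^sub>R (w - u)" using yc(1) by simp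
        from triangle_coords_unique(2)[OF nc this] yc show False by simp
      qed
      moreover have "y \<noteq> w"
      proof
        assume "y = w"
        then have "u + a *\<^sub>R (v - u) + b *\<^sub>R (w - u) = u + 0 *\<^sub>R (v - u) + 1 *\<^sub>R (w - u)" using yc(1) by simp
        from triangle_coords_unique(1)[OF nc this] yc show False by simp
      qed
      moreover have "?q = u + \<eta>' *\<^sub>R (w - u)" if "\<xi>' = 0" using s(3) that by simp
      moreover have "?q = u + \<xi>' *\<^sub>R (v - u)" if "\<eta>' = 0" using s(3) that by simp
      moreover have "\<xi>' = 0 \<or> \<eta>' = 0" "\<xi>' < 1" "\<eta>' < 1" using s(4,5,7) s1 by auto
      ultimately show False using key[of \<eta>' w] key[of \<xi>' v] s(4,5) v w by blast
    qed
    \<comment> \<open>Rotating a ray about \<open>u\<close> from \<open>y\<close> towards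
      \<open>z\<close> yields a vertex \<open>x\<close> seen from \<open>u\<close>, inside the
      triangle and in cone \<open>i\<close> of \<open>y\<close>, hence higher than
      \<open>y\<close>.\<close>
    have "cr (u - y) (z - y) \<noteq> 0" using noncollinear[of y u z] yV zV V \<open>y \<noteq> u\<close> zu by auto
    moreover have "V \<inter> closed_segment y u \<subseteq> {y, u}" using vertex_on_segment[OF yV(1) V(3)] by blast
    moreover have "good_apex y u z" using yV z splits_commute by (auto simp: good_apex_def)
    moreover have "free (closed_segment y u)" using yV by (simp add: closed_segment_commute)
    ultimately obtain x \<alpha>' \<beta>' where x: "x \<in> V" "x \<noteq> u" "x = y + \<alpha>' *\<^sub>R (u - y) + \<beta>' *\<^sub>R (z - y)"
      "0 \<le> \<alpha>'" "0 < \<beta>'" "\<alpha>' + \<beta>' \<le> 1" "free (convex hull {y, u, x})"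
      using first_vertex[OF V(3) zV(1) _ _ zV(3)] by metis
    have "x = u + ((1 - \<alpha>' - \<beta>') * a + \<beta>' * \<xi>) *\<^sub>R (v - u) + ((1 - \<alpha>' - \<beta>') * b + \<beta>' * \<eta>) *\<^sub>R (w - u)"
      unfolding x(3) yc(1) zc by (simp add: algebra_simps)
    moreover have "(1 - \<alpha>' - \<beta>') * a + \<beta>' * \<xi> > 0" "(1 - \<alpha>' - \<beta>') * b + \<beta>' * \<eta> > 0"
      using x yc zin by (auto intro!: add_nonneg_pos)
    moreover have "(1 - \<alpha>' - \<beta>') * a + \<beta>' * \<xi> + ((1 - \<alpha>' - \<beta>') * b + \<beta>' * \<eta>) < 1"
    proof -
      have "(1 - \<alpha>' - \<beta>') * (1 - a - b) \<ge> 0" "\<beta>' * (1 - \<xi> - \<eta>) > 0"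
        using x yc zin by (auto intro!: mult_nonneg_nonneg)
      then show ?thesis using x(4) by (simp add: algebra_simps)
    qed
    moreover have "free (closed_segment u x)" using x(7) free_mono segment_subset_hull3(3) by blast
    ultimately have "x \<in> Z" unfolding Z_def using x(1) by blast
    then have "ht i (x - y) \<le> 0" using ymax by simp
    moreover have "x - y = \<alpha>' *\<^sub>R (u - y) + \<beta>' *\<^sub>R (z - y)" unfolding x(3) by simp
    then have "pos i (x - y)" using pos_comb[OF py pz] x by simp
    ultimately have False using pos_ht by fastforce
    then show ?thesis ..
  qed
qed

lemma consec_vis:
  assumes "consec i u v w"
  shows "vis v w"
proof -
  have "v \<in> V" "w \<in> V" "v \<noteq> w" using assms by (auto simp: consec_def cone_arc_def vis_def)
  moreover have "free (closed_segment v w)"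
    using consec_triangle[OF assms] free_mono[OF _ segment_subset_hull3(3)] by blast
  ultimately show ?thesis by (simp add: vis_def)
qed

text \<open>The triangle over a canonical edge contains no further vertex, so a segment entering it
  through that edge ends at the apex or leaves through one of the two arcs.\<close>

lemma cross_triangle:
  assumes c: "consec i u v w" and V': "a \<in> V" "b \<in> V"
    and p: "p \<in> open_segment a b" "p \<in> open_segment v w" and ne: "{a, b} \<noteq> {v, w}"
  shows "u \<in> {a, b} \<or> (\<exists>q. q \<in> open_segment a b \<and> (q \<in> open_segment v u \<or> q \<in> open_segment w u))"
proof -
  have V: "v \<in> V" "w \<in> V" "u \<in> V" "v \<noteq> u" "w \<noteq> u" "v \<noteq> w"
    using c by (auto simp: consec_def cone_arc_def vis_def)
  have nc: "cr (v - u) (w - u) \<noteq> 0" using noncollinear[of u v w] V by auto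
  note D = crossing_distinct[OF V' V(1,2) p ne]
  have main: "u = b \<or> (\<exists>q. q \<in> open_segment a b \<and> (q \<in> open_segment v u \<or> q \<in> open_segment w u))"
    if ab: "a \<in> V" "b \<in> V" "p \<in> open_segment a b" "b \<noteq> v" "b \<noteq> w"
      and bc: "b = u + \<xi> *\<^sub>R (v - u) + \<eta> *\<^sub>R (w - u)" "\<xi> + \<eta> < 1" for a b \<xi> \<eta>
  proof (rule disjCI)
    assume nq: "\<not> (\<exists>q. q \<in> open_segment a b \<and> (q \<in> open_segment v u \<or> q \<in> open_segment w u))"
    obtain m where m: "0 < m" "m < 1" "p = v + m *\<^sub>R (w - v)" using p(2) by (rule open_segment_param)
    have pc: "p = u + (1 - m) *\<^sub>R (v - u) + m *\<^sub>R (w - u)" unfolding m(3) by (simp add: algebra_simps)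
    \<comment> \<open>\<open>M\<close> bounds the change of either coordinate on the way from
      \<open>p\<close> to \<open>b\<close>, so the point \<open>t\<close>, a fraction
      \<open>e\<close> of the way, is still strictly between the two sides at
      \<open>u\<close>.\<close>
    define M where "M = 1 + \<bar>\<xi> - (1 - m)\<bar> + \<bar>\<eta> - m\<bar>"
    have "0 < min 1 (min (1 - m) m / M)" using m by (simp add: M_def add_pos_nonneg)
    then obtain e where "0 < e" "e < min 1 (min (1 - m) m / M)" using dense by blast
    then have "0 < e" "e < 1" "e < min (1 - m) m / M" by simp_all
    moreover have "M > 0" by (simp add: M_def add_pos_nonneg)
    ultimately have e: "0 < e" "e < 1" "e * M < 1 - m" "e * M < m"
      by (simp_all add: pos_less_divide_eq)
    define t where "t = p + e *\<^sub>R (b - p)"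
    define \<alpha> \<beta> where "\<alpha> = (1 - m) + e * (\<xi> - (1 - m))" and "\<beta> = m + e * (\<eta> - m)"
    have tc: "t = u + \<alpha> *\<^sub>R (v - u) + \<beta> *\<^sub>R (w - u)"
      unfolding t_def pc bc(1) \<alpha>_def \<beta>_def by (simp add: algebra_simps)
    have "e * \<bar>\<xi> - (1 - m)\<bar> \<le> e * M" "e * \<bar>\<eta> - m\<bar> \<le> e * M"
      using e by (auto simp: M_def intro!: mult_left_mono)
    moreover have "\<bar>e * (\<xi> - (1 - m))\<bar> = e * \<bar>\<xi> - (1 - m)\<bar>" "\<bar>e * (\<eta> - m)\<bar> = e * \<bar>\<eta> - m\<bar>"
      using e by (simp_all add: abs_mult)
    ultimately have "(1 - m) + e * (\<xi> - (1 - m)) > 0 \<and> m + e * (\<eta> - m) > 0" using e by linarith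
    then have ab0: "\<alpha> > 0" "\<beta> > 0" by (simp_all add: \<alpha>_def \<beta>_def)
    have ab1: "1 - \<alpha> - \<beta> = e * (1 - \<xi> - \<eta>)" unfolding \<alpha>_def \<beta>_def by (simp add: algebra_simps)
    have "e * (1 - \<xi> - \<eta>) > 0" using e bc by simp
    then have ab2: "\<alpha> + \<beta> < 1" using ab1 by linarith
    have emp: "x = u \<or> x = v \<or> x = w" if "x \<in> V" "x \<in> convex hull {u, v, w}" for x
      using consec_triangle[OF c] that by blast
    show "u = b"
    proof (cases "\<xi> > 0 \<and> \<eta> > 0 \<and> \<xi> + \<eta> < 1")
      case True
      then have "b \<in> convex hull {u, v, w}" unfolding bc(1) by (intro in_triangleI) auto
      then show ?thesis using emp[OF ab(2)] ab by blast
    next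
      case False
      then obtain s \<xi>' \<eta>' where s: "0 < s" "s \<le> 1" "t + s *\<^sub>R (b - t) = u + \<xi>' *\<^sub>R (v - u) + \<eta>' *\<^sub>R (w - u)"
        "0 \<le> \<xi>'" "0 \<le> \<eta>'" "\<xi>' + \<eta>' \<le> 1" "\<xi>' = 0 \<or> \<eta>' = 0 \<or> \<xi>' + \<eta>' = 1"
        "1 - \<xi>' - \<eta>' = (1 - s) * (1 - \<alpha> - \<beta>) + s * (1 - \<xi> - \<eta>)"
        using triangle_exit[OF tc ab0 ab2 bc(1)] by metis
      have "(1 - s) * (1 - \<alpha> - \<beta>) \<ge> 0" "s * (1 - \<xi> - \<eta>) > 0" using s ab2 bc by auto
      then have lt1: "\<xi>' + \<eta>' < 1" using s(8) by linarith
      show ?thesis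
      proof (cases "s = 1")
        case True
        then have "b = u + \<xi>' *\<^sub>R (v - u) + \<eta>' *\<^sub>R (w - u)" using s(3) by simp
        then have "b \<in> convex hull {u, v, w}" using in_triangleI[OF s(4-6)] by simp
        then show ?thesis using emp[OF ab(2)] ab by blast
      next
        case False
        let ?q = "t + s *\<^sub>R (b - t)"
        obtain g where g: "0 < g" "g < 1" "p = a + g *\<^sub>R (b - a)" "a \<noteq> b" using ab(3) by (rule open_segment_param)
        define f where "f = e + s * (1 - e)"
        have f0: "0 < f" unfolding f_def using e s by (simp add: add_pos_pos)
        have "0 < (1 - s) * (1 - e)" using s False e by simp
        also have "\<dots> = 1 - f" by (simp add: f_def algebra_simps)
        finally have f1: "f < 1" by simp
        have "?q = p + f *\<^sub>R (b - p)" unfolding t_def f_def by (simp add: algebra_simps)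
        also have "\<dots> = a + (g + f * (1 - g)) *\<^sub>R (b - a)" unfolding g(3) by (simp add: algebra_simps)
        finally have qe: "?q = a + (g + f * (1 - g)) *\<^sub>R (b - a)" .
        have g1: "0 < g + f * (1 - g)" using g f0 by (simp add: add_pos_pos)
        have "0 < (1 - f) * (1 - g)" using f1 g by simp
        also have "\<dots> = 1 - (g + f * (1 - g))" by (simp add: algebra_simps)
        finally have g2: "g + f * (1 - g) < 1" by simp
        have q: "?q \<in> open_segment a b" unfolding qe by (rule open_segment_paramI[OF g1 g2 g(4)])
        have key: False if "?q = u + n *\<^sub>R (x - u)" "0 \<le> n" "n < 1" "x \<noteq> u" "x = v \<or> x = w" for n x
        proof (cases "n = 0")
          case True
          then have "u \<in> open_segment a b" using q that by simp
          then show False using vertex_on_segment[OF ab(1,2) V(3)] by (auto simp: open_segment_def)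
        next
          case False
          then have "?q \<in> open_segment u x" unfolding that(1) using that by (intro open_segment_paramI) auto
          then show False using nq q that(5) by (auto simp: open_segment_commute)
        qed
        moreover have "?q = u + \<eta>' *\<^sub>R (w - u)" if "\<xi>' = 0" using s(3) that by simp
        moreover have "?q = u + \<xi>' *\<^sub>R (v - u)" if "\<eta>' = 0" using s(3) that by simp
        moreover have "\<xi>' = 0 \<or> \<eta>' = 0" "\<xi>' < 1" "\<eta>' < 1" using s(4,5,7) lt1 by auto
        ultimately have False using key[of \<eta>' w] key[of \<xi>' v] s(4,5) V(4,5) by blast
        then show ?thesis ..
      qed
    qed
  qed
  obtain a1 a2 where ac: "a = u + a1 *\<^sub>R (v - u) + a2 *\<^sub>R (w - u)" using triangle_coords[OF nc] .
  obtain b1 b2 where bc: "b = u + b1 *\<^sub>R (v - u) + b2 *\<^sub>R (w - u)" using triangle_coords[OF nc] .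
  obtain m where m: "0 < m" "m < 1" "p = v + m *\<^sub>R (w - v)" using p(2) by (rule open_segment_param)
  have pc: "p = u + (1 - m) *\<^sub>R (v - u) + m *\<^sub>R (w - u)" unfolding m(3) by (simp add: algebra_simps)
  obtain s where s: "0 < s" "s < 1" "p = a + s *\<^sub>R (b - a)" using p(1) by (rule open_segment_param)
  have "p = u + (a1 + s * (b1 - a1)) *\<^sub>R (v - u) + (a2 + s * (b2 - a2)) *\<^sub>R (w - u)"
    unfolding s(3) ac bc by (simp add: algebra_simps)
  from triangle_coords_unique[OF nc trans[OF pc[symmetric] this]]
  have sum0: "(1 - s) * (1 - a1 - a2) + s * (1 - b1 - b2) = 0" by (simp add: algebra_simps)
  \<comment> \<open>The coordinates sum to 1 on the line \<open>v w\<close>, which contains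
    \<open>p\<close>. If neither end were strictly on the side of \<open>u\<close>, the segment
    would lie on that line.\<close>
  have "a1 + a2 < 1 \<or> b1 + b2 < 1"
  proof (rule ccontr)
    assume "\<not> ?thesis"
    then have "1 - a1 - a2 \<le> 0" "1 - b1 - b2 \<le> 0" by auto
    then have "(1 - s) * (1 - a1 - a2) \<le> 0" "s * (1 - b1 - b2) \<le> 0" using s by (auto simp: mult_le_0_iff)
    then have "(1 - s) * (1 - a1 - a2) = 0" "s * (1 - b1 - b2) = 0" using sum0 by linarith+
    then have e: "a1 = 1 - a2" "b1 = 1 - b2" using s by auto
    have "b - a = (b2 - a2) *\<^sub>R (w - v)" unfolding ac bc e by (simp add: algebra_simps)
    then have "cr (b - a) (w - v) = 0" by simp
    then show False using D(5) by simp
  qed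
  then show ?thesis
  proof
    assume "b1 + b2 < 1"
    from main[OF V' p(1) D(3,4) bc this] show ?thesis by blast
  next
    assume "a1 + a2 < 1"
    from main[OF V'(2,1) _ D(1,2) ac this] p(1) show ?thesis by (auto simp: open_segment_commute)
  qed
qed

text \<open>Leaving through a side contradicts \<open>arcs_plane\<close>. An arc that ends at the
  apex would start between two consecutive vertices, and an arc that starts at the apex would run
  into a negative cone.\<close>

lemma arc_consec_plane:
  assumes arc: "cone_arc j a z" and c: "consec i u v w"
    and p: "p \<in> open_segment a z" "p \<in> open_segment v w"
  shows "{a, z} = {v, w}"
proof (rule ccontr)
  assume ne: "{a, z} \<noteq> {v, w}"
  have V: "a \<in> V" "z \<in> V" "v \<in> V" "w \<in> V" "u \<in> V" "a \<noteq> z"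
    and av: "cone_arc i v u" and aw: "cone_arc i w u"
    using arc c by (auto simp: consec_def cone_arc_def vis_def)
  note D = crossing_distinct[OF V(1-4) p ne]
  from cross_triangle[OF c V(1,2) p ne] show False
  proof
    assume "\<exists>q. q \<in> open_segment a z \<and> (q \<in> open_segment v u \<or> q \<in> open_segment w u)"
    then have "{a, z} = {v, u} \<or> {a, z} = {w, u}" using arcs_plane[OF arc av] arcs_plane[OF arc aw] by blast
    then show False using D(1-4) by (auto simp: doubleton_eq_iff)
  next
    assume u: "u \<in> {a, z}"
    obtain m where m: "0 < m" "m < 1" "p = v + m *\<^sub>R (w - v)" using p(2) by (rule open_segment_param)
    have pc: "p - u = (1 - m) *\<^sub>R (v - u) + m *\<^sub>R (w - u)" unfolding m(3) by (simp add: algebra_simps)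
    have dir: "\<exists>\<alpha> \<beta>. \<alpha> > 0 \<and> \<beta> > 0 \<and> e - u = \<alpha> *\<^sub>R (v - u) + \<beta> *\<^sub>R (w - u)" if "p \<in> open_segment u e" for e
    proof -
      obtain s where s: "0 < s" "s < 1" "p = u + s *\<^sub>R (e - u)" using \<open>p \<in> open_segment u e\<close> by (rule open_segment_param)
      have "e - u = (1 / s) *\<^sub>R (p - u)" unfolding s(3) using s(1) by simp
      also have "\<dots> = ((1 - m) / s) *\<^sub>R (v - u) + (m / s) *\<^sub>R (w - u)" unfolding pc by (simp add: scaleR_add_right)
      finally have "e - u = ((1 - m) / s) *\<^sub>R (v - u) + (m / s) *\<^sub>R (w - u)" .
      moreover have "(1 - m) / s > 0" "m / s > 0" using m s by auto
      ultimately show ?thesis by blast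
    qed
    have posd: "pos i (u - e)" if "\<alpha> > 0" "\<beta> > 0" "e - u = \<alpha> *\<^sub>R (v - u) + \<beta> *\<^sub>R (w - u)" for e \<alpha> \<beta>
    proof -
      have "u - e = - (e - u)" by simp
      also have "\<dots> = \<alpha> *\<^sub>R (u - v) + \<beta> *\<^sub>R (u - w)" unfolding that(3) by (simp add: algebra_simps)
      finally show ?thesis using pos_comb[OF arc_pos[OF av] arc_pos[OF aw]] that by simp
    qed
    show False
    proof (cases "u = z")
      case True
      then have "p \<in> open_segment u a" using p(1) by (simp add: open_segment_commute)
      then obtain \<alpha> \<beta> where ab: "\<alpha> > 0" "\<beta> > 0" "a - u = \<alpha> *\<^sub>R (v - u) + \<beta> *\<^sub>R (w - u)" using dir by blast
      then have "pos i (u - a)" by (rule posd)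
      then have "i = j" using pos_unique arc_pos[OF arc] True by blast
      then show False using c ab arc True unfolding consec_def by blast
    next
      case False
      then have ua: "u = a" using u by blast
      then obtain \<alpha> \<beta> where ab: "\<alpha> > 0" "\<beta> > 0" "z - u = \<alpha> *\<^sub>R (v - u) + \<beta> *\<^sub>R (w - u)" using dir p(1) by blast
      then have "pos i (u - z)" by (rule posd)
      then show False using pos_opposite[of i "u - z" j] arc_pos[OF arc] ua by simp
    qed
  qed
qed

text \<open>The case left over by \<open>arc_consec_plane\<close> is that the apex of one edge is an
  end of the other. \<open>bad\<close> then looks at the other triangle; if the same happens there,
  the two apexes would have arcs to each other.\<close>

lemma consec_consec_plane:
  assumes c: "consec i u v w" and c': "consec j u' v' w'"
    and p: "p \<in> open_segment v w" "p \<in> open_segment v' w'"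
  shows "{v, w} = {v', w'}"
proof (rule ccontr)
  assume ne: "{v, w} \<noteq> {v', w'}"
  have V: "v \<in> V" "w \<in> V" "v' \<in> V" "w' \<in> V" "u \<in> V" "u' \<in> V"
    and av: "cone_arc i v u" "cone_arc i w u" and av': "cone_arc j v' u'" "cone_arc j w' u'"
    using c c' by (auto simp: consec_def cone_arc_def vis_def)
  note D = crossing_distinct[OF V(1-4) p ne]
  have bad: False if cc: "consec j u' x y" "{x, y} = {v', w'}" and ux: "u = x" for x y
  proof -
    have pp: "p \<in> open_segment x y" using p(2) cc(2) by (auto simp: doubleton_eq_iff open_segment_commute)
    from cross_triangle[OF cc(1) V(1,2) p(1) pp] ne cc(2)
    have "u' \<in> {v, w} \<or> (\<exists>q. q \<in> open_segment v w \<and> (q \<in> open_segment x u' \<or> q \<in> open_segment y u'))" by simp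
    then show False
    proof
      assume "u' \<in> {v, w}"
      then obtain e where e: "u' = e" "cone_arc i e u" using av by auto
      have "cone_arc j u e" using cc(1) ux e by (simp add: consec_def)
      then show False using e(2) pos_opposite[of i "u - e" j] by (simp add: cone_arc_def)
    next
      assume "\<exists>q. q \<in> open_segment v w \<and> (q \<in> open_segment x u' \<or> q \<in> open_segment y u')"
      then have "{x, u'} = {v, w} \<or> {y, u'} = {v, w}"
        using arc_consec_plane[OF _ c] cc(1) unfolding consec_def by blast
      then show False using D(1-4) cc(2) by (auto simp: doubleton_eq_iff)
    qed
  qed
  have ne': "{v', w'} \<noteq> {v, w}" using ne by simp
  from cross_triangle[OF c V(3,4) p(2,1) ne'] show False
  proof
    assume "u \<in> {v', w'}"
    then show False using bad[OF c'] bad[OF consec_sym[OF c']] by auto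
  next
    assume "\<exists>q. q \<in> open_segment v' w' \<and> (q \<in> open_segment v u \<or> q \<in> open_segment w u)"
    then have "{v, u} = {v', w'} \<or> {w, u} = {v', w'}"
      using arc_consec_plane[OF av(1) c'] arc_consec_plane[OF av(2) c'] by blast
    then show False using D(1-4) by (auto simp: doubleton_eq_iff)
  qed
qed

text \<open>All arcs and all canonical edges, more than the final graph. The degree count uses
  planarity of this larger graph, because arcs that are dropped still separate the edges around a
  vertex.\<close>

definition star :: "complex \<Rightarrow> complex \<Rightarrow> bool" where
  "star a b \<longleftrightarrow> (\<exists>i. cone_arc i a b \<or> cone_arc i b a \<or> (\<exists>u. consec i u a b))"

lemma star_vis: "star a b \<Longrightarrow> vis a b"
  unfolding star_def by (auto dest: arc_vis consec_vis simp: vis_sym[of a b])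

lemma star_plane:
  assumes "star a b" "star c d" "p \<in> open_segment a b" "p \<in> open_segment c d"
  shows "{a, b} = {c, d}"
proof -
  have e: "\<exists>i x y. {x, y} = {a, b} \<and> (cone_arc i x y \<or> (\<exists>u. consec i u x y))" if "star a b" for a b
    using that unfolding star_def by (metis insert_commute)
  obtain i x y where 1: "{x, y} = {a, b}" "cone_arc i x y \<or> (\<exists>u. consec i u x y)" using e[OF assms(1)] by blast
  obtain j z w where 2: "{z, w} = {c, d}" "cone_arc j z w \<or> (\<exists>u. consec j u z w)" using e[OF assms(2)] by blast
  have s: "p \<in> open_segment x y" "p \<in> open_segment z w"
    using assms 1 2 by (auto simp: doubleton_eq_iff open_segment_commute)
  have "{x, y} = {z, w}"
    using 1(2) 2(2) s arcs_plane arc_consec_plane consec_consec_plane by metis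
  then show ?thesis using 1 2 by simp
qed

text \<open>Here \<open>u\<close> is an end of the canonical edge and \<open>x\<close> is its apex.
  An edge from \<open>u\<close> into the angle of the empty triangle would have to end inside it or
  cross the arc from \<open>y\<close> to \<open>x\<close>.\<close>

lemma consec_no_star_between:
  assumes c: "consec i x u y" and z: "star u z"
    and zc: "z - u = \<alpha> *\<^sub>R (x - u) + \<beta> *\<^sub>R (y - u)" "\<alpha> > 0" "\<beta> > 0"
  shows False
proof -
  have V: "x \<in> V" "u \<in> V" "y \<in> V" "x \<noteq> u" "x \<noteq> y" "u \<noteq> y" and a: "cone_arc i y x"
    using c by (auto simp: consec_def cone_arc_def vis_def)
  have zV: "z \<in> V" "z \<noteq> u" using star_vis[OF z] by (auto simp: vis_def)
  have nc: "cr (x - u) (y - u) \<noteq> 0" using noncollinear[of u x y] V by auto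
  have z': "z = u + \<alpha> *\<^sub>R (x - u) + \<beta> *\<^sub>R (y - u)" using zc(1) by (metis add.assoc diff_add_cancel add.commute)
  have zx: "z \<noteq> x"
  proof
    assume "z = x"
    then have "u + \<alpha> *\<^sub>R (x - u) + \<beta> *\<^sub>R (y - u) = u + 1 *\<^sub>R (x - u) + 0 *\<^sub>R (y - u)" using z' by simp
    from triangle_coords_unique(2)[OF nc this] zc show False by simp
  qed
  have zy: "z \<noteq> y"
  proof
    assume "z = y"
    then have "u + \<alpha> *\<^sub>R (x - u) + \<beta> *\<^sub>R (y - u) = u + 0 *\<^sub>R (x - u) + 1 *\<^sub>R (y - u)" using z' by simp
    from triangle_coords_unique(1)[OF nc this] zc show False by simp
  qed
  have "convex hull {x, u, y} = convex hull {u, x, y}" by (simp add: insert_commute)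
  then have emp: "V \<inter> convex hull {u, x, y} \<subseteq> {x, u, y}" using consec_triangle[OF c] by simp
  have gt: "\<alpha> + \<beta> > 1"
  proof (rule ccontr)
    assume "\<not> ?thesis"
    then have "z \<in> convex hull {u, x, y}" unfolding z' using zc by (intro in_triangleI) auto
    then show False using emp zV zx zy by blast
  qed
  define p where "p = u + (1 / (\<alpha> + \<beta>)) *\<^sub>R (z - u)"
  have "p \<in> open_segment u z" unfolding p_def using gt zV by (intro open_segment_paramI) auto
  moreover have "p \<in> open_segment x y"
  proof -
    have "p = u + (\<alpha> / (\<alpha> + \<beta>)) *\<^sub>R (x - u) + (\<beta> / (\<alpha> + \<beta>)) *\<^sub>R (y - u)"
      unfolding p_def zc(1) by (simp add: scaleR_add_right)
    also have "\<alpha> / (\<alpha> + \<beta>) = 1 - \<beta> / (\<alpha> + \<beta>)" using zc by (simp add: field_simps)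
    finally have "p = x + (\<beta> / (\<alpha> + \<beta>)) *\<^sub>R (y - x)" by (simp add: algebra_simps)
    then show ?thesis using open_segment_paramI[of "\<beta> / (\<alpha> + \<beta>)" x y] zc V by simp
  qed
  moreover have "star x y" using a by (auto simp: star_def)
  ultimately have "{u, z} = {x, y}" using star_plane z by blast
  then show False using V(4,6) by (auto simp: doubleton_eq_iff)
qed

end

section \<open>Degrees\<close>

text \<open>A multiple of the cross product whose sign is positive when \<open>b\<close> lies, seen from \<open>a\<close>, on the side
  that leads from \<open>C\<^sub>i\<close> to \<open>C\<^sub>j\<close> without meeting \<open>C\<^sub>k\<close>.\<close>

definition dt :: "nat \<Rightarrow> nat \<Rightarrow> complex \<Rightarrow> complex \<Rightarrow> real" where
  "dt i j a b = ht i a * ht j b - ht j a * ht i b"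

lemma dt_antisym: "dt i j a b = - dt i j b a"
  by (simp add: dt_def)

lemma dt_flip: "dt j i b a = dt i j a b"
  by (simp add: dt_def mult.commute)

lemma dt_swap:
  assumes "idx i j k"
  shows "dt i k a b = - dt i j a b"
proof -
  have e: "ht k a = - ht i a - ht j a" "ht k b = - ht i b - ht j b"
    using ht_sum[OF assms, of a] ht_sum[OF assms, of b] by linarith+
  show ?thesis unfolding dt_def e by (simp add: algebra_simps)
qed

lemma dt_cr:
  assumes "idx i j k"
  obtains c where "c \<noteq> 0" "\<And>a b. dt i j a b = c * cr a b"
  using ht_cr[OF idx_perm(4)[OF assms]] unfolding dt_def by metis

lemma dt_between:
  assumes id: "idx i j k" and "dt i j x y > 0" "dt i j z y > 0" "dt i j x z > 0"
  obtains \<alpha> \<beta> where "\<alpha> > 0" "\<beta> > 0" "z = \<alpha> *\<^sub>R x + \<beta> *\<^sub>R y"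
proof -
  obtain c where c: "c \<noteq> 0" "\<And>a b. dt i j a b = c * cr a b" using dt_cr[OF id] by blast
  have nz: "cr x y \<noteq> 0" using assms(2) c by auto
  have "cr z y / cr x y = dt i j z y / dt i j x y" "cr x z / cr x y = dt i j x z / dt i j x y"
    using c by simp_all
  then have "cr z y / cr x y > 0" "cr x z / cr x y > 0" using assms by simp_all
  then show thesis using that cr_expand[OF nz, of z] by blast
qed

text \<open>Together with the next two lemmas: the positive cone \<open>i\<close>, the negative cone
  \<open>k\<close> and the positive cone \<open>j\<close> follow each other around the
  origin.\<close>

lemma dt_pos_pos:
  assumes id: "idx i j k" and "pos i a" "pos j b"
  shows "dt i j a b > 0"
proof -
  have a: "ht j a < 0" "ht k a < 0" using assms pos_idx[OF id] by auto
  have b: "ht i b < 0" "ht k b < 0" using assms pos_idx[OF idx_perm(2)[OF id]] by auto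
  have "- ht j a < ht i a" "- ht i b < ht j b"
    using a b ht_sum[OF id, of a] ht_sum[OF id, of b] by linarith+
  then have "(- ht j a) * (- ht i b) < ht i a * ht j b" using a b by (intro mult_strict_mono) auto
  then show ?thesis by (simp add: dt_def)
qed

lemma dt_pos_neg:
  assumes id: "idx i j k" and "pos i a" "pos k (- b)"
  shows "dt i j a b > 0"
proof -
  have a: "ht i a > 0" "ht j a < 0" using assms id by (auto simp: pos_def idx_def)
  have neg: "ht m (- b) = - ht m b" for m using ht_diff[of m 0 b] by simp
  have b: "ht i b > 0" "ht j b > 0" using assms id neg by (auto simp: pos_def idx_def)
  have "ht i a * ht j b > 0" "ht j a * ht i b < 0" using a b by (auto simp: mult_neg_pos)
  then show ?thesis by (simp add: dt_def)
qed

lemma dt_neg_pos: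
  assumes id: "idx i j k" and "pos k (- a)" "pos j b"
  shows "dt i j a b > 0"
  using dt_pos_neg[OF idx_perm(2)[OF id] assms(3,2)] by (simp only: dt_flip[of j i])

lemma card_le_2I:
  assumes "finite A" "\<And>x y z. x \<in> A \<Longrightarrow> y \<in> A \<Longrightarrow> z \<in> A \<Longrightarrow> x = y \<or> y = z \<or> x = z"
  shows "card A \<le> 2"
proof (rule ccontr)
  assume "\<not> card A \<le> 2"
  then have "3 \<le> card A" by simp
  then obtain B where B: "B \<subseteq> A" "card B = 3" using obtain_subset_with_card_n by metis
  then obtain x y z where "B = {x, y, z}" "x \<noteq> y" "y \<noteq> z" "x \<noteq> z" by (auto simp: card_3_iff)
  then show False using assms(2)[of x y z] B by auto
qed

context polygon_scene
begin

lemma dt_nonzero: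
  assumes id: "idx i j k" and "u \<in> V" "v \<in> V" "w \<in> V" "u \<noteq> v" "u \<noteq> w" "v \<noteq> w"
  shows "dt i j (v - u) (w - u) \<noteq> 0"
proof -
  obtain c where c: "c \<noteq> 0" "\<And>a b. dt i j a b = c * cr a b" using dt_cr[OF id] by blast
  then show ?thesis using noncollinear assms by auto
qed

lemma consec_no_star_dt:
  assumes c: "consec i x u y" and z: "star u z" and id: "idx a b d"
    and "dt a b (x - u) (y - u) > 0" "dt a b (z - u) (y - u) > 0" "dt a b (x - u) (z - u) > 0"
  shows False
proof -
  obtain \<alpha> \<beta> where "\<alpha> > 0" "\<beta> > 0" "z - u = \<alpha> *\<^sub>R (x - u) + \<beta> *\<^sub>R (y - u)"
    using dt_between[OF id assms(4-6)] .
  then show False using consec_no_star_between[OF c z] by blast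
qed

text \<open>Only one obstacle has \<open>u\<close> as a corner. Turning from its interior direction
  towards \<open>v\<close> and towards \<open>w\<close> meets an edge each time, and these two edges
  differ, so both edges at \<open>u\<close> lie in every split angle.\<close>

lemma split_corner:
  assumes sp0: "splits S u v0 w0"
  obtains b c where "b \<in> V" "c \<in> V" "b \<noteq> c" "b \<noteq> u" "c \<noteq> u"
    "\<And>v w e. vis u v \<Longrightarrow> vis u w \<Longrightarrow> splits S u v w \<Longrightarrow> e \<in> {b, c} \<Longrightarrow>
       \<exists>x y. x \<ge> 0 \<and> y \<ge> 0 \<and> e - u = x *\<^sub>R (v - u) + y *\<^sub>R (w - u)"
proof -
  obtain P where P: "P \<in> S" "u \<in> set P" using sp0 unfolding splits_def by blast
  note sP = simple_S[OF P(1)]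
  obtain b c k l r where bc: "b \<in> set P" "c \<in> set P" "b \<noteq> c" "b \<noteq> u" "c \<noteq> u"
    "r > 0" "ball u r \<inter> poly_boundary P \<subseteq> closed_segment u b \<union> closed_segment u c"
    using corner_edges[OF sP P(2)] by metis
  have main: "\<exists>x y. x \<ge> 0 \<and> y \<ge> 0 \<and> e - u = x *\<^sub>R (v - u) + y *\<^sub>R (w - u)"
    if vw: "vis u v" "vis u w" and sp: "splits S u v w" and e: "e \<in> {b, c}" for v w e
  proof -
    obtain P' \<alpha> \<beta> \<epsilon> where P': "P' \<in> S" "u \<in> set P'" "\<alpha> > 0" "\<beta> > 0" "\<epsilon> > 0"
      and I: "\<And>t. 0 < t \<Longrightarrow> t < \<epsilon> \<Longrightarrow> u + t *\<^sub>R (\<alpha> *\<^sub>R (v - u) + \<beta> *\<^sub>R (w - u)) \<in> obstacle_interior P'"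
      using sp unfolding splits_def by blast
    have "P' = P" using scene P P' unfolding scene_def by blast
    note I = I[unfolded this]
    let ?d = "\<alpha> *\<^sub>R (v - u) + \<beta> *\<^sub>R (w - u)"
    have "v \<noteq> w" using sp not_splits_vis vw by blast
    then have nc: "cr (v - u) (w - u) \<noteq> 0" using vw noncollinear[of u v w] by (auto simp: vis_def)
    have dv: "cr ?d (v - u) \<noteq> 0" "cr ?d (w - u) \<noteq> 0"
      using nc P' cr_commute[of "w - u" "v - u"] by simp_all
    have cl: "closed_segment u v \<inter> obstacle_interior P = {}" "closed_segment u w \<inter> obstacle_interior P = {}"
      using vw P unfolding vis_def free_def by blast+
    obtain e1 x1 y1 where e1: "e1 \<in> {b, c}" "x1 \<ge> 0" "y1 > 0" "e1 - u = x1 *\<^sub>R ?d + y1 *\<^sub>R (v - u)"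
      using blocked_direction_edge[OF sP P(2) bc(4-7) P'(5) I cl(1) dv(1)] by blast
    obtain e2 x2 y2 where e2: "e2 \<in> {b, c}" "x2 \<ge> 0" "y2 > 0" "e2 - u = x2 *\<^sub>R ?d + y2 *\<^sub>R (w - u)"
      using blocked_direction_edge[OF sP P(2) bc(4-7) P'(5) I cl(2) dv(2)] by blast
    have c1: "e1 - u = (x1 * \<alpha> + y1) *\<^sub>R (v - u) + (x1 * \<beta>) *\<^sub>R (w - u)"
      unfolding e1(4) by (simp add: algebra_simps)
    have c2: "e2 - u = (x2 * \<alpha>) *\<^sub>R (v - u) + (x2 * \<beta> + y2) *\<^sub>R (w - u)"
      unfolding e2(4) by (simp add: algebra_simps)
    have "e1 \<noteq> e2"
    proof
      assume "e1 = e2"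
      then have eq: "(x1 * \<alpha> + y1) *\<^sub>R (v - u) + (x1 * \<beta>) *\<^sub>R (w - u) = (x2 * \<alpha>) *\<^sub>R (v - u) + (x2 * \<beta> + y2) *\<^sub>R (w - u)"
        using c1 c2 by simp
      have "x1 * \<alpha> + y1 = x2 * \<alpha>" "x1 * \<beta> = x2 * \<beta> + y2" using cr_coords_unique[OF nc eq] by blast+
      then have "x1 * \<alpha> < x2 * \<alpha>" "x2 * \<beta> < x1 * \<beta>" using e1 e2 by linarith+
      then have "x1 < x2" "x2 < x1" using P' by simp_all
      then show False by simp
    qed
    then have "e = e1 \<or> e = e2" using e e1(1) e2(1) by blast
    moreover have "x1 * \<alpha> + y1 \<ge> 0" "x1 * \<beta> \<ge> 0" "x2 * \<alpha> \<ge> 0" "x2 * \<beta> + y2 \<ge> 0"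
      using e1 e2 P' by simp_all
    ultimately show ?thesis using c1 c2 by blast
  qed
  have "b \<in> V" "c \<in> V" using bc corners_V P by auto
  from that[OF this bc(3-5) main] show thesis .
qed

text \<open>One of the three directions is in the middle, and the two angles that it forms with the
  others share only its own ray. Both obstacle edges at \<open>u\<close> lie in both angles, so on
  that ray, and general position makes their ends equal.\<close>

lemma no_three_splits:
  assumes vs: "vis u v1" "vis u v2" "vis u v3"
    and h: "ht m (v1 - u) > 0" "ht m (v2 - u) > 0" "ht m (v3 - u) > 0"
    and sp: "splits S u v1 v2" "splits S u v2 v3" "splits S u v1 v3"
  shows False
proof -
  obtain b c where bc: "b \<in> V" "c \<in> V" "b \<noteq> c" "b \<noteq> u" "c \<noteq> u"
    and cone: "\<And>v w e. vis u v \<Longrightarrow> vis u w \<Longrightarrow> splits S u v w \<Longrightarrow> e \<in> {b, c} \<Longrightarrow>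
       \<exists>x y. x \<ge> 0 \<and> y \<ge> 0 \<and> e - u = x *\<^sub>R (v - u) + y *\<^sub>R (w - u)"
    using split_corner[OF sp(1)] by metis
  have V: "u \<in> V" "v1 \<in> V" "v2 \<in> V" "v3 \<in> V" "v1 \<noteq> u" "v2 \<noteq> u" "v3 \<noteq> u"
    using vs by (auto simp: vis_def)
  have ne: "v1 \<noteq> v2" "v2 \<noteq> v3" "v1 \<noteq> v3" using sp not_splits_vis vs by blast+
  have bad: False if vv: "vis u x" "vis u y" "vis u z" "splits S u x y" "splits S u x z" "x \<noteq> y" "x \<noteq> z" "y \<noteq> z"
      and xc: "x - u = p *\<^sub>R (y - u) + q *\<^sub>R (z - u)" "p \<ge> 0" "q \<ge> 0" for x y z p q
  proof -
    have W: "x \<in> V" "y \<in> V" "z \<in> V" "x \<noteq> u" "y \<noteq> u" "z \<noteq> u" using vv by (auto simp: vis_def)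
    define N where "N = cr (y - u) (z - u)"
    have nc: "N \<noteq> 0" "cr (x - u) (y - u) \<noteq> 0" "cr (x - u) (z - u) \<noteq> 0"
      unfolding N_def using noncollinear V(1) W vv(6-8) by metis+
    have c1: "cr (x - u) (y - u) = - (q * N)" unfolding xc(1) N_def
      using cr_commute[of "z - u" "y - u"] by simp
    have c2: "cr (x - u) (z - u) = p * N" unfolding xc(1) N_def by simp
    have pq: "p > 0" "q > 0" using nc c1 c2 xc by (auto simp: less_eq_real_def)
    have "e = x" if e: "e \<in> {b, c}" for e
    proof -
      obtain a1 a2 where a: "a1 \<ge> 0" "a2 \<ge> 0" "e - u = a1 *\<^sub>R (x - u) + a2 *\<^sub>R (y - u)"
        using cone[OF vv(1,2,4) e] by blast
      obtain b1 b2 where b: "b1 \<ge> 0" "b2 \<ge> 0" "e - u = b1 *\<^sub>R (x - u) + b2 *\<^sub>R (z - u)"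
        using cone[OF vv(1,3,5) e] by blast
      have "cr (x - u) (e - u) = a2 * - (q * N)" unfolding a(3) by (simp add: c1)
      moreover have "cr (x - u) (e - u) = b2 * (p * N)" unfolding b(3) by (simp add: c2)
      ultimately have "(b2 * p + a2 * q) * N = 0" by (simp add: algebra_simps)
      then have "b2 * p + a2 * q = 0" using nc(1) by simp
      then have "a2 = 0" using pq a b by (smt (verit) mult_nonneg_nonneg mult_pos_pos)
      then have "cr (x - u) (e - u) = 0" unfolding a(3) by simp
      moreover have "e \<in> V" "e \<noteq> u" using e bc by auto
      ultimately show ?thesis using noncollinear[of u x e] V(1) W by auto
    qed
    then show False using bc(3) by blast
  qed
  have nc: "cr (v1 - u) (v2 - u) \<noteq> 0" "cr (v2 - u) (v3 - u) \<noteq> 0" "cr (v3 - u) (v1 - u) \<noteq> 0"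
    using noncollinear V ne by metis+
  note sc = splits_commute[OF sp(1)] splits_commute[OF sp(2)] splits_commute[OF sp(3)]
  from cone_three[OF h nc] show False
  proof (elim disjE exE conjE)
    fix x y assume "0 \<le> x" "0 \<le> y" "v1 - u = x *\<^sub>R (v2 - u) + y *\<^sub>R (v3 - u)"
    then show False using bad[OF vs(1,2,3) sp(1,3)] ne by blast
  next
    fix x y assume "0 \<le> x" "0 \<le> y" "v2 - u = x *\<^sub>R (v3 - u) + y *\<^sub>R (v1 - u)"
    then show False using bad[OF vs(2,3,1) sp(2) sc(1)] ne by blast
  next
    fix x y assume "0 \<le> x" "0 \<le> y" "v3 - u = x *\<^sub>R (v1 - u) + y *\<^sub>R (v2 - u)"
    then show False using bad[OF vs(3,1,2) sc(3,2)] ne by blast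
  qed
qed

text \<open>An obstacle edge at \<open>u\<close> lies in both split angles and hence in both
  cones.\<close>

lemma splits_same_cone:
  assumes vs: "vis u v1" "vis u v2" "vis u v3" "vis u v4"
    and p: "pos k (u - v1)" "pos k (u - v2)" "pos k' (u - v3)" "pos k' (u - v4)"
    and sp: "splits S u v1 v2" "splits S u v3 v4"
  shows "k = k'"
proof -
  obtain b c where bc: "b \<in> V" "c \<in> V" "b \<noteq> c" "b \<noteq> u" "c \<noteq> u"
    and cone: "\<And>v w e. vis u v \<Longrightarrow> vis u w \<Longrightarrow> splits S u v w \<Longrightarrow> e \<in> {b, c} \<Longrightarrow>
       \<exists>x y. x \<ge> 0 \<and> y \<ge> 0 \<and> e - u = x *\<^sub>R (v - u) + y *\<^sub>R (w - u)"
    using split_corner[OF sp(1)] by metis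
  have "pos l (u - b)" if vw: "vis u v" "vis u w" "splits S u v w" "pos l (u - v)" "pos l (u - w)" for v w l
  proof -
    obtain x y where xy: "x \<ge> 0" "y \<ge> 0" "b - u = x *\<^sub>R (v - u) + y *\<^sub>R (w - u)"
      using cone[OF vw(1-3), of b] by blast
    have "x + y \<noteq> 0"
    proof
      assume "x + y = 0"
      then have "x = 0" "y = 0" using xy by linarith+
      then show False using xy(3) bc by simp
    qed
    then have "x + y > 0" using xy by linarith
    moreover have "u - b = - (b - u)" by simp
    then have "u - b = x *\<^sub>R (u - v) + y *\<^sub>R (u - w)" unfolding xy(3) by (simp add: algebra_simps)
    ultimately show ?thesis using pos_comb[OF vw(4,5) xy(1,2)] by simp
  qed
  then have "pos k (u - b)" "pos k' (u - b)" using vs p sp by blast+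
  then show ?thesis by (rule pos_unique)
qed

section \<open>Charging the edges at a vertex to its cones\<close>

definition closest :: "nat \<Rightarrow> complex \<Rightarrow> complex \<Rightarrow> bool" where
  "closest i u v \<longleftrightarrow> cone_arc i v u \<and> (\<forall>w. cone_arc i w u \<and> \<not> splits S u v w \<longrightarrow> ht i w \<le> ht i v)"

definition G :: "complex \<Rightarrow> complex \<Rightarrow> bool" where
  "G x y \<longleftrightarrow> (\<exists>i. closest i x y \<or> closest i y x \<or> (\<exists>u. consec i u x y))"

lemma G_star: "G x y \<Longrightarrow> star x y"
  unfolding G_def star_def closest_def by blast

lemma arcs_split:
  assumes "cone_arc i u x" "cone_arc i u x'" "x \<noteq> x'"
  shows "splits S u x x'"
proof (rule ccontr)
  assume n: "\<not> splits S u x x'"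
  then have n': "\<not> splits S u x' x" using splits_commute by blast
  have "ht i x \<le> ht i x'" "ht i x' \<le> ht i x" using assms n n' unfolding cone_arc_def by blast+
  moreover have "ht i x \<noteq> ht i x'"
    using assms gen_pos_ht[of x x' i] by (auto simp: cone_arc_def vis_def pos_def)
  ultimately show False by simp
qed

lemma closest_split:
  assumes "closest i u x" "closest i u x'" "x \<noteq> x'"
  shows "splits S u x x'"
proof (rule ccontr)
  assume n: "\<not> splits S u x x'"
  then have n': "\<not> splits S u x' x" using splits_commute by blast
  have "ht i x \<le> ht i x'" "ht i x' \<le> ht i x" using assms n n' unfolding closest_def by blast+
  moreover have "ht i x \<noteq> ht i x'"
    using assms gen_pos_ht[of x x' i] by (auto simp: closest_def cone_arc_def vis_def pos_def)
  ultimately show False by simp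
qed

text \<open>The canonical edges in this set run in the positive cone \<open>j\<close>. They are
  charged to the negative cone \<open>k\<close> because the empty triangle between the arc in cone
  \<open>i\<close> and the edge covers all directions of that cone, which then holds no other
  edge.\<close>

definition nbr_neg :: "nat \<Rightarrow> complex \<Rightarrow> complex set" where
  "nbr_neg k u = {y. closest k u y} \<union> {y. \<exists>i j x. idx i j k \<and> consec i x u y \<and> pos j (y - u)}"

text \<open>The edges charged to one arc \<open>u x\<close>: the arc, if it is kept as the closest
  edge of \<open>x\<close>, and the canonical edges with apex \<open>x\<close> that run into the two
  negative cones next to cone \<open>i\<close>.\<close>

definition nbr_arc :: "nat \<Rightarrow> complex \<Rightarrow> complex \<Rightarrow> complex set" where
  "nbr_arc i u x = {y. y = x \<and> closest i x u} \<union> {y. \<exists>j k. idx i j k \<and> consec i x u y \<and> pos k (u - y)}"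

definition nbr_pos :: "nat \<Rightarrow> complex \<Rightarrow> complex set" where
  "nbr_pos i u = (\<Union>x\<in>{x. cone_arc i u x}. nbr_arc i u x)"

text \<open>By \<open>siblings_side\<close> the other two heights are ordered oppositely, so the
  sign of the difference in height \<open>i\<close> decides whether a canonical edge runs into a
  positive or a negative cone.\<close>

lemma nbr_cover:
  assumes "G u y"
  shows "\<exists>i<3. y \<in> nbr_neg i u \<or> y \<in> nbr_pos i u"
proof -
  obtain i where "closest i u y \<or> closest i y u \<or> (\<exists>x. consec i x u y)" using assms by (auto simp: G_def)
  moreover have "?thesis" if "closest i u y"
    using that unfolding nbr_neg_def by (auto simp: closest_def cone_arc_def pos_def)
  moreover have "?thesis" if c: "closest i y u"
  proof -
    have "cone_arc i u y" "i < 3" using c by (auto simp: closest_def cone_arc_def pos_def)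
    then show ?thesis using c unfolding nbr_pos_def nbr_arc_def by blast
  qed
  moreover have "?thesis" if c: "consec i x u y" for x
  proof -
    have a: "cone_arc i u x" "cone_arc i y x" "u \<noteq> y" "\<not> splits S x u y" using c by (auto simp: consec_def)
    have i3: "i < 3" using arc_pos[OF a(1)] by (simp add: pos_def)
    then obtain j0 k0 where id0: "idx i j0 k0" using idx_exists by blast
    obtain j k where id: "idx i j k" and jk: "ht j u < ht j y" "ht k y < ht k u"
      using siblings_side[OF id0 a] id0 idx_perm(1)[OF id0] by blast
    have V: "u \<in> V" "y \<in> V" using a by (auto simp: cone_arc_def vis_def)
    have "ht i u \<noteq> ht i y" using gen_pos_ht V a(3) i3 by blast
    then consider "ht i y < ht i u" | "ht i u < ht i y" by linarith
    then show ?thesis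
    proof cases
      case 1
      then have "pos j (y - u)" unfolding pos_idx[OF idx_perm(2)[OF id]] using jk by simp
      then have "y \<in> nbr_neg k u" unfolding nbr_neg_def using id c by blast
      then show ?thesis using id by (auto simp: idx_def)
    next
      case 2
      then have "pos k (u - y)" unfolding pos_idx[OF idx_perm(4)[OF id]] using jk by simp
      then have "y \<in> nbr_arc i u x" unfolding nbr_arc_def using id c by blast
      then show ?thesis unfolding nbr_pos_def using a(1) i3 by blast
    qed
  qed
  ultimately show ?thesis by blast
qed

text \<open>Two such triangles overlap. With arcs in the same cone, one canonical edge runs into the
  angle of the other triangle. With the cones \<open>i\<close> and \<open>j\<close> exchanged, arcs
  and edges must coincide crosswise, and then \<open>x\<close> and \<open>y\<close> would have arcs
  to each other.\<close>

lemma crossing_unique: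
  assumes id: "idx i j k" and c: "consec i x u y" "pos j (y - u)"
    and id': "idx i' j' k" and c': "consec i' x' u y'" "pos j' (y' - u)"
  shows "y = y'"
proof (rule ccontr)
  assume ne: "y \<noteq> y'"
  have a: "cone_arc i u x" "cone_arc i y x" and a': "cone_arc i' u x'" "cone_arc i' y' x'" using c c' by (auto simp: consec_def)
  have V: "u \<in> V" "x \<in> V" "y \<in> V" "x' \<in> V" "y' \<in> V" "x \<noteq> u" "y \<noteq> u" "x' \<noteq> u" "y' \<noteq> u"
    using a a' c c' by (auto simp: cone_arc_def vis_def consec_def)
  have st: "star u x" "star u x'" using a a' by (auto simp: star_def)
  have st': "star u y" "star u y'" using c c' by (auto simp: star_def)
  have px: "pos i (x - u)" "pos i' (x' - u)" using a a' by (auto simp: cone_arc_def)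
  show False
  proof (cases "i' = i")
    case True
    then have j: "j' = j" using id id' unfolding idx_def by linarith
    note dd = dt_pos_pos[OF id]
    consider "dt i j (y' - u) (y - u) > 0" | "dt i j (y - u) (y' - u) > 0"
      using dt_nonzero[OF id V(1,3,5)] V ne dt_antisym[of i j "y - u" "y' - u"] by force
    then show False
    proof cases
      case 1
      then show False using consec_no_star_dt[OF c(1) st'(2) id] dd px c(2) c'(2) j by blast
    next
      case 2
      then show False using consec_no_star_dt[OF c'(1) st'(1) id] dd px c(2) c'(2) j True by blast
    qed
  next
    case False
    then have ij: "i' = j" "j' = i" using id id' unfolding idx_def by linarith+
    note dd = dt_pos_pos[OF id]
    have px': "pos j (x' - u)" "pos i (y' - u)" using px c' ij by auto
    have c'': "consec j x' u y'" using c' ij by simp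
    have rev: False if "star u z" "dt i j (y' - u) (x' - u) > 0" "dt i j (z - u) (x' - u) > 0" "dt i j (y' - u) (z - u) > 0" for z
      using consec_no_star_dt[OF c'' that(1) idx_perm(2)[OF id]] that(2-4) unfolding dt_flip[of j i] by blast
    have "y = x'"
    proof (rule ccontr)
      assume n: "y \<noteq> x'"
      consider "dt i j (x' - u) (y - u) > 0" | "dt i j (y - u) (x' - u) > 0"
        using dt_nonzero[OF id V(1,3,4)] V n dt_antisym[of i j "y - u" "x' - u"] by force
      then show False
      proof cases
        case 1
        then show False using consec_no_star_dt[OF c(1) st(2) id] dd px px' c(2) by blast
      next
        case 2
        then show False using rev[OF st'(1)] dd px px' c(2) by blast
      qed
    qed
    moreover have "x = y'"
    proof (rule ccontr)
      assume n: "x \<noteq> y'"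
      consider "dt i j (y' - u) (x - u) > 0" | "dt i j (x - u) (y' - u) > 0"
        using dt_nonzero[OF id V(1,2,5)] V n dt_antisym[of i j "x - u" "y' - u"] by force
      then show False
      proof cases
        case 1
        then show False using rev[OF st(1)] dd px px' c(2) by blast
      next
        case 2
        then show False using consec_no_star_dt[OF c(1) st'(2) id] dd px px' c(2) by blast
      qed
    qed
    ultimately have "cone_arc i y x" "cone_arc j x y" using a(2) a'(2) ij by simp_all
    then show False using pos_opposite[of i "x - y" j] by (simp add: cone_arc_def)
  qed
qed

lemma crossing_no_closest:
  assumes id: "idx i j k" and c: "consec i x u y" "pos j (y - u)" and z: "closest k u z"
  shows False
proof -
  have a: "cone_arc i u x" "cone_arc k z u" using c z by (auto simp: consec_def closest_def)
  have px: "pos i (x - u)" "pos k (- (z - u))" using a by (auto simp: cone_arc_def)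
  have "star u z" using a by (auto simp: star_def)
  then show False using consec_no_star_dt[OF c(1) _ id] dt_pos_pos[OF id px(1) c(2)]
    dt_pos_neg[OF id px] dt_neg_pos[OF id px(2) c(2)] by blast
qed

lemma finite_vis: "finite {y. vis u y}"
  by (rule finite_subset[OF _ finite_V]) (auto simp: vis_def)

lemma nbr_neg_vis: "y \<in> nbr_neg k u \<Longrightarrow> vis u y"
proof -
  assume "y \<in> nbr_neg k u"
  then have "G u y" unfolding nbr_neg_def G_def by blast
  then show ?thesis using G_star star_vis by blast
qed

lemma nbr_arc_vis: "y \<in> nbr_arc k u x \<Longrightarrow> vis u y"
proof -
  assume "y \<in> nbr_arc k u x"
  then have "G u y" unfolding nbr_arc_def G_def by blast
  then show ?thesis using G_star star_vis by blast
qed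

lemma finite_nbr: "finite (nbr_neg k u)" "finite (nbr_arc i u x)" "finite {x. cone_arc i u x}" "finite (nbr_pos i u)"
proof -
  show "finite (nbr_neg k u)" by (rule finite_subset[OF _ finite_vis[of u]]) (auto dest: nbr_neg_vis)
  show a: "finite (nbr_arc i u x)" for x by (rule finite_subset[OF _ finite_vis[of u]]) (auto dest: nbr_arc_vis)
  show "finite {x. cone_arc i u x}" by (rule finite_subset[OF _ finite_vis[of u]]) (auto dest: arc_vis)
  then show "finite (nbr_pos i u)" unfolding nbr_pos_def using a by blast
qed

lemma nbr_neg_two:
  assumes "x \<in> nbr_neg k u" "y \<in> nbr_neg k u" "x \<noteq> y"
  shows "closest k u x \<and> closest k u y"
  using assms crossing_unique crossing_no_closest unfolding nbr_neg_def by blast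

text \<open>More than one neighbour means closest edges in different subcones, and a cone has at
  most two of those.\<close>

lemma card_nbr_neg: "card (nbr_neg k u) \<le> 2"
proof (rule card_le_2I[OF finite_nbr(1)], rule ccontr)
  fix x y z assume h: "x \<in> nbr_neg k u" "y \<in> nbr_neg k u" "z \<in> nbr_neg k u" "\<not> (x = y \<or> y = z \<or> x = z)"
  then have c: "closest k u x" "closest k u y" "closest k u z" using nbr_neg_two by blast+
  then have a: "cone_arc k x u" "cone_arc k y u" "cone_arc k z u" by (auto simp: closest_def)
  have "k < 3" using arc_pos[OF a(1)] by (simp add: pos_def)
  then obtain j i where id: "idx k j i" using idx_exists by blast
  have "ht j (v - u) > 0" if "cone_arc k v u" for v using arc_pos[OF that] unfolding pos_idx[OF id] by simp
  moreover have "vis u x" "vis u y" "vis u z" using a arc_vis vis_sym by blast+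
  ultimately show False using no_three_splits[of u x y z j] a closest_split c h(4) by blast
qed

lemma card_nbr_neg_unique:
  assumes "card (nbr_neg k u) = 2" "card (nbr_neg k' u) = 2"
  shows "k = k'"
proof -
  obtain x y where xy: "nbr_neg k u = {x, y}" "x \<noteq> y" using assms(1) by (auto simp: card_2_iff)
  obtain z w where zw: "nbr_neg k' u = {z, w}" "z \<noteq> w" using assms(2) by (auto simp: card_2_iff)
  have c: "closest k u x" "closest k u y" "closest k' u z" "closest k' u w"
    using nbr_neg_two[of x k u y] nbr_neg_two[of z k' u w] xy zw by auto
  then have a: "cone_arc k x u" "cone_arc k y u" "cone_arc k' z u" "cone_arc k' w u" by (auto simp: closest_def)
  then have "vis u x" "vis u y" "vis u z" "vis u w" using arc_vis vis_sym by blast+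
  then show ?thesis using splits_same_cone[OF _ _ _ _ arc_pos[OF a(1)] arc_pos[OF a(2)] arc_pos[OF a(3)] arc_pos[OF a(4)]]
    closest_split[OF c(1,2) xy(2)] closest_split[OF c(3,4) zw(2)] by blast
qed

lemma sum_card_nbr_neg: "card (nbr_neg 0 u) + card (nbr_neg 1 u) + card (nbr_neg 2 u) \<le> 4"
proof -
  have "card (nbr_neg 0 u) \<le> 2" "card (nbr_neg 1 u) \<le> 2" "card (nbr_neg 2 u) \<le> 2"
    using card_nbr_neg by blast+
  moreover have "\<not> (card (nbr_neg 0 u) = 2 \<and> card (nbr_neg 1 u) = 2)"
    "\<not> (card (nbr_neg 0 u) = 2 \<and> card (nbr_neg 2 u) = 2)"
    "\<not> (card (nbr_neg 1 u) = 2 \<and> card (nbr_neg 2 u) = 2)"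
    using card_nbr_neg_unique[of 0 u 1] card_nbr_neg_unique[of 0 u 2] card_nbr_neg_unique[of 1 u 2] by auto
  ultimately show ?thesis by linarith
qed

lemma side_nbr_unique:
  assumes id: "idx i j k" and c: "consec i x u y" "pos k (u - y)" and c': "consec i x u y'" "pos k (u - y')"
  shows "y = y'"
proof (rule ccontr)
  assume ne: "y \<noteq> y'"
  have a: "cone_arc i u x" using c by (auto simp: consec_def)
  have V: "u \<in> V" "y \<in> V" "y' \<in> V" "u \<noteq> y" "u \<noteq> y'" using c c' by (auto simp: consec_def cone_arc_def vis_def)
  have st: "star u y" "star u y'" using c c' by (auto simp: star_def)
  have d: "dt i j (x - u) (y - u) > 0" "dt i j (x - u) (y' - u) > 0"
    using dt_pos_neg[OF id arc_pos[OF a]] c(2) c'(2) by simp_all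
  consider "dt i j (y' - u) (y - u) > 0" | "dt i j (y - u) (y' - u) > 0"
    using dt_nonzero[OF id V ne] dt_antisym[of i j "y - u" "y' - u"] by force
  then show False
    using consec_no_star_dt[OF c(1) st(2) id] consec_no_star_dt[OF c'(1) st(1) id] d by cases blast+
qed

lemma side_nbr_excluded:
  assumes id: "idx i j k" and c: "consec i x u y" "pos k (u - y)"
    and x': "cone_arc i u x'" "dt i j (x - u) (x' - u) > 0"
  shows False
proof -
  have a: "cone_arc i u x" using c by (auto simp: consec_def)
  have "star u x'" using x' by (auto simp: star_def)
  moreover have "dt i j (x - u) (y - u) > 0" "dt i j (x' - u) (y - u) > 0"
    using dt_pos_neg[OF id arc_pos[OF a]] dt_pos_neg[OF id arc_pos[OF x'(1)]] c(2) by simp_all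
  ultimately show False using consec_no_star_dt[OF c(1) _ id] x'(2) by blast
qed

text \<open>A side neighbour \<open>y\<close> is higher than \<open>u\<close> in direction
  \<open>i\<close>, so it is nearer to \<open>x\<close>.\<close>

lemma closest_no_side_nbr:
  assumes id: "idx i j k" and c: "consec i x u y" "pos k (u - y)" and cl: "closest i x u"
  shows False
proof -
  have "cone_arc i y x" "\<not> splits S x u y" using c by (auto simp: consec_def)
  then have "ht i y \<le> ht i u" using cl by (auto simp: closest_def)
  moreover have "ht i (u - y) < 0" using c(2) id by (auto simp: pos_def idx_def)
  ultimately show False by simp
qed

lemma nbr_arc_cases:
  assumes id: "idx i j k" and y: "y \<in> nbr_arc i u x"
  shows "y = x \<and> closest i x u \<or> consec i x u y \<and> pos k (u - y) \<or> consec i x u y \<and> pos j (u - y)"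
proof -
  have "k' = k \<or> k' = j" if "idx i j' k'" for j' k' using id that unfolding idx_def by linarith
  then show ?thesis using y unfolding nbr_arc_def by blast
qed

text \<open>The candidates are the arc and one canonical edge on either side. The arc excludes both
  canonical edges, and a second arc in the same cone excludes the one on its side.\<close>

lemma card_nbr_arc:
  assumes i: "i < 3"
  shows "card (nbr_arc i u x) \<le> 2"
    and "cone_arc i u x \<Longrightarrow> cone_arc i u x' \<Longrightarrow> x \<noteq> x' \<Longrightarrow> card (nbr_arc i u x) \<le> 1"
proof -
  obtain j k where id: "idx i j k" using idx_exists[OF i] by blast
  note id' = idx_perm(1)[OF id]
  show "card (nbr_arc i u x) \<le> 2"
  proof (rule card_le_2I[OF finite_nbr(2)])
    fix a b c assume "a \<in> nbr_arc i u x" "b \<in> nbr_arc i u x" "c \<in> nbr_arc i u x"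
    then show "a = b \<or> b = c \<or> a = c"
      using nbr_arc_cases[OF id, of _ u x] side_nbr_unique[OF id] side_nbr_unique[OF id'] closest_no_side_nbr[OF id] closest_no_side_nbr[OF id']
      by metis
  qed
  assume a: "cone_arc i u x" "cone_arc i u x'" "x \<noteq> x'"
  have V: "u \<in> V" "x \<in> V" "x' \<in> V" "u \<noteq> x" "u \<noteq> x'" using a by (auto simp: cone_arc_def vis_def)
  have "dt i j (x - u) (x' - u) > 0 \<or> dt i k (x - u) (x' - u) > 0"
    using dt_nonzero[OF id V a(3)] dt_swap[OF id, of "x - u" "x' - u"] by linarith
  then obtain j0 k0 where id0: "idx i j0 k0" and d: "dt i j0 (x - u) (x' - u) > 0" using id id' by blast
  note id0' = idx_perm(1)[OF id0]
  have "\<forall>a\<in>nbr_arc i u x. \<forall>b\<in>nbr_arc i u x. a = b"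
    using nbr_arc_cases[OF id0, of _ u x] side_nbr_unique[OF id0'] closest_no_side_nbr[OF id0']
      side_nbr_excluded[OF id0 _ _ a(2) d] by metis
  then show "card (nbr_arc i u x) \<le> 1" using finite_nbr(2)[of i u x] by (simp add: card_le_Suc0_iff_eq)
qed

text \<open>Different arcs in one cone are split from each other, so there are at most two. A single
  arc carries at most two edges, each of two arcs at most one.\<close>

lemma card_nbr_pos:
  assumes i: "i < 3"
  shows "card (nbr_pos i u) \<le> 2"
proof -
  let ?R = "{x. cone_arc i u x}"
  have "card ?R \<le> 2"
  proof (rule card_le_2I[OF finite_nbr(3)], rule ccontr)
    fix x y z assume h: "x \<in> ?R" "y \<in> ?R" "z \<in> ?R" "\<not> (x = y \<or> y = z \<or> x = z)"
    then have a: "cone_arc i u x" "cone_arc i u y" "cone_arc i u z" by auto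
    have "ht i (x - u) > 0" "ht i (y - u) > 0" "ht i (z - u) > 0"
      using a arc_pos pos_ht by blast+
    then show False using no_three_splits[of u x y z i] a arc_vis arcs_split h(4) by blast
  qed
  then consider "card ?R = 0" | "card ?R = 1" | "card ?R = 2" by linarith
  then show ?thesis
  proof cases
    case 1
    then have "?R = {}" using finite_nbr(3) by simp
    then show ?thesis by (simp add: nbr_pos_def)
  next
    case 2
    then obtain x where "?R = {x}" by (auto simp: card_1_singleton_iff)
    then show ?thesis using card_nbr_arc(1)[OF i, of u x] by (simp add: nbr_pos_def)
  next
    case 3
    then obtain x y where R: "?R = {x, y}" "x \<noteq> y" by (auto simp: card_2_iff)
    then have "cone_arc i u x" "cone_arc i u y" by auto
    then have "card (nbr_arc i u x) \<le> 1" "card (nbr_arc i u y) \<le> 1"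
      using card_nbr_arc(2)[OF i] R(2) by metis+
    moreover have "nbr_pos i u = nbr_arc i u x \<union> nbr_arc i u y" unfolding nbr_pos_def R(1) by auto
    ultimately show ?thesis using card_Un_le[of "nbr_arc i u x" "nbr_arc i u y"] by simp
  qed
qed

text \<open>At most two for each of the three positive cones and four for the negative cones
  together.\<close>

lemma degree_G: "card {y. G u y} \<le> 10"
proof -
  let ?N = "nbr_neg 0 u \<union> nbr_neg 1 u \<union> nbr_neg 2 u" and ?P = "nbr_pos 0 u \<union> nbr_pos 1 u \<union> nbr_pos 2 u"
  have "i = 0 \<or> i = 1 \<or> i = 2" if "i < 3" for i :: nat using that by linarith
  then have "{y. G u y} \<subseteq> ?N \<union> ?P" using nbr_cover by blast
  then have "card {y. G u y} \<le> card (?N \<union> ?P)" by (intro card_mono) (auto simp: finite_nbr)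
  also have "\<dots> \<le> card ?N + card ?P" by (rule card_Un_le)
  also have "card ?N \<le> card (nbr_neg 0 u) + card (nbr_neg 1 u) + card (nbr_neg 2 u)"
    by (meson add_le_mono card_Un_le le_trans order_refl)
  also have "card ?P \<le> card (nbr_pos 0 u) + card (nbr_pos 1 u) + card (nbr_pos 2 u)"
    by (meson add_le_mono card_Un_le le_trans order_refl)
  finally show ?thesis
    using sum_card_nbr_neg[of u] card_nbr_pos[of 0 u] card_nbr_pos[of 1 u] card_nbr_pos[of 2 u] by simp
qed

end

section \<open>Spanning ratio\<close>

text \<open>Walks with their length as an index, so that concatenation adds lengths without sums
  over list positions. \<open>walk_gpath\<close> and \<open>gpath_walk\<close> translate from and to
  the list form.\<close>

inductive walk :: "complex set \<Rightarrow> (complex \<Rightarrow> complex \<Rightarrow> bool) \<Rightarrow> complex \<Rightarrow> complex \<Rightarrow> real \<Rightarrow> bool"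
  for V E where
  walk_refl: "x \<in> V \<Longrightarrow> walk V E x x 0"
| walk_step: "E x y \<Longrightarrow> x \<in> V \<Longrightarrow> walk V E y z r \<Longrightarrow> walk V E x z (dist x y + r)"

lemma walk_in: "walk V E x y r \<Longrightarrow> x \<in> V \<and> y \<in> V"
  by (induction rule: walk.induct) auto

lemma walk_trans: "walk V E x y r \<Longrightarrow> walk V E y z s \<Longrightarrow> walk V E x z (r + s)"
proof (induction rule: walk.induct)
  case (walk_step x y z' r)
  then show ?case using walk.walk_step[of E x y V z "r + s"] by (simp add: add.assoc)
qed simp

lemma walk_edge: "E x y \<Longrightarrow> x \<in> V \<Longrightarrow> y \<in> V \<Longrightarrow> walk V E x y (dist x y)"
  using walk_step[of E x y V y 0] walk_refl[of y V E] by simp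

lemma walk_sym:
  assumes "walk V E x y r" "\<And>a b. E a b \<Longrightarrow> E b a"
  shows "walk V E y x r"
  using assms(1)
proof (induction rule: walk.induct)
  case (walk_refl x)
  then show ?case by (rule walk.walk_refl)
next
  case (walk_step x y z r)
  have "walk V E y x (dist y x)" using walk_step walk_in assms(2) by (intro walk_edge) auto
  with walk_step show ?case using walk_trans[of V E z y r x "dist y x"] by (simp add: dist_commute add.commute)
qed

lemma walk_gpath:
  assumes "walk V E x y r"
  shows "\<exists>ys. gpath V E ys \<and> hd ys = x \<and> last ys = y \<and> path_len ys = r"
  using assms
proof (induction rule: walk.induct)
  case (walk_refl x)
  then show ?case by (intro exI[of _ "[x]"]) (simp add: gpath_def path_len_def)
next
  case (walk_step x y z r)
  then obtain ys where ys: "gpath V E ys" "hd ys = y" "last ys = z" "path_len ys = r" by blast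
  then obtain zs where zs: "ys = y # zs" by (cases ys) (auto simp: gpath_def)
  have "gpath V E (x # ys)" unfolding gpath_def
  proof (intro conjI allI impI)
    fix k assume "Suc k < length (x # ys)"
    then show "E ((x # ys) ! k) ((x # ys) ! Suc k)"
      using ys(1) walk_step(1) zs by (cases k) (auto simp: gpath_def)
  qed (use ys walk_step in \<open>auto simp: gpath_def\<close>)
  moreover have "path_len (x # ys) = dist x y + path_len ys"
    by (simp add: path_len_def zs sum.lessThan_Suc_shift del: sum.lessThan_Suc)
  ultimately show ?case using ys zs by (intro exI[of _ "x # ys"]) auto
qed

lemma gpath_walk:
  assumes "gpath V E xs" and "\<And>x y. E x y \<Longrightarrow> \<exists>r. walk V F x y r \<and> r \<le> c * dist x y"
  shows "\<exists>r. walk V F (hd xs) (last xs) r \<and> r \<le> c * path_len xs"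
  using assms(1)
proof (induction xs)
  case Nil
  then show ?case by (simp add: gpath_def)
next
  case (Cons x ys)
  show ?case
  proof (cases ys)
    case Nil
    then show ?thesis using Cons.prems walk_refl[of x V F] by (auto simp: gpath_def path_len_def)
  next
    case (Cons y zs)
    have k: "E (ys ! k) (ys ! Suc k)" if "Suc k < length ys" for k
      using Cons.prems that unfolding gpath_def by (metis Suc_less_eq length_Cons nth_Cons_Suc)
    then have "gpath V E ys" using Cons.prems Cons by (auto simp: gpath_def)
    then obtain r where r: "walk V F (hd ys) (last ys) r" "r \<le> c * path_len ys" using Cons.IH by blast
    have "E x y" using Cons.prems unfolding gpath_def Cons by force
    then obtain s where s: "walk V F x y s" "s \<le> c * dist x y" using assms(2) by blast
    have "path_len (x # ys) = dist x y + path_len ys"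
      by (simp add: path_len_def Cons sum.lessThan_Suc_shift del: sum.lessThan_Suc)
    then have "s + r \<le> c * path_len (x # ys)" using r s by (simp add: algebra_simps)
    moreover have "walk V F (hd (x # ys)) (last (x # ys)) (s + r)"
      using walk_trans[OF s(1), of "last ys" r] r(1) Cons by simp
    ultimately show ?thesis by blast
  qed
qed

text \<open>With \<open>a = - ht j d\<close> and \<open>b = - ht k d\<close> this is \<open>a^2 + a
  * b + b^2 \<le> (2 * a + b)^2 \<le> 4 * (a^2 + a * b + b^2)\<close>. The first bound charges an
  edge to heights, the second returns to lengths; their constants differ by the factor 2 of the
  spanning ratio.\<close>

lemma norm_le_ht:
  assumes id: "idx i j k" and "ht j d \<le> 0" "ht k d \<le> 0"
  shows "sqrt 3 / 2 * norm d \<le> ht i d - ht j d" "ht i d - ht j d \<le> sqrt 3 * norm d"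
proof -
  define a b where "a = - ht j d" and "b = - ht k d"
  have ab: "a \<ge> 0" "b \<ge> 0" "ht i d = a + b" "ht j d = - a" "ht k d = - b"
    using assms ht_sum[OF id, of d] by (auto simp: a_def b_def)
  have n: "(norm d)\<^sup>2 = 4 / 3 * (a\<^sup>2 + a * b + b\<^sup>2)"
    unfolding ht_norm[OF id] ab(3-5) by (simp add: power2_eq_square algebra_simps)
  have "(sqrt 3 / 2 * norm d)\<^sup>2 \<le> (2 * a + b)\<^sup>2"
    unfolding power_mult_distrib n using ab by (simp add: power_divide power2_eq_square algebra_simps)
  then have "sqrt 3 / 2 * norm d \<le> 2 * a + b" by (rule power2_le_imp_le) (use ab in simp)
  then show "sqrt 3 / 2 * norm d \<le> ht i d - ht j d" using ab by simp
  have "(2 * a + b)\<^sup>2 \<le> (sqrt 3 * norm d)\<^sup>2"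
    unfolding power_mult_distrib n using ab by (simp add: power2_eq_square algebra_simps)
  then have "2 * a + b \<le> sqrt 3 * norm d" by (rule power2_le_imp_le) simp
  then show "ht i d - ht j d \<le> sqrt 3 * norm d" using ab by simp
qed

lemma dt_trans:
  assumes "dt a b x y > 0" "dt a b y z > 0" "ht a x > 0" "ht a y > 0" "ht a z > 0"
  shows "dt a b x z > 0"
proof -
  have "ht a y * dt a b x z = ht a x * dt a b y z + ht a z * dt a b x y"
    by (simp add: dt_def algebra_simps)
  moreover have "ht a x * dt a b y z > 0" "ht a z * dt a b x y > 0" using assms by auto
  ultimately have "ht a y * dt a b x z > 0" by linarith
  then show ?thesis using assms(4) by (simp add: zero_less_mult_iff)
qed

lemma dt_lin [simp]:
  "dt a b (x + y) z = dt a b x z + dt a b y z" "dt a b z (x + y) = dt a b z x + dt a b z y"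
  "dt a b (c *\<^sub>R x) z = c * dt a b x z" "dt a b z (c *\<^sub>R x) = c * dt a b z x" "dt a b x x = 0"
  by (simp_all add: dt_def algebra_simps)

context polygon_scene
begin

definition ginf :: "complex \<Rightarrow> complex \<Rightarrow> bool" where
  "ginf x y \<longleftrightarrow> (\<exists>i. cone_arc i x y \<or> cone_arc i y x)"

text \<open>Lengths are scaled by \<open>sqrt 3 / 2\<close>, which makes the sides of the cone triangles equal to
  differences of \<^term>\<open>ht\<close>.\<close>

definition near :: "complex \<Rightarrow> complex \<Rightarrow> real \<Rightarrow> bool" where
  "near u v r \<longleftrightarrow> (\<exists>s. walk V ginf u v s \<and> sqrt 3 / 2 * s \<le> r)"

lemma near_trans:
  assumes "near u v r" "near v w s" "r + s \<le> t"
  shows "near u w t"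
proof -
  obtain a b where "walk V ginf u v a" "sqrt 3 / 2 * a \<le> r" "walk V ginf v w b" "sqrt 3 / 2 * b \<le> s"
    using assms by (auto simp: near_def)
  moreover have "sqrt 3 / 2 * (a + b) = sqrt 3 / 2 * a + sqrt 3 / 2 * b" by (simp add: algebra_simps)
  ultimately show ?thesis unfolding near_def using walk_trans assms(3)
    by (intro exI[of _ "a + b"]) (auto simp del: times_divide_eq_left)
qed

lemma near_sym: "near u v r \<Longrightarrow> near v u r"
  unfolding near_def using walk_sym[of V ginf] by (auto simp: ginf_def) blast

lemma near_mono: "near u v r \<Longrightarrow> r \<le> s \<Longrightarrow> near u v s"
  unfolding near_def by force

lemma near_arc:
  assumes id: "idx i j k" and a: "cone_arc i u v"
  shows "near u v (ht i (v - u) - ht j (v - u))"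
proof -
  have "u \<in> V" "v \<in> V" using a by (auto simp: cone_arc_def vis_def)
  then have "walk V ginf u v (dist u v)" using a by (intro walk_edge) (auto simp: ginf_def)
  moreover have "sqrt 3 / 2 * norm (v - u) \<le> ht i (v - u) - ht j (v - u)"
    using arc_pos[OF a] unfolding pos_idx[OF id] by (intro norm_le_ht[OF id]) auto
  ultimately show ?thesis unfolding near_def dist_norm by (metis norm_minus_commute)
qed

text \<open>The sign of \<open>dt i k\<close> puts \<open>y\<close> on the side of the ray
  \<open>u w\<close> that faces the positive cone \<open>k\<close>.\<close>

definition side_empty :: "nat \<Rightarrow> nat \<Rightarrow> complex \<Rightarrow> complex \<Rightarrow> bool" where
  "side_empty i k u w \<longleftrightarrow> \<not> (\<exists>y. vis u y \<and> pos i (y - u) \<and> \<not> splits S u w y \<and>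
     ht i y < ht i w \<and> dt i k (w - u) (y - u) > 0)"

text \<open>An intermediate stop \<open>t\<close> on the walk from \<open>u\<close> to
  \<open>w\<close>, lower than \<open>w\<close> and on the side of cone \<open>j\<close>; the empty
  triangle lets both legs inherit what is known about \<open>u\<close> and \<open>w\<close>.\<close>

definition linked :: "nat \<Rightarrow> nat \<Rightarrow> complex \<Rightarrow> complex \<Rightarrow> complex \<Rightarrow> bool" where
  "linked i j u w t \<longleftrightarrow> vis u w \<and> pos i (w - u) \<and> vis u t \<and> vis t w \<and> pos i (t - u) \<and>
     ht i t < ht i w \<and> ht j w < ht j t \<and> dt i j (w - u) (t - u) > 0 \<and>
     V \<inter> convex hull {u, w, t} \<subseteq> {u, w, t}"

text \<open>The ray turns about \<open>w\<close>, from \<open>u\<close> towards the arc target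
  \<open>v\<close>. The last conclusion records that \<open>t\<close> is the first vertex hit, which
  is the convexity of the chain of vertices between \<open>v\<close> and \<open>w\<close>.\<close>

lemma link_exists:
  assumes id: "idx i j k" and uw: "vis u w" "pos i (w - u)"
    and v: "cone_arc i u v" "\<not> splits S u v w" "dt i j (w - u) (v - u) > 0"
  obtains t \<alpha> \<beta> where "linked i j u w t"
    "t = u + \<alpha> *\<^sub>R (w - u) + \<beta> *\<^sub>R (v - u)" "0 \<le> \<alpha>" "0 < \<beta>" "\<alpha> + \<beta> \<le> 1"
    "\<not> splits S u v t" "ht i v \<le> ht i t" "\<alpha> = 0 \<longrightarrow> t = v" "ht i v < ht i w"
    "\<forall>q\<in>V - {u}. \<forall>\<xi> \<eta>. q = u + \<xi> *\<^sub>R (w - u) + \<eta> *\<^sub>R (v - u) \<longrightarrow>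
       0 \<le> \<xi> \<longrightarrow> 0 \<le> \<eta> \<longrightarrow> \<xi> + \<eta> \<le> 1 \<longrightarrow> \<beta> * (1 - \<xi>) \<le> \<eta> * (1 - \<alpha>)"
proof -
  have V: "u \<in> V" "w \<in> V" "v \<in> V" "u \<noteq> w" "u \<noteq> v" "free (closed_segment u w)" "free (closed_segment u v)"
    using uw v by (auto simp: vis_def cone_arc_def)
  have vw: "v \<noteq> w" using v(3) by auto
  have pv: "pos i (v - u)" using v by (simp add: cone_arc_def)
  have i3: "i < 3" "j < 3" using id by (auto simp: idx_def)
  have hv: "ht i v < ht i w"
    using v(1,2) uw gen_pos_ht[OF V(3,2) vw i3(1)] unfolding cone_arc_def by force
  define A B where "A = w - u" and "B = v - u"
  have A: "ht i A > 0" "ht j A < 0" "ht k A < 0" using uw(2) id by (auto simp: A_def pos_def idx_def)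
  have B: "ht i B > 0" "ht j B < 0" "ht k B < 0" using pv id by (auto simp: B_def pos_def idx_def)
  have AB: "ht i B < ht i A" "dt i j A B > 0" using hv v(3) by (auto simp: A_def B_def)
  have jAB: "ht j A < ht j B"
  proof (rule ccontr)
    assume "\<not> ht j A < ht j B"
    then have "(- ht j A) * ht i B \<le> (- ht j B) * ht i A" using A B AB by (intro mult_mono) auto
    then show False using AB(2) by (simp add: dt_def mult.commute)
  qed
  have nc: "cr (w - u) (v - u) \<noteq> 0" using noncollinear[of u w v] V vw by auto
  have "V \<inter> closed_segment u w \<subseteq> {u, w}" using vertex_on_segment[OF V(1,2)] by blast
  moreover have "good_apex u w v" using V v splits_commute by (auto simp: good_apex_def)
  ultimately obtain t \<alpha> \<beta> where t: "t \<in> V" "t \<noteq> w" "t \<noteq> u"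
    "t = u + \<alpha> *\<^sub>R (w - u) + \<beta> *\<^sub>R (v - u)" "0 \<le> \<alpha>" "0 < \<beta>" "\<alpha> + \<beta> \<le> 1"
    "V \<inter> convex hull {u, w, t} \<subseteq> {u, w, t}" "free (convex hull {u, w, t})"
    and ext: "\<And>q \<xi> \<eta>. q \<in> V \<Longrightarrow> q \<noteq> u \<Longrightarrow> q = u + \<xi> *\<^sub>R (w - u) + \<eta> *\<^sub>R (v - u) \<Longrightarrow>
       0 \<le> \<xi> \<Longrightarrow> 0 \<le> \<eta> \<Longrightarrow> \<xi> + \<eta> \<le> 1 \<Longrightarrow> \<beta> * (1 - \<xi>) \<le> \<eta> * (1 - \<alpha>)"
    using first_vertex[OF V(2,3) nc V(6,7)] by blast
  have tu: "t - u = \<alpha> *\<^sub>R A + \<beta> *\<^sub>R B" unfolding t(4) A_def B_def by simp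
  have wt: "w - t = (1 - \<alpha> - \<beta>) *\<^sub>R A + \<beta> *\<^sub>R (A - B)"
    unfolding t(4) A_def B_def by (simp add: algebra_simps)
  have "ht i (w - t) > 0"
    unfolding wt using A AB t by (simp add: add_nonneg_pos)
  moreover have "(1 - \<alpha> - \<beta>) * ht j A \<le> 0" "\<beta> * (ht j A - ht j B) < 0"
    using A jAB t by (auto simp: mult_nonneg_nonpos mult_pos_neg)
  then have "ht j (w - t) < 0" unfolding wt by simp
  moreover have pt: "pos i (t - u)" unfolding tu A_def B_def using uw pv t by (intro pos_comb) auto
  moreover have vut: "vis u t" "vis t w"
    using t V free_mono[OF t(9)] segment_subset_hull3(2)[of u t w] segment_subset_hull3(3)[of w t u]
    by (auto simp: vis_def closed_segment_commute)
  moreover have "dt i j (w - u) (t - u) > 0" using tu AB t by (simp add: A_def[symmetric])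
  ultimately have lk: "linked i j u w t" using uw t(8) by (auto simp: linked_def)
  have ns: "\<not> splits S u v t"
  proof (cases "\<alpha> = 0")
    case True
    then have "t - u = 0 *\<^sub>R (v - u) + \<beta> *\<^sub>R (v - u)" using tu by (simp add: B_def)
    then show ?thesis using splits_mono[of S u v t 0 \<beta> v] t(6) not_splits_vis arc_vis[OF v(1)] by auto
  next
    case False
    have "t - u = \<beta> *\<^sub>R (v - u) + \<alpha> *\<^sub>R (w - u)" using tu by (simp add: A_def B_def add.commute)
    then show ?thesis using splits_mono[of S u v t \<beta> \<alpha> w] t False v(2) by auto
  qed
  have hvt: "ht i v \<le> ht i t" using v(1) vut(1) pt ns unfolding cone_arc_def by blast
  have "t = v" if "\<alpha> = 0"
  proof -
    have "t = u + \<beta> *\<^sub>R (v - u)" using t(4) that by simp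
    then have "t \<in> closed_segment u v" using closed_segment_paramI[of \<beta> u v] t that by simp
    then show ?thesis using vertex_on_segment[OF V(1,3) t(1)] t(3) by blast
  qed
  then have 0: "\<alpha> = 0 \<longrightarrow> t = v" by blast
  have "\<forall>q\<in>V - {u}. \<forall>\<xi> \<eta>. q = u + \<xi> *\<^sub>R (w - u) + \<eta> *\<^sub>R (v - u) \<longrightarrow>
       0 \<le> \<xi> \<longrightarrow> 0 \<le> \<eta> \<longrightarrow> \<xi> + \<eta> \<le> 1 \<longrightarrow> \<beta> * (1 - \<xi>) \<le> \<eta> * (1 - \<alpha>)"
    by (intro ballI allI impI, rule ext) auto
  from that[OF lk t(4-7) ns hvt 0 hv this] show thesis .
qed

text \<open>In this position \<open>t\<close> is in the positive cone \<open>j\<close> of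
  \<open>w\<close>, so the leg is treated with \<open>w\<close> as its source. Its side facing
  \<open>u\<close> is empty, since below \<open>t\<close> it would have to hold vertices of the
  triangle \<open>u w t\<close>.\<close>

lemma linked_neg:
  assumes id: "idx i j k" and l: "linked i j u w t" and h: "ht k t < ht k w"
  shows "pos j (t - w)" "side_empty j k w t" "ht j (t - w) < ht i (w - u)"
proof -
  have id2: "idx j i k" "idx j k i" using id by (auto simp: idx_def)
  have L: "vis u w" "pos i (w - u)" "vis u t" "vis t w" "pos i (t - u)" "ht i t < ht i w" "ht j w < ht j t"
    "V \<inter> convex hull {u, w, t} \<subseteq> {u, w, t}" using l by (auto simp: linked_def)
  show p: "pos j (t - w)" unfolding pos_idx[OF id2(1)] using L h by simp
  have tj: "ht j t < ht j u" using L(5) unfolding pos_idx[OF id] by simp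
  have "ht k w < ht k u" using L(2) unfolding pos_idx[OF id] by simp
  then show "ht j (t - w) < ht i (w - u)"
    using tj ht_sum[OF id, of u] ht_sum[OF id, of w] by simp
  show "side_empty j k w t" unfolding side_empty_def
  proof
    assume "\<exists>y. vis w y \<and> pos j (y - w) \<and> \<not> splits S w t y \<and> ht j y < ht j t \<and> dt j k (t - w) (y - w) > 0"
    then obtain y where y: "vis w y" "pos j (y - w)" "ht j y < ht j t" "dt j k (t - w) (y - w) > 0" by blast
    have T: "ht j (t - w) > 0" "ht k (t - w) < 0" using p id by (auto simp: pos_def idx_def)
    have Y: "ht j (y - w) > 0" "ht k (y - w) < 0" using y id by (auto simp: pos_def idx_def)
    have U: "ht j (u - w) > 0" "ht k (u - w) > 0" using L(2) unfolding pos_idx[OF id] by simp_all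
    have d: "dt j k x (u - w) > 0" if "ht j x > 0" "ht k x < 0" for x
    proof -
      have "ht j x * ht k (u - w) > 0" "ht k x * ht j (u - w) < 0" using that U by (auto simp: mult_neg_pos)
      then show ?thesis unfolding dt_def by linarith
    qed
    obtain p q where pq: "p > 0" "q > 0" "y - w = p *\<^sub>R (t - w) + q *\<^sub>R (u - w)"
      using dt_between[OF id2(2) d[OF T] d[OF Y] y(4)] .
    have "(p + q) * ht j (t - w) \<le> p * ht j (t - w) + q * ht j (u - w)"
      using pq tj by (simp add: algebra_simps)
    also have "\<dots> = ht j (y - w)" unfolding pq(3) by simp
    also have "\<dots> < 1 * ht j (t - w)" using y by simp
    finally have lt: "p + q < 1" using T(1) mult_less_cancel_right_pos by blast
    have "y = w + q *\<^sub>R (u - w) + p *\<^sub>R (t - w)" using pq(3) by (simp add: algebra_simps)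
    also have "\<dots> \<in> convex hull {w, u, t}" using pq lt by (intro in_triangleI) auto
    finally have "y \<in> {u, w, t}" using L(8) y(1) by (auto simp: vis_def insert_commute)
    moreover have "y \<noteq> w" "y \<noteq> t" using y by (auto simp: vis_def)
    moreover have "y \<noteq> u" using Y U by auto
    ultimately show False by blast
  qed
qed

text \<open>A vertex beside \<open>t\<close> is either beyond the ray \<open>u w\<close> too, where
  emptiness for \<open>w\<close> excludes it, or between the two rays and, being lower than
  \<open>t\<close>, inside the empty triangle.\<close>

lemma linked_side_first:
  assumes id: "idx i j k" and l: "linked i j u w t" and e: "side_empty i k u w"
  shows "side_empty i k u t"
  unfolding side_empty_def
proof
  note id' = idx_perm(1)[OF id]
  have L: "vis u w" "pos i (w - u)" "vis u t" "vis t w" "pos i (t - u)" "ht i t < ht i w"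
    "dt i j (w - u) (t - u) > 0" "V \<inter> convex hull {u, w, t} \<subseteq> {u, w, t}" using l by (auto simp: linked_def)
  assume "\<exists>y. vis u y \<and> pos i (y - u) \<and> \<not> splits S u t y \<and> ht i y < ht i t \<and> dt i k (t - u) (y - u) > 0"
  then obtain y where y: "vis u y" "pos i (y - u)" "\<not> splits S u t y" "ht i y < ht i t" "dt i k (t - u) (y - u) > 0" by blast
  have tw: "dt i k (t - u) (w - u) > 0"
    using L(7) dt_swap[OF id, of "t - u" "w - u"] dt_antisym[of i j "t - u" "w - u"] by simp
  have "y \<noteq> w" using y L by auto
  then have "dt i k (w - u) (y - u) \<noteq> 0" using dt_nonzero[OF id'] L(1) y(1) by (auto simp: vis_def)
  then consider "dt i k (w - u) (y - u) > 0" | "dt i k (y - u) (w - u) > 0"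
    using dt_antisym[of i k "w - u" "y - u"] by linarith
  then show False
  proof cases
    case 1
    obtain \<alpha> \<beta> where ab: "\<alpha> > 0" "\<beta> > 0" "w - u = \<alpha> *\<^sub>R (t - u) + \<beta> *\<^sub>R (y - u)"
      using dt_between[OF id' y(5) 1 tw] .
    have "\<not> splits S u w y"
    proof
      assume "splits S u w y"
      moreover have "w - u = \<beta> *\<^sub>R (y - u) + \<alpha> *\<^sub>R (t - u)" using ab(3) by (simp add: add.commute)
      ultimately have "splits S u y t" using splits_mono[OF splits_commute] ab by (metis less_imp_le)
      then show False using y(3) splits_commute by blast
    qed
    moreover have "ht i y < ht i w" using y(4) L(6) by linarith
    ultimately show False using e y(1,2) 1 unfolding side_empty_def by blast
  next
    case 2
    obtain p q where pq: "p > 0" "q > 0" "y - u = p *\<^sub>R (t - u) + q *\<^sub>R (w - u)"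
      using dt_between[OF id' tw 2 y(5)] .
    have "(p + q) * ht i (t - u) \<le> p * ht i (t - u) + q * ht i (w - u)"
      using pq L(6) by (simp add: algebra_simps)
    also have "\<dots> = ht i (y - u)" unfolding pq(3) by simp
    also have "\<dots> < 1 * ht i (t - u)" using y by simp
    finally have lt: "p + q < 1" using pos_ht[OF L(5)] mult_less_cancel_right_pos by blast
    have "y = u + q *\<^sub>R (w - u) + p *\<^sub>R (t - u)" using pq(3) by (simp add: algebra_simps)
    also have "\<dots> \<in> convex hull {u, w, t}" using pq lt by (intro in_triangleI) auto
    finally have "y \<in> {u, w, t}" using L(8) y(1) by (auto simp: vis_def)
    then show False using y \<open>y \<noteq> w\<close> by (auto simp: vis_def)
  qed
qed

text \<open>The new source \<open>t\<close> may see vertices that \<open>u\<close> does not. If it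
  sees a forbidden one beyond the ray \<open>u w\<close>, the segment \<open>t y\<close> crosses
  \<open>u w\<close>, and the crossing gives \<open>u\<close> a forbidden vertex as well. Otherwise
  \<open>y\<close> is in the empty triangle.\<close>

lemma linked_side_second:
  assumes id: "idx i j k" and l: "linked i j u w t" and e: "side_empty i k u w" and c: "pos i (w - t)"
  shows "side_empty i k t w"
  unfolding side_empty_def
proof
  note id' = idx_perm(1)[OF id]
  have L: "vis u w" "pos i (w - u)" "vis u t" "vis t w" "pos i (t - u)" "ht i t < ht i w"
    "dt i j (w - u) (t - u) > 0" "V \<inter> convex hull {u, w, t} \<subseteq> {u, w, t}" using l by (auto simp: linked_def)
  assume "\<exists>y. vis t y \<and> pos i (y - t) \<and> \<not> splits S t w y \<and> ht i y < ht i w \<and> dt i k (w - t) (y - t) > 0"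
  then obtain y where y: "vis t y" "pos i (y - t)" "ht i y < ht i w" "dt i k (w - t) (y - t) > 0" by blast
  define T A where "T = t - u" and "A = w - u"
  have wtA: "w - t = A + (-1) *\<^sub>R T" by (simp add: T_def A_def)
  have TA: "dt i k T A > 0"
    using L(7) dt_swap[OF id, of T A] dt_antisym[of i j T A] by (simp add: T_def A_def)
  have pyu: "pos i (y - u)"
    using pos_comb[OF y(2) L(5), of 1 1] by simp
  have yw: "y \<noteq> w" "y \<noteq> u" "y \<noteq> t" using y(1,3) pyu by (auto simp: vis_def pos_def)
  have V: "u \<in> V" "w \<in> V" "y \<in> V" "t \<in> V" "u \<noteq> w" "t \<noteq> w" using L y by (auto simp: vis_def)
  have "dt i k A (y - u) \<noteq> 0" unfolding A_def using dt_nonzero[OF id' V(1,2,3)] V yw by auto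
  then consider "dt i k A (y - u) > 0" | "dt i k (y - u) A > 0"
    using dt_antisym[of i k A "y - u"] by linarith
  then show False
  proof cases
    case 1
    define f where "f = dt i k T A" define g where "g = dt i k A (y - u)"
    have fg: "f > 0" "g > 0" using TA 1 by (auto simp: f_def g_def)
    \<comment> \<open>Chosen so that \<open>dt i k A (p - u)\<close> vanishes: \<open>p\<close> is
      where \<open>t y\<close> meets the line \<open>u w\<close>.\<close>
    define s where "s = f / (f + g)"
    have s: "0 < s" "s < 1" using fg by (auto simp: s_def)
    define p where "p = t + s *\<^sub>R (y - t)"
    have p1: "p \<in> open_segment t y" unfolding p_def using s yw by (intro open_segment_paramI) auto
    have pu: "p - u = (1 - s) *\<^sub>R T + s *\<^sub>R (y - u)" unfolding p_def T_def by (simp add: algebra_simps)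
    have "dt i k A (p - u) = (1 - s) * dt i k A T + s * g" unfolding pu g_def by simp
    also have "\<dots> = s * (f + g) - f" using dt_antisym[of i k A T] by (simp add: f_def algebra_simps)
    also have "\<dots> = 0" using fg by (simp add: s_def)
    finally have z: "dt i k A (p - u) = 0" .
    obtain c where cc: "c \<noteq> 0" "\<And>a b. dt i k a b = c * cr a b" using dt_cr[OF id'] by blast
    then have "cr A (p - u) = 0" using z by simp
    moreover have "A \<noteq> 0" using V by (simp add: A_def)
    ultimately obtain m where m: "p - u = m *\<^sub>R A" by (rule cr_zero_parallel)
    have "ht i (p - u) = (1 - s) * ht i T + s * ht i (y - u)" unfolding pu by simp
    moreover have hT: "ht i T > 0" "ht i T < ht i A" "ht i (y - u) > 0" "ht i (y - u) < ht i A"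
      using L y pos_ht[OF L(5)] pos_ht[OF pyu] by (auto simp: T_def A_def)
    have "(1 - s) * ht i T + s * ht i (y - u) > 0" using s hT by (simp add: add_pos_pos)
    moreover have "(1 - s) * ht i T + s * ht i (y - u) < ht i A"
    proof -
      have "(1 - s) * ht i T < (1 - s) * ht i A" "s * ht i (y - u) < s * ht i A" using s hT by simp_all
      then show ?thesis by (simp add: algebra_simps)
    qed
    ultimately have "m * ht i A > 0" "m * ht i A < 1 * ht i A" using m by simp_all
    then have m01: "0 < m" "m < 1" using hT by (simp_all add: zero_less_mult_iff)
    have "p = u + m *\<^sub>R (w - u)" using m unfolding A_def by (metis add.commute diff_add_cancel)
    then have p2: "p \<in> open_segment u w" using open_segment_paramI[OF m01 V(5)] by simp
    have p1': "p \<in> open_segment y t" using p1 by (simp add: open_segment_commute)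
    have "{u, w} \<noteq> {y, t}" using yw by (auto simp: doubleton_eq_iff)
    then obtain x n \<beta> where x: "vis u x" "\<not> splits S u w x" "x - u = n *\<^sub>R (w - u) + \<beta> *\<^sub>R (y - u)"
      "0 \<le> n" "0 < \<beta>" "n + \<beta> \<le> 1"
      using crossing_visible[OF L(1) _ p2 p1'] y(1) vis_sym by blast
    have "pos i (x - u)" unfolding x(3) using L(2) pyu x by (intro pos_comb) auto
    moreover have "dt i k (w - u) (x - u) > 0" unfolding x(3) using 1 x(5) by (simp add: A_def)
    moreover have "ht i x < ht i w"
    proof -
      have "ht i (x - u) = n * ht i A + \<beta> * ht i (y - u)" unfolding x(3) A_def by simp
      also have "\<dots> < n * ht i A + \<beta> * ht i A" using x hT by simp
      also have "\<dots> = (n + \<beta>) * ht i A" by (simp add: algebra_simps)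
      also have "\<dots> \<le> ht i A" using x hT by (simp add: mult_left_le_one_le)
      finally show ?thesis by (simp add: A_def)
    qed
    ultimately show False using e x(1,2) unfolding side_empty_def by blast
  next
    case 2
    have "dt i k T (w - t) > 0" unfolding wtA dt_lin using TA by simp
    then have Tyt: "dt i k T (y - t) > 0"
      using dt_trans[OF _ y(4)] pos_ht[OF L(5)] pos_ht[OF c] pos_ht[OF y(2)] by (simp add: T_def)
    have yu: "y - u = T + (y - t)" by (simp add: T_def)
    have Ty: "dt i k T (y - u) > 0" unfolding yu dt_lin using Tyt by simp
    obtain p q where pq: "p > 0" "q > 0" "y - u = p *\<^sub>R T + q *\<^sub>R A"
      using dt_between[OF id' TA 2 Ty] .
    have "y - t = (p - 1) *\<^sub>R T + q *\<^sub>R A" using pq(3) yu by (simp add: algebra_simps)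
    then have "dt i k (w - t) (y - t) = dt i k (A + (-1) *\<^sub>R T) ((p - 1) *\<^sub>R T + q *\<^sub>R A)"
      unfolding wtA by simp
    also have "\<dots> = (1 - p - q) * dt i k T A"
      unfolding dt_lin using dt_antisym[of i k A T] by (simp add: algebra_simps)
    finally have "dt i k (w - t) (y - t) = (1 - p - q) * dt i k T A" .
    then have "(1 - p - q) * dt i k T A > 0" using y(4) by simp
    then have lt: "p + q < 1" using TA by (simp add: zero_less_mult_iff)
    have "y = u + q *\<^sub>R (w - u) + p *\<^sub>R (t - u)"
      using pq(3) unfolding T_def A_def by (simp add: algebra_simps)
    also have "\<dots> \<in> convex hull {u, w, t}" using pq lt by (intro in_triangleI) auto
    finally have "y \<in> {u, w, t}" using L(8) V(3) by auto
    then show False using yw by blast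
  qed
qed

end

text \<open>Here \<open>a\<close>, \<open>b\<close> are coordinates along the base and
  \<open>A\<close>, \<open>B\<close> heights of \<open>w\<close> and \<open>v\<close> over
  \<open>u\<close>; \<open>\<alpha>\<close>, \<open>\<beta>\<close> locate \<open>t\<close>, and
  \<open>\<gamma>\<close>, \<open>\<delta>\<close> locate a vertex of the triangle
  \<open>u t v\<close>. If \<open>t\<close> is not further out than \<open>w\<close>, convexity of
  the chain keeps that vertex from being further out than \<open>t\<close>.\<close>

lemma chain_bound:
  fixes a b :: real
  assumes "\<beta> > 0" "\<alpha> > 0" "\<alpha> < 1" "0 \<le> \<gamma>" "0 \<le> \<delta>" "\<gamma> + \<delta> \<le> 1" "\<beta> * (1 - \<gamma>) \<le> \<delta> * (1 - \<alpha>)"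
    "a * B > b * A" "B > 0" "\<alpha> * A + \<beta> * B \<ge> B" "\<alpha> * a + \<beta> * b \<le> a"
  shows "\<gamma> * (\<alpha> * a + \<beta> * b) + \<delta> * b \<le> \<alpha> * a + \<beta> * b"
proof -
  define x where "x = \<alpha> * a + \<beta> * b"
  have g1: "\<gamma> \<le> 1" using assms by linarith
  show ?thesis
  proof (cases "b \<ge> 0")
    case True
    have "x * B - b * (\<alpha> * A + \<beta> * B) = \<alpha> * (a * B - b * A)" by (simp add: x_def algebra_simps)
    moreover have "\<alpha> * (a * B - b * A) \<ge> 0" using assms by simp
    moreover have "b * (\<alpha> * A + \<beta> * B) \<ge> b * B" using True assms by (simp add: mult_left_mono)
    ultimately have "b * B \<le> x * B" by linarith
    then have bx: "b \<le> x" using assms by simp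
    have "\<gamma> * x + \<delta> * b \<le> \<gamma> * x + \<delta> * x" using bx assms by (simp add: mult_left_mono)
    also have "\<dots> = (\<gamma> + \<delta>) * x" by (simp add: algebra_simps)
    also have "\<dots> \<le> x" using bx True assms by (intro mult_left_le_one_le) auto
    finally show ?thesis by (simp add: x_def)
  next
    case False
    have "(1 - \<alpha>) * \<delta> * b \<le> \<beta> * (1 - \<gamma>) * b"
      using assms False by (intro mult_right_mono_neg) (auto simp: mult.commute)
    also have "\<dots> = (1 - \<gamma>) * (\<alpha> * (\<beta> * b) + (1 - \<alpha>) * (\<beta> * b))" by (simp add: algebra_simps)
    also have "\<dots> \<le> (1 - \<gamma>) * (\<alpha> * ((1 - \<alpha>) * a) + (1 - \<alpha>) * (\<beta> * b))"
    proof -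
      have "\<beta> * b \<le> (1 - \<alpha>) * a" using assms by (simp add: algebra_simps)
      then show ?thesis using assms g1 by (intro mult_left_mono add_right_mono) auto
    qed
    also have "\<dots> = (1 - \<alpha>) * ((1 - \<gamma>) * x)" by (simp add: x_def algebra_simps)
    finally have "(1 - \<alpha>) * (\<delta> * b) \<le> (1 - \<alpha>) * ((1 - \<gamma>) * x)" by (simp add: mult.assoc)
    then have "\<delta> * b \<le> (1 - \<gamma>) * x" using assms by simp
    then show ?thesis by (simp add: x_def[symmetric] algebra_simps)
  qed
qed

text \<open>The analogue for the end \<open>w\<close> of the chain, when \<open>v\<close> has a
  negative base coordinate.\<close>

lemma chain_end_bound:
  fixes a b :: real
  assumes "\<alpha> < 1" "\<xi> \<le> 1" "\<beta> * (1 - \<xi>) \<le> \<eta> * (1 - \<alpha>)" "\<beta> * b \<le> (1 - \<alpha>) * a" "b < 0"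
  shows "\<xi> * a + \<eta> * b \<le> a"
proof -
  have "(1 - \<alpha>) * (\<eta> * b) = (\<eta> * (1 - \<alpha>)) * b" by (simp add: algebra_simps)
  also have "\<dots> \<le> (\<beta> * (1 - \<xi>)) * b" using assms by (intro mult_right_mono_neg) auto
  also have "\<dots> = (1 - \<xi>) * (\<beta> * b)" by (simp add: algebra_simps)
  also have "\<dots> \<le> (1 - \<xi>) * ((1 - \<alpha>) * a)" using assms by (intro mult_left_mono) auto
  also have "\<dots> = (1 - \<alpha>) * ((1 - \<xi>) * a)" by (simp add: algebra_simps)
  finally have "\<eta> * b \<le> (1 - \<xi>) * a" using assms by simp
  then show ?thesis by (simp add: algebra_simps)
qed

lemma walk_subst:
  assumes "walk V E x y r" and "\<And>a b. E a b \<Longrightarrow> \<exists>s. walk V F a b s \<and> s \<le> c * dist a b"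
  shows "\<exists>s. walk V F x y s \<and> s \<le> c * r"
  using assms(1)
proof (induction rule: walk.induct)
  case (walk_refl x)
  then show ?case using walk.walk_refl[of x V F] by (intro exI[of _ 0]) simp
next
  case (walk_step x y z r)
  then obtain s where s: "walk V F y z s" "s \<le> c * r" by blast
  obtain s' where s': "walk V F x y s'" "s' \<le> c * dist x y" using assms(2)[OF walk_step(1)] by blast
  show ?case using walk_trans[OF s'(1) s(1)] s s' by (intro exI[of _ "s' + s"]) (simp add: algebra_simps)
qed

context polygon_scene
begin

text \<open>Up to scaling, \<open>ht i - ht j\<close> of \<open>w - u\<close> is the way along the
  side of the cone triangle on the zero line of \<open>ht j\<close> and then along the base to
  \<open>w\<close>. It is linear, so the bounds of two legs add up exactly.\<close>

definition bnd_side :: "nat \<Rightarrow> nat \<Rightarrow> nat \<Rightarrow> complex \<Rightarrow> complex \<Rightarrow> bool" where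
  "bnd_side i j k u w \<longleftrightarrow> (side_empty i k u w \<longrightarrow> near u w (ht i (w - u) - ht j (w - u)))"

definition bnd_max :: "nat \<Rightarrow> nat \<Rightarrow> nat \<Rightarrow> complex \<Rightarrow> complex \<Rightarrow> bool" where
  "bnd_max i j k u w \<longleftrightarrow> near u w (max (ht i (w - u) - ht j (w - u)) (ht i (w - u) - ht k (w - u)))"

text \<open>The convex chain of vertices from the arc target \<open>v\<close> to \<open>w\<close> never turns back when \<open>w\<close> is its
  extreme point in the direction parallel to the base of the cone.\<close>

definition bnd_chain :: "nat \<Rightarrow> nat \<Rightarrow> nat \<Rightarrow> complex \<Rightarrow> complex \<Rightarrow> bool" where
  "bnd_chain i j k u w \<longleftrightarrow> (\<forall>v. cone_arc i u v \<and> \<not> splits S u v w \<and> dt i j (w - u) (v - u) > 0 \<and>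
     (\<forall>q\<in>V \<inter> convex hull {u, w, v} - {u}. ht k q - ht j q \<le> ht k w - ht j w)
     \<longrightarrow> near u w (ht i (w - u) - ht j (w - u)))"

text \<open>The three bounds feed each other, and a leg may lie in a different cone, so the
  induction hypothesis is joint and ranges over all cones.\<close>

definition below :: "real \<Rightarrow> bool" where
  "below h \<longleftrightarrow> (\<forall>i j k u w. idx i j k \<and> vis u w \<and> pos i (w - u) \<and> ht i (w - u) < h \<longrightarrow>
     bnd_side i j k u w \<and> bnd_max i j k u w \<and> bnd_chain i j k u w)"

text \<open>If \<open>t\<close> is in cone \<open>j\<close> of \<open>w\<close>, the leg is walked
  backwards, and \<open>ht j - ht i\<close> of \<open>t - w\<close> is the required bound. Otherwise
  \<open>w\<close> is in cone \<open>i\<close> of \<open>t\<close>, and \<open>s\<close> makes the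
  \<open>j\<close> way available, either by emptiness or as the longer of the two ways.\<close>

lemma second_leg:
  assumes id: "idx i j k" and l: "linked i j u w t" and b: "below (ht i (w - u))"
    and s: "pos i (w - t) \<Longrightarrow> side_empty i k t w \<or> ht k t - ht j t \<le> ht k w - ht j w"
  shows "near t w (ht i (w - t) - ht j (w - t))"
proof -
  have L: "vis u w" "vis u t" "vis t w" "pos i (t - u)" "ht i t < ht i w" "ht j w < ht j t"
    using l by (auto simp: linked_def)
  have "ht k t \<noteq> ht k w" using gen_pos_ht[of t w k] L(3) id by (auto simp: vis_def idx_def)
  then consider "ht k t < ht k w" | "ht k w < ht k t" by linarith
  then show ?thesis
  proof cases
    case 1
    note N = linked_neg[OF id l 1]
    have "bnd_side j i k w t" using b N L(3) vis_sym idx_perm(2)[OF id] unfolding below_def by blast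
    then have "near w t (ht j (t - w) - ht i (t - w))" using N(2) by (simp add: bnd_side_def)
    then have "near t w (ht j (t - w) - ht i (t - w))" by (rule near_sym)
    then show ?thesis by (rule near_mono) simp
  next
    case 2
    then have p: "pos i (w - t)" unfolding pos_idx[OF id] using L by simp
    have "ht i (w - t) < ht i (w - u)" using pos_ht[OF L(4)] by simp
    then have bb: "bnd_side i j k t w" "bnd_max i j k t w" using b id L(3) p unfolding below_def by blast+
    from s[OF p] show ?thesis
    proof
      assume "side_empty i k t w"
      then show ?thesis using bb by (simp add: bnd_side_def)
    next
      assume "ht k t - ht j t \<le> ht k w - ht j w"
      then show ?thesis using bb(2) unfolding bnd_max_def by (elim near_mono) auto
    qed
  qed
qed

text \<open>Emptiness on the \<open>k\<close> side puts the arc target on the \<open>j\<close> side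
  and is inherited by the first leg, and by the second one whenever it lies in cone
  \<open>i\<close>.\<close>

lemma bnd_side_step:
  assumes id: "idx i j k" and uw: "vis u w" "pos i (w - u)" and b: "below (ht i (w - u))"
  shows "bnd_side i j k u w"
  unfolding bnd_side_def
proof
  assume e: "side_empty i k u w"
  obtain v where v: "cone_arc i u v" "\<not> splits S u v w" using arc_exists[OF uw] .
  show "near u w (ht i (w - u) - ht j (w - u))"
  proof (cases "v = w")
    case True
    then show ?thesis using near_arc[OF id v(1)] by simp
  next
    case False
    have V: "u \<in> V" "w \<in> V" "v \<in> V" "u \<noteq> w" "u \<noteq> v" using uw v by (auto simp: vis_def cone_arc_def)
    have "ht i v < ht i w"
      using v uw gen_pos_ht[OF V(3,2) False, of i] id unfolding cone_arc_def idx_def by force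
    then have "\<not> dt i k (w - u) (v - u) > 0"
      using e v splits_commute unfolding side_empty_def cone_arc_def by blast
    then have d: "dt i j (w - u) (v - u) > 0"
      using dt_nonzero[OF id V(1,2,3,4,5)] False dt_swap[OF id, of "w - u" "v - u"] by force
    obtain t where l: "linked i j u w t" using link_exists[OF id uw v d] by metis
    then have L: "vis u t" "pos i (t - u)" "ht i t < ht i w" by (auto simp: linked_def)
    have "bnd_side i j k u t" using b id L unfolding below_def by simp
    then have "near u t (ht i (t - u) - ht j (t - u))"
      using linked_side_first[OF id l e] by (simp add: bnd_side_def)
    moreover have "near t w (ht i (w - t) - ht j (w - t))"
      using second_leg[OF id l b] linked_side_second[OF id l e] by blast
    ultimately show ?thesis by (rule near_trans) simp
  qed
qed

text \<open>\<open>ht k - ht j\<close> is a coordinate along the base, so its ratio to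
  \<open>ht i\<close> orders directions by angle.\<close>

lemma cone_base_order:
  assumes id: "idx i j k"
  shows "(ht k a - ht j a) * ht i b - (ht k b - ht j b) * ht i a = 2 * dt i j a b"
proof -
  have e: "ht k a = - ht i a - ht j a" "ht k b = - ht i b - ht j b"
    using ht_sum[OF id, of a] ht_sum[OF id, of b] by linarith+
  show ?thesis unfolding e dt_def by (simp add: algebra_simps)
qed

text \<open>The extremality of \<open>w\<close> passes to the preceding chain vertex
  \<open>t\<close> by \<open>chain_bound\<close>, so the induction hypothesis covers the first leg;
  for the second it suffices that \<open>t\<close> is not further out than \<open>w\<close>.\<close>

lemma bnd_chain_step:
  assumes id: "idx i j k" and uw: "vis u w" "pos i (w - u)" and b: "below (ht i (w - u))"
  shows "bnd_chain i j k u w"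
  unfolding bnd_chain_def
proof (intro allI impI, elim conjE)
  fix v assume v: "cone_arc i u v" "\<not> splits S u v w" and d: "dt i j (w - u) (v - u) > 0"
    and Q: "\<forall>q\<in>V \<inter> convex hull {u, w, v} - {u}. ht k q - ht j q \<le> ht k w - ht j w"
  obtain t \<alpha> \<beta> where l: "linked i j u w t"
    and t: "t = u + \<alpha> *\<^sub>R (w - u) + \<beta> *\<^sub>R (v - u)" "0 \<le> \<alpha>" "0 < \<beta>" "\<alpha> + \<beta> \<le> 1"
      "\<not> splits S u v t" "ht i v \<le> ht i t" "\<alpha> = 0 \<longrightarrow> t = v" "ht i v < ht i w"
    and ext: "\<forall>q\<in>V - {u}. \<forall>\<xi> \<eta>. q = u + \<xi> *\<^sub>R (w - u) + \<eta> *\<^sub>R (v - u) \<longrightarrow>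
       0 \<le> \<xi> \<longrightarrow> 0 \<le> \<eta> \<longrightarrow> \<xi> + \<eta> \<le> 1 \<longrightarrow> \<beta> * (1 - \<xi>) \<le> \<eta> * (1 - \<alpha>)"
    using link_exists[OF id uw v d] .
  have L: "vis u t" "pos i (t - u)" "ht i t < ht i w" using l by (auto simp: linked_def)
  have tV: "t \<in> V" "t \<noteq> u" using L by (auto simp: vis_def)
  define x where "x q = ht k q - ht j q" for q
  have xl: "x (p + q) = x p + x q" "x (p - q) = x p - x q" "x (c *\<^sub>R p) = c * x p" for p q c
    by (simp_all add: x_def algebra_simps)
  have "t \<in> convex hull {u, w, v}" unfolding t(1) using t by (intro in_triangleI) auto
  then have xt: "x t \<le> x w" using Q tV by (auto simp: x_def)
  have "near u t (ht i (t - u) - ht j (t - u))"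
  proof (cases "t = v")
    case True
    then show ?thesis using near_arc[OF id v(1)] by simp
  next
    case False
    then have "\<alpha> \<noteq> 0" using t(7) by blast
    then have a0: "\<alpha> > 0" using t(2) by simp
    have "t - u = \<alpha> *\<^sub>R (w - u) + \<beta> *\<^sub>R (v - u)" unfolding t(1) by simp
    then have "dt i j (t - u) (v - u) = \<alpha> * dt i j (w - u) (v - u)" by simp
    then have dtv: "dt i j (t - u) (v - u) > 0" using a0 d by simp
    have Qt: "x q \<le> x t" if q: "q \<in> V \<inter> convex hull {u, t, v} - {u}" for q
    proof -
      have qV: "q \<in> V" "q \<noteq> u" using q by auto
      have "q \<in> convex hull {u, t, v}" using q by blast
      then obtain \<gamma> \<delta> where g: "q = u + \<gamma> *\<^sub>R (t - u) + \<delta> *\<^sub>R (v - u)" "0 \<le> \<gamma>" "0 \<le> \<delta>" "\<gamma> + \<delta> \<le> 1"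
        by (rule in_triangleE)
      have qe: "q = u + (\<gamma> * \<alpha>) *\<^sub>R (w - u) + (\<gamma> * \<beta> + \<delta>) *\<^sub>R (v - u)"
        unfolding g(1) t(1) by (simp add: algebra_simps)
      have "\<gamma> * (\<alpha> + \<beta>) \<le> \<gamma> * 1" using g t by (intro mult_left_mono) auto
      then have le: "\<gamma> * \<alpha> + (\<gamma> * \<beta> + \<delta>) \<le> 1" using g(4) by (simp add: algebra_simps)
      have nn: "0 \<le> \<gamma> * \<alpha>" "0 \<le> \<gamma> * \<beta> + \<delta>" using g t by auto
      have "q \<in> V - {u}" using qV by blast
      from ext[rule_format, OF this qe nn le] have "\<beta> * (1 - \<gamma> * \<alpha>) \<le> (\<gamma> * \<beta> + \<delta>) * (1 - \<alpha>)" .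
      then have star: "\<beta> * (1 - \<gamma>) \<le> \<delta> * (1 - \<alpha>)" by (simp add: algebra_simps)
      have "x (w - u) * ht i (v - u) - x (v - u) * ht i (w - u) > 0"
        unfolding x_def cone_base_order[OF id] using d by simp
      then have ab: "x (v - u) * ht i (w - u) < x (w - u) * ht i (v - u)" by simp
      have hv: "ht i (v - u) > 0" using v(1) by (simp add: cone_arc_def pos_def)
      have ht: "\<alpha> * ht i (w - u) + \<beta> * ht i (v - u) \<ge> ht i (v - u)"
      proof -
        have "ht i (t - u) = \<alpha> * ht i (w - u) + \<beta> * ht i (v - u)" unfolding t(1) by simp
        then show ?thesis using t(6) by simp
      qed
      have xtu: "x (t - u) = \<alpha> * x (w - u) + \<beta> * x (v - u)" unfolding t(1) by (simp add: xl)
      then have "\<alpha> * x (w - u) + \<beta> * x (v - u) \<le> x (w - u)" using xt by (simp add: xl)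
      moreover have "\<alpha> < 1" using t by simp
      ultimately have "\<gamma> * (\<alpha> * x (w - u) + \<beta> * x (v - u)) + \<delta> * x (v - u) \<le> \<alpha> * x (w - u) + \<beta> * x (v - u)"
        using chain_bound[OF t(3) a0 _ g(2-4) star ab hv ht] by blast
      moreover have "x (q - u) = \<gamma> * x (t - u) + \<delta> * x (v - u)" unfolding g(1) by (simp add: xl)
      ultimately have "x (q - u) \<le> x (t - u)" using xtu by simp
      then show ?thesis by (simp add: xl)
    qed
    have "bnd_chain i j k u t" using b id L unfolding below_def by simp
    then show ?thesis using v(1) t(5) dtv Qt unfolding bnd_chain_def x_def by blast
  qed
  moreover have "near t w (ht i (w - t) - ht j (w - t))"
    using second_leg[OF id l b] xt by (simp add: x_def)
  ultimately show "near u w (ht i (w - u) - ht j (w - u))" by (rule near_trans) simp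
qed

text \<open>If \<open>w\<close> is on the half of the cone facing cone \<open>k\<close>, no vertex
  of the triangle \<open>u w v\<close> is further out, and the chain bound applies. On the other
  half the same holds unless \<open>t\<close> overshoots \<open>w\<close>; but then the
  \<open>k\<close> way is the longer one for both legs, and the two \<open>k\<close> bounds add
  up.\<close>

lemma bnd_max_step_side:
  assumes id: "idx i j k" and uw: "vis u w" "pos i (w - u)" and b: "below (ht i (w - u))"
    and v: "cone_arc i u v" "\<not> splits S u v w" and d: "dt i j (w - u) (v - u) > 0"
  shows "bnd_max i j k u w"
proof -
  define x where "x q = ht k q - ht j q" for q
  have xl: "x (p + q) = x p + x q" "x (p - q) = x p - x q" "x (c *\<^sub>R p) = c * x p" for p q c
    by (simp_all add: x_def algebra_simps)
  define A B where "A = w - u" and "B = v - u"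
  have hA: "ht i A > 0" using pos_ht[OF uw(2)] by (simp add: A_def)
  have hB: "ht i B > 0" using v(1) by (simp add: cone_arc_def pos_def B_def)
  have "x A * ht i B - x B * ht i A > 0"
    unfolding x_def cone_base_order[OF id] using d by (simp add: A_def B_def)
  then have ab: "x B * ht i A < x A * ht i B" by simp
  obtain t \<alpha> \<beta> where l: "linked i j u w t"
    and t: "t = u + \<alpha> *\<^sub>R (w - u) + \<beta> *\<^sub>R (v - u)" "0 \<le> \<alpha>" "0 < \<beta>" "\<alpha> + \<beta> \<le> 1"
      "\<not> splits S u v t" "ht i v \<le> ht i t" "\<alpha> = 0 \<longrightarrow> t = v" "ht i v < ht i w"
    and ext: "\<forall>q\<in>V - {u}. \<forall>\<xi> \<eta>. q = u + \<xi> *\<^sub>R (w - u) + \<eta> *\<^sub>R (v - u) \<longrightarrow>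
       0 \<le> \<xi> \<longrightarrow> 0 \<le> \<eta> \<longrightarrow> \<xi> + \<eta> \<le> 1 \<longrightarrow> \<beta> * (1 - \<xi>) \<le> \<eta> * (1 - \<alpha>)"
    using link_exists[OF id uw v d] .
  have L: "vis u t" "vis t w" "pos i (t - u)" "ht i t < ht i w" "ht j w < ht j t" using l by (auto simp: linked_def)
  have AB: "ht i B < ht i A" using t(8) by (simp add: A_def B_def)
  have chain: "bnd_max i j k u w"
    if Q: "\<And>q \<xi> \<eta>. q \<in> V \<Longrightarrow> q \<noteq> u \<Longrightarrow> q = u + \<xi> *\<^sub>R (w - u) + \<eta> *\<^sub>R (v - u) \<Longrightarrow>
       0 \<le> \<xi> \<Longrightarrow> 0 \<le> \<eta> \<Longrightarrow> \<xi> + \<eta> \<le> 1 \<Longrightarrow> \<xi> * x A + \<eta> * x B \<le> x A"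
  proof -
    have "x q \<le> x w" if q: "q \<in> V \<inter> convex hull {u, w, v} - {u}" for q
    proof -
      have qV: "q \<in> V" "q \<noteq> u" using q by auto
      have "q \<in> convex hull {u, w, v}" using q by blast
      then obtain \<xi> \<eta> where e: "q = u + \<xi> *\<^sub>R (w - u) + \<eta> *\<^sub>R (v - u)" "0 \<le> \<xi>" "0 \<le> \<eta>" "\<xi> + \<eta> \<le> 1"
        by (rule in_triangleE)
      have "x (q - u) = \<xi> * x A + \<eta> * x B" unfolding e(1) A_def B_def by (simp add: xl)
      then have "x (q - u) \<le> x A" using Q[OF qV e] by simp
      then show ?thesis by (simp add: xl A_def)
    qed
    then have "near u w (ht i (w - u) - ht j (w - u))"
      using bnd_chain_step[OF id uw b] v d unfolding bnd_chain_def x_def by blast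
    then show ?thesis unfolding bnd_max_def by (rule near_mono) simp
  qed
  show ?thesis
  proof (cases "x A \<ge> 0")
    case True
    have "x B \<le> x A"
    proof (rule ccontr)
      assume n: "\<not> x B \<le> x A"
      then have "x A * ht i B \<le> x B * ht i A" using True AB hB by (intro mult_mono) auto
      then show False using ab by simp
    qed
    show ?thesis
    proof (rule chain)
      fix \<xi> \<eta> :: real assume h: "0 \<le> \<xi>" "0 \<le> \<eta>" "\<xi> + \<eta> \<le> 1"
      have "\<xi> * x A + \<eta> * x B \<le> \<xi> * x A + \<eta> * x A" using h \<open>x B \<le> x A\<close> by (simp add: mult_left_mono)
      also have "\<dots> = (\<xi> + \<eta>) * x A" by (simp add: algebra_simps)
      also have "\<dots> \<le> x A" using h True by (intro mult_left_le_one_le) auto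
      finally show "\<xi> * x A + \<eta> * x B \<le> x A" .
    qed
  next
    case False
    then have "x A * ht i B < 0" using hB by (simp add: mult_neg_pos)
    then have "x B * ht i A < 0" using ab by linarith
    then have xB: "x B < 0" using hA by (simp add: mult_less_0_iff)
    have a1: "\<alpha> < 1" using t by simp
    have xtu: "x (t - u) = \<alpha> * x A + \<beta> * x B" unfolding t(1) A_def B_def by (simp add: xl)
    show ?thesis
    proof (cases "x t \<le> x w")
      case True
      then have "x (t - u) \<le> x A" by (simp add: xl A_def)
      then have bb: "\<beta> * x B \<le> (1 - \<alpha>) * x A" unfolding xtu by (simp add: algebra_simps)
      show ?thesis
      proof (rule chain)
        fix q and \<xi> \<eta> :: real assume q: "q \<in> V" "q \<noteq> u" "q = u + \<xi> *\<^sub>R (w - u) + \<eta> *\<^sub>R (v - u)"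
          "0 \<le> \<xi>" "0 \<le> \<eta>" "\<xi> + \<eta> \<le> 1"
        have x1: "\<xi> \<le> 1" using q(5,6) by simp
        have "q \<in> V - {u}" using q(1,2) by blast
        from chain_end_bound[OF a1 x1 ext[rule_format, OF this q(3-6)] bb xB] show "\<xi> * x A + \<eta> * x B \<le> x A" .
      qed
    next
      case F: False
      have "ht k t \<noteq> ht k w" using gen_pos_ht[of t w k] L(2) id by (auto simp: vis_def idx_def)
      then have "ht k w < ht k t" using F L(5) by (simp add: x_def)
      then have p: "pos i (w - t)" unfolding pos_idx[OF id] using L by simp
      have "ht i (w - t) < ht i (w - u)" using pos_ht[OF L(3)] by simp
      then have "bnd_max i j k t w" using b id L(2) p unfolding below_def by blast
      then have 1: "near t w (ht i (w - t) - ht k (w - t))"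
        unfolding bnd_max_def by (rule near_mono) (use F in \<open>simp add: x_def\<close>)
      have "bnd_max i j k u t" using b id L unfolding below_def by simp
      moreover have "\<alpha> * x A \<le> 0" "\<beta> * x B < 0" using t False xB by (auto simp: mult_nonneg_nonpos mult_pos_neg)
      then have "x (t - u) < 0" using xtu by linarith
      ultimately have 2: "near u t (ht i (t - u) - ht k (t - u))"
        unfolding bnd_max_def by (elim near_mono) (simp add: x_def)
      have "near u w (ht i (w - u) - ht k (w - u))" by (rule near_trans[OF 2 1]) simp
      then show ?thesis unfolding bnd_max_def by (rule near_mono) simp
    qed
  qed
qed

lemma bnd_max_step:
  assumes id: "idx i j k" and uw: "vis u w" "pos i (w - u)" and b: "below (ht i (w - u))"
  shows "bnd_max i j k u w"
proof -
  obtain v where v: "cone_arc i u v" "\<not> splits S u v w" using arc_exists[OF uw] .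
  show ?thesis
  proof (cases "v = w")
    case True
    then have "near u w (ht i (w - u) - ht j (w - u))" using near_arc[OF id v(1)] by simp
    then show ?thesis unfolding bnd_max_def by (rule near_mono) simp
  next
    case False
    have V: "u \<in> V" "w \<in> V" "v \<in> V" "u \<noteq> w" "u \<noteq> v" using uw v by (auto simp: vis_def cone_arc_def)
    have "dt i j (w - u) (v - u) \<noteq> 0" using dt_nonzero[OF id V] False by simp
    then consider "dt i j (w - u) (v - u) > 0" | "dt i k (w - u) (v - u) > 0"
      using dt_swap[OF id, of "w - u" "v - u"] by linarith
    then show ?thesis
    proof cases
      case 1
      then show ?thesis by (rule bnd_max_step_side[OF id uw b v])
    next
      case 2
      then have "bnd_max i k j u w" by (rule bnd_max_step_side[OF idx_perm(1)[OF id] uw b v])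
      then show ?thesis unfolding bnd_max_def by (simp add: max.commute)
    qed
  qed
qed

text \<open>Cone triangles have real sizes; the induction is on the finite number of triples of a
  cone and two vertices with a smaller height difference.\<close>

lemma all_bounds:
  assumes "idx i j k" "vis u w" "pos i (w - u)"
  shows "bnd_side i j k u w \<and> bnd_max i j k u w \<and> bnd_chain i j k u w"
proof -
  define U where "U h = {p \<in> {..<3} \<times> V \<times> V. ht (fst p) (snd (snd p) - fst (snd p)) < h}" for h
  have fin: "finite (U h)" for h unfolding U_def using finite_V by simp
  show ?thesis using assms
  proof (induction "card (U (ht i (w - u)))" arbitrary: i j k u w rule: less_induct)
    case less
    have "below (ht i (w - u))" unfolding below_def
    proof (intro allI impI, elim conjE)
      fix i' j' k' u' w' assume h: "idx i' j' k'" "vis u' w'" "pos i' (w' - u')" "ht i' (w' - u') < ht i (w - u)"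
      have "(i', u', w') \<in> U (ht i (w - u))" using h by (auto simp: U_def vis_def idx_def)
      moreover have "(i', u', w') \<notin> U (ht i' (w' - u'))" by (simp add: U_def)
      moreover have "U (ht i' (w' - u')) \<subseteq> U (ht i (w - u))" using h(4) unfolding U_def by fastforce
      ultimately have "card (U (ht i' (w' - u'))) < card (U (ht i (w - u)))"
        using fin by (intro psubset_card_mono) auto
      then show "bnd_side i' j' k' u' w' \<and> bnd_max i' j' k' u' w' \<and> bnd_chain i' j' k' u' w'"
        using less.hyps h by blast
    qed
    then show ?case using bnd_side_step bnd_max_step bnd_chain_step less.prems by blast
  qed
qed

text \<open>The three height differences are nonzero with sum zero, so one sign occurs once and the
  other twice.\<close>

lemma pos_cases:
  assumes "u \<in> V" "w \<in> V" "u \<noteq> w"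
  obtains i where "pos i (w - u)" | i where "pos i (u - w)"
proof -
  have n: "ht 0 u \<noteq> ht 0 w" "ht 1 u \<noteq> ht 1 w" "ht 2 u \<noteq> ht 2 w"
    using gen_pos_ht[OF assms] by simp_all
  have id: "idx 0 1 2" "idx 1 0 2" "idx 2 0 1" by (simp_all add: idx_def)
  have s: "ht 0 u + ht 1 u + ht 2 u = 0" "ht 0 w + ht 1 w + ht 2 w = 0" using ht_sum[OF id(1)] by auto
  have "(\<exists>i. pos i (w - u)) \<or> (\<exists>i. pos i (u - w))"
  proof (rule ccontr)
    assume "\<not> ?thesis"
    then have "\<not> pos 0 (w - u)" "\<not> pos 1 (w - u)" "\<not> pos 2 (w - u)"
      "\<not> pos 0 (u - w)" "\<not> pos 1 (u - w)" "\<not> pos 2 (u - w)" by blast+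
    with n s show False unfolding pos_idx[OF id(1)] pos_idx[OF id(2)] pos_idx[OF id(3)] ht_diff by argo
  qed
  then show thesis using that by blast
qed

lemma ginf_2_spanner:
  assumes uw: "vis u w"
  shows "\<exists>s. walk V ginf u w s \<and> s \<le> 2 * dist u w"
proof -
  have main: "\<exists>s. walk V ginf u w s \<and> s \<le> 2 * dist u w" if uw: "vis u w" "pos i (w - u)" for u w i
  proof -
    have "i < 3" using uw by (simp add: pos_def)
    then obtain j k where id: "idx i j k" using idx_exists by blast
    have "bnd_max i j k u w" using all_bounds[OF id uw] by blast
    then obtain s where s: "walk V ginf u w s"
      "sqrt 3 / 2 * s \<le> max (ht i (w - u) - ht j (w - u)) (ht i (w - u) - ht k (w - u))"
      by (auto simp: bnd_max_def near_def)
    have p: "ht j (w - u) \<le> 0" "ht k (w - u) \<le> 0" using uw(2) unfolding pos_idx[OF id] by auto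
    have "ht i (w - u) - ht j (w - u) \<le> sqrt 3 * norm (w - u)" "ht i (w - u) - ht k (w - u) \<le> sqrt 3 * norm (w - u)"
      using norm_le_ht(2)[OF id p] norm_le_ht(2)[OF idx_perm(1)[OF id] p(2,1)] by auto
    then have "sqrt 3 / 2 * s \<le> sqrt 3 * norm (w - u)" using s(2) by linarith
    then have "sqrt 3 * s \<le> sqrt 3 * (2 * norm (w - u))" by simp
    then have "s \<le> 2 * norm (w - u)" by (rule mult_left_le_imp_le) simp
    then show ?thesis using s(1) by (auto simp: dist_norm norm_minus_commute)
  qed
  have "u \<in> V" "w \<in> V" "u \<noteq> w" using uw by (auto simp: vis_def)
  then show ?thesis
  proof (cases rule: pos_cases)
    case (1 i)
    then show ?thesis using main uw by blast
  next
    case (2 i)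
    then obtain s where s: "walk V ginf w u s" "s \<le> 2 * dist w u" using main uw vis_sym by blast
    have "walk V ginf u w s" using walk_sym[OF s(1)] by (auto simp: ginf_def)
    then show ?thesis using s(2) by (auto simp: dist_commute)
  qed
qed

section \<open>From arcs to closest edges and canonical paths\<close>

lemma G_sym: "G x y \<Longrightarrow> G y x"
  unfolding G_def using consec_sym by blast

text \<open>Whatever the sign of \<open>ht i d\<close>, either \<open>d\<close> is in the closed
  cone \<open>k\<close> or \<open>- d\<close> is in the closed cone \<open>j\<close>, and the bound
  is the same.\<close>

lemma norm_le_ht_mixed:
  assumes id: "idx i j k" and "ht j d \<le> 0" "ht k d \<ge> 0"
  shows "sqrt 3 / 2 * norm d \<le> ht k d - ht j d"
proof (cases "ht i d \<le> 0")
  case True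
  then show ?thesis using norm_le_ht(1)[of k j i d] idx_perm(5)[OF id] assms by simp
next
  case False
  have n: "ht m (- d) = - ht m d" for m using ht_diff[of m 0 d] by simp
  show ?thesis using norm_le_ht(1)[of j k i "- d"] idx_perm(3)[OF id] assms False by (simp add: n)
qed

lemma siblings_order:
  assumes id: "idx i j k" and v: "cone_arc i v u" and w: "cone_arc i w u" and n: "\<not> splits S u v w"
    and d: "dt j k (v - u) (w - u) > 0"
  shows "ht j w < ht j v" "ht k v < ht k w"
proof -
  have ne: "v \<noteq> w" using d by auto
  have p: "ht j (v - u) > 0" "ht k (v - u) > 0" "ht j (w - u) > 0" "ht k (w - u) > 0"
    using arc_pos[OF v] arc_pos[OF w] unfolding pos_idx[OF id] by simp_all
  have "\<not> (ht j v < ht j w \<and> ht k w < ht k v)"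
  proof
    assume h: "ht j v < ht j w \<and> ht k w < ht k v"
    have "ht j (v - u) * ht k (w - u) \<le> ht j (w - u) * ht k (v - u)"
      using h p by (intro mult_mono) auto
    then show False using d unfolding dt_def by (simp add: mult.commute)
  qed
  then show "ht j w < ht j v" "ht k v < ht k w" using siblings_side[OF id v w ne n] by blast+
qed

text \<open>Induction on the number of arcs between \<open>v\<close> and \<open>w\<close>.
  Monotonicity in both heights makes the edge bounds telescope, so the total depends on the two ends
  only.\<close>

lemma canonical_walk:
  assumes id: "idx i j k" and v: "cone_arc i v u" and w: "cone_arc i w u" and n: "\<not> splits S u v w"
    and d: "dt j k (v - u) (w - u) > 0"
  shows "\<exists>r. walk V G v w r \<and> sqrt 3 / 2 * r \<le> ht k (w - v) - ht j (w - v)"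
proof -
  define C where "C v w = {x. cone_arc i x u \<and> (\<exists>\<alpha> \<beta>. \<alpha> > 0 \<and> \<beta> > 0 \<and> x - u = \<alpha> *\<^sub>R (v - u) + \<beta> *\<^sub>R (w - u))}" for v w
  have fin: "finite (C v w)" for v w
    by (rule finite_subset[OF _ finite_V]) (auto simp: C_def cone_arc_def vis_def)
  show ?thesis using v w n d
  proof (induction "card (C v w)" arbitrary: v w rule: less_induct)
    case less
    note v = less.prems(1) and w = less.prems(2) and n = less.prems(3) and d = less.prems(4)
    have V: "v \<in> V" "w \<in> V" using v w by (auto simp: cone_arc_def vis_def)
    have ne: "v \<noteq> w" using d by auto
    show ?case
    proof (cases "C v w = {}")
      case True
      then have "consec i u v w" using v w n ne unfolding consec_def C_def by blast
      then have "walk V G v w (dist v w)" using V by (intro walk_edge) (auto simp: G_def)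
      moreover have "sqrt 3 / 2 * norm (w - v) \<le> ht k (w - v) - ht j (w - v)"
        using siblings_order[OF id v w n d] by (intro norm_le_ht_mixed[OF id]) auto
      ultimately show ?thesis unfolding dist_norm by (metis norm_minus_commute)
    next
      case False
      then obtain x \<alpha> \<beta> where x: "cone_arc i x u" "\<alpha> > 0" "\<beta> > 0" "x - u = \<alpha> *\<^sub>R (v - u) + \<beta> *\<^sub>R (w - u)"
        unfolding C_def by blast
      have xC: "x \<in> C v w" unfolding C_def using x by blast
      have d1: "dt j k (v - u) (x - u) > 0" unfolding x(4) using d x by simp
      have d2: "dt j k (x - u) (w - u) > 0" unfolding x(4) using d x by simp
      have n1: "\<not> splits S u v x" using splits_mono[of S u v x \<alpha> \<beta> w] x n by auto
      have "x - u = \<beta> *\<^sub>R (w - u) + \<alpha> *\<^sub>R (v - u)" using x(4) by (simp add: add.commute)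
      then have n2: "\<not> splits S u x w" using splits_mono[of S u w x \<beta> \<alpha> v] x n splits_commute by (meson less_imp_le)
      obtain c where cc: "c \<noteq> 0" "\<And>a b. dt j k a b = c * cr a b" using dt_cr[OF idx_perm(3)[OF id]] by blast
      have nc1: "cr (v - u) (x - u) \<noteq> 0" and nc2: "cr (x - u) (w - u) \<noteq> 0" using d1 d2 cc by auto
      have "C v x \<subseteq> C v w"
      proof
        fix y assume "y \<in> C v x"
        then obtain a b where y: "cone_arc i y u" "a > 0" "b > 0" "y - u = a *\<^sub>R (v - u) + b *\<^sub>R (x - u)"
          unfolding C_def by blast
        have "y - u = (a + b * \<alpha>) *\<^sub>R (v - u) + (b * \<beta>) *\<^sub>R (w - u)"
          unfolding y(4) x(4) by (simp add: algebra_simps)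
        moreover have "a + b * \<alpha> > 0" "b * \<beta> > 0" using x y by (auto simp: add_pos_pos)
        ultimately show "y \<in> C v w" unfolding C_def using y(1) by blast
      qed
      moreover have "x \<notin> C v x"
      proof
        assume "x \<in> C v x"
        then obtain a b where y: "a > 0" "b > 0" "x - u = a *\<^sub>R (v - u) + b *\<^sub>R (x - u)" unfolding C_def by blast
        then have "0 *\<^sub>R (v - u) + 1 *\<^sub>R (x - u) = a *\<^sub>R (v - u) + b *\<^sub>R (x - u)" by simp
        from cr_coords_unique(1)[OF nc1 this] y show False by simp
      qed
      ultimately have lt1: "card (C v x) < card (C v w)" using xC fin by (intro psubset_card_mono) auto
      have "C x w \<subseteq> C v w"
      proof
        fix y assume "y \<in> C x w"
        then obtain a b where y: "cone_arc i y u" "a > 0" "b > 0" "y - u = a *\<^sub>R (x - u) + b *\<^sub>R (w - u)"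
          unfolding C_def by blast
        have "y - u = (a * \<alpha>) *\<^sub>R (v - u) + (a * \<beta> + b) *\<^sub>R (w - u)"
          unfolding y(4) x(4) by (simp add: algebra_simps)
        moreover have "a * \<alpha> > 0" "a * \<beta> + b > 0" using x y by (auto simp: add_pos_pos)
        ultimately show "y \<in> C v w" unfolding C_def using y(1) by blast
      qed
      moreover have "x \<notin> C x w"
      proof
        assume "x \<in> C x w"
        then obtain a b where y: "a > 0" "b > 0" "x - u = a *\<^sub>R (x - u) + b *\<^sub>R (w - u)" unfolding C_def by blast
        then have "1 *\<^sub>R (x - u) + 0 *\<^sub>R (w - u) = a *\<^sub>R (x - u) + b *\<^sub>R (w - u)" by simp
        from cr_coords_unique(2)[OF nc2 this] y show False by simp
      qed
      ultimately have lt2: "card (C x w) < card (C v w)" using xC fin by (intro psubset_card_mono) auto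
      obtain r1 where r1: "walk V G v x r1" "sqrt 3 / 2 * r1 \<le> ht k (x - v) - ht j (x - v)"
        using less.hyps[OF lt1 v x(1) n1 d1] by blast
      obtain r2 where r2: "walk V G x w r2" "sqrt 3 / 2 * r2 \<le> ht k (w - x) - ht j (w - x)"
        using less.hyps[OF lt2 x(1) w n2 d2] by blast
      have "sqrt 3 / 2 * (r1 + r2) = sqrt 3 / 2 * r1 + sqrt 3 / 2 * r2" by (simp add: algebra_simps)
      also have "\<dots> \<le> ht k (w - v) - ht j (w - v)" using r1 r2 unfolding ht_diff by linarith
      finally show ?thesis using walk_trans[OF r1(1) r2(1)] by blast
    qed
  qed
qed

lemma closest_exists:
  assumes w: "cone_arc i w u"
  obtains v where "closest i u v" "\<not> splits S u v w"
proof -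
  have "i < 3" using arc_pos[OF w] by (simp add: pos_def)
  then obtain j k where id: "idx i j k" using idx_exists by blast
  have hj: "ht j (v - u) > 0" if "cone_arc i v u" for v using arc_pos[OF that] unfolding pos_idx[OF id] by simp
  define W where "W = {v. cone_arc i v u \<and> \<not> splits S u w v}"
  have fin: "finite W" by (rule finite_subset[OF _ finite_V]) (auto simp: W_def cone_arc_def vis_def)
  have vw: "vis u v" if "cone_arc i v u" for v using that arc_vis vis_sym by blast
  have "w \<in> W" using w vw not_splits_vis by (simp add: W_def)
  then have "Max (ht i ` W) \<in> ht i ` W" using fin by (intro Max_in) auto
  then obtain v where v: "v \<in> W" "ht i v = Max (ht i ` W)" by auto
  have av: "cone_arc i v u" "\<not> splits S u w v" using v(1) by (auto simp: W_def)
  have "ht i x \<le> ht i v" if x: "cone_arc i x u" "\<not> splits S u v x" for x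
  proof -
    have "\<not> splits S u w x"
      by (rule not_splits_trans[OF vw[OF av(1)] vw[OF w] vw[OF x(1)] hj[OF av(1)] hj[OF w] hj[OF x(1)] av(2) x(2)])
    then have "x \<in> W" using x by (simp add: W_def)
    then show ?thesis using v(2) fin by simp
  qed
  then have "closest i u v" using av(1) by (simp add: closest_def)
  moreover have "\<not> splits S u v w" using av(2) splits_commute by blast
  ultimately show thesis by (rule that)
qed

lemma arc_G_walk:
  assumes w: "cone_arc i w u"
  shows "\<exists>r. walk V G u w r \<and> r \<le> 3 * dist u w"
proof -
  obtain v where v: "closest i u v" "\<not> splits S u v w" using closest_exists[OF w] .
  have av: "cone_arc i v u" using v by (simp add: closest_def)
  have V: "u \<in> V" "v \<in> V" "w \<in> V" "v \<noteq> u" "w \<noteq> u" using av w by (auto simp: cone_arc_def vis_def)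
  have "G u v" using v by (auto simp: G_def)
  then have e: "walk V G u v (dist u v)" using V by (intro walk_edge)
  show ?thesis
  proof (cases "v = w")
    case True
    then show ?thesis using e by (intro exI[of _ "dist u v"]) simp
  next
    case False
    have "i < 3" using arc_pos[OF w] by (simp add: pos_def)
    then obtain j0 k0 where id0: "idx i j0 k0" using idx_exists by blast
    have "dt j0 k0 (v - u) (w - u) \<noteq> 0" using dt_nonzero[OF idx_perm(3)[OF id0]] V False by auto
    then have "dt j0 k0 (v - u) (w - u) > 0 \<or> dt k0 j0 (v - u) (w - u) > 0" by (auto simp: dt_def)
    then obtain j k where id: "idx i j k" and d: "dt j k (v - u) (w - u) > 0"
      using id0 idx_perm(1)[OF id0] by blast
    obtain r where r: "walk V G v w r" "sqrt 3 / 2 * r \<le> ht k (w - v) - ht j (w - v)"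
      using canonical_walk[OF id av w v(2) d] by blast
    \<comment> \<open>In units of \<open>sqrt 3 / 2\<close> the closest edge costs at most
      \<open>P + Q\<close> and the canonical path \<open>(q - Q) + (P - p)\<close>, together
      \<open>2 * P + q - p\<close>. Since \<open>P + Q \<le> p + q\<close>, this is at most
      \<open>p + 3 * q\<close>, whose square is at most 9 times \<open>p^2 + p * q + q^2\<close>.
      This is where the factor 3 comes from.\<close>
    define P Q p q where "P = ht j (v - u)" and "Q = ht k (v - u)" and "p = ht j (w - u)" and "q = ht k (w - u)"
    have pos: "P > 0" "Q > 0" "p > 0" "q > 0"
      using arc_pos[OF av] arc_pos[OF w] unfolding pos_idx[OF id] P_def Q_def p_def q_def by simp_all
    have "ht i w \<le> ht i v" using v w unfolding closest_def by blast
    then have PQ: "P + Q \<le> p + q"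
      using ht_sum[OF id, of "v - u"] ht_sum[OF id, of "w - u"] unfolding P_def Q_def p_def q_def ht_diff by linarith
    have nm: "(sqrt 3 / 2 * norm d)\<^sup>2 = (ht j d)\<^sup>2 + ht j d * ht k d + (ht k d)\<^sup>2" for d
    proof -
      have hi: "ht i d = - ht j d - ht k d" using ht_sum[OF id, of d] by linarith
      show ?thesis unfolding power_mult_distrib ht_norm[OF id] hi by (simp add: power_divide power2_eq_square algebra_simps)
    qed
    have "(sqrt 3 / 2 * norm (v - u))\<^sup>2 \<le> (P + Q)\<^sup>2"
      unfolding nm P_def[symmetric] Q_def[symmetric] using pos by (simp add: power2_eq_square algebra_simps)
    then have l1: "sqrt 3 / 2 * norm (v - u) \<le> P + Q" by (rule power2_le_imp_le) (use pos in simp)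
    have "(p + 3 * q)\<^sup>2 \<le> 9 * (p\<^sup>2 + p * q + q\<^sup>2)" using pos by (simp add: power2_eq_square algebra_simps)
    also have "\<dots> = (3 * (sqrt 3 / 2 * norm (w - u)))\<^sup>2"
      unfolding power_mult_distrib[of 3] nm p_def[symmetric] q_def[symmetric] by simp
    finally have l2: "p + 3 * q \<le> 3 * (sqrt 3 / 2 * norm (w - u))" by (rule power2_le_imp_le) simp
    have "ht k (w - v) - ht j (w - v) = (q - Q) + (P - p)"
      unfolding P_def Q_def p_def q_def by simp
    then have "sqrt 3 / 2 * (norm (v - u) + r) \<le> sqrt 3 / 2 * (3 * norm (w - u))"
      using l1 l2 r(2) PQ pos unfolding distrib_left by argo
    then have "norm (v - u) + r \<le> 3 * norm (w - u)" by (rule mult_left_le_imp_le) simp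
    then have "dist u v + r \<le> 3 * dist u w" by (simp add: dist_norm norm_minus_commute)
    then show ?thesis using walk_trans[OF e r(1)] by blast
  qed
qed

lemma G_6_spanner:
  assumes "vis u w"
  shows "\<exists>s. walk V G u w s \<and> s \<le> 6 * dist u w"
proof -
  obtain s where s: "walk V ginf u w s" "s \<le> 2 * dist u w" using ginf_2_spanner[OF assms] by blast
  have "\<exists>s. walk V G a b s \<and> s \<le> 3 * dist a b" if g: "ginf a b" for a b
  proof -
    obtain i where "cone_arc i a b \<or> cone_arc i b a" using g by (auto simp: ginf_def)
    then show ?thesis
    proof
      assume "cone_arc i b a"
      then show ?thesis by (rule arc_G_walk)
    next
      assume "cone_arc i a b"
      then obtain r where r: "walk V G b a r" "r \<le> 3 * dist b a" using arc_G_walk by blast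
      have "walk V G a b r" by (rule walk_sym[OF r(1) G_sym])
      then show ?thesis using r(2) by (auto simp: dist_commute)
    qed
  qed
  from walk_subst[OF s(1) this] obtain r where "walk V G u w r" "r \<le> 3 * s" by blast
  then show ?thesis using s(2) by (intro exI[of _ r]) auto
qed

end

section \<open>The graphs of the definitions\<close>

text \<open>The signed distance of \<open>z\<close> from the line in direction
  \<open>m * pi / 3\<close>; a cone is an intersection of two of the corresponding
  half-planes.\<close>

definition sixth :: "nat \<Rightarrow> complex \<Rightarrow> real" where
  "sixth m z = Im (z / cis (real m * pi / 3))"

lemma Im_div_cis: "Im (z / cis \<phi>) = Im z * cos \<phi> - Re z * sin \<phi>"
  by (simp add: divide_inverse)

lemma sixth_add_3: "sixth (m + 3) z = - sixth m z"
proof -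
  have "cis (real (m + 3) * pi / 3) = cis (real m * pi / 3) * cis pi"
    unfolding cis_mult by (simp add: add_divide_distrib distrib_right)
  then have "cis (real (m + 3) * pi / 3) = - cis (real m * pi / 3)" by simp
  then show ?thesis by (simp add: sixth_def)
qed

lemma sixth_ht:
  "sixth 0 z = ht 0 z" "sixth 1 z = - ht 2 z" "sixth 2 z = ht 1 z" "sixth 3 z = - ht 0 z"
  "sixth 4 z = ht 2 z" "sixth 5 z = - ht 1 z" "sixth 6 z = ht 0 z" "sixth 7 z = - ht 2 z"
proof -
  show 0: "sixth 0 z = ht 0 z" by (simp add: sixth_def ht_def)
  have "sixth 1 z = Im z * (1/2) - Re z * (sqrt 3 / 2)"
    unfolding sixth_def Im_div_cis of_nat_1 mult_1 cos_60 sin_60 ..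
  then show 1: "sixth 1 z = - ht 2 z" by (simp add: ht_def)
  have c: "cos (real 2 * pi / 3) = - (1/2)" "sin (real 2 * pi / 3) = sqrt 3 / 2"
    using cos_120 sin_120 by (simp_all add: mult.commute)
  have "sixth 2 z = Im z * - (1/2) - Re z * (sqrt 3 / 2)" unfolding sixth_def Im_div_cis c ..
  then show 2: "sixth 2 z = ht 1 z" by (simp add: ht_def)
  show 3: "sixth 3 z = - ht 0 z" and 4: "sixth 4 z = ht 2 z" and "sixth 5 z = - ht 1 z"
    using sixth_add_3[of 0 z] sixth_add_3[of 1 z] sixth_add_3[of 2 z] 0 1 2 by (simp_all add: eval_nat_numeral)
  show "sixth 6 z = ht 0 z" "sixth 7 z = - ht 2 z"
    using sixth_add_3[of 3 z] sixth_add_3[of 4 z] 3 4 by simp_all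
qed

text \<open>The imaginary part is a positive multiple of the sine of the argument, which lies in
  (-pi, pi]; the rotated copy tests the upper boundary of the sector. At 0 both sides fail.\<close>

lemma Arg_sector_iff:
  "z \<noteq> 0 \<and> 0 \<le> Arg z \<and> Arg z < pi / 3 \<longleftrightarrow> 0 \<le> Im z \<and> Im (z / cis (pi / 3)) < 0"
proof (cases "z = 0")
  case False
  define r \<theta> where "r = norm z" and "\<theta> = Arg z"
  have r: "r > 0" using False by (simp add: r_def)
  have z: "z = complex_of_real r * cis \<theta>" unfolding r_def \<theta>_def using rcis_cmod_Arg[of z] by (simp add: rcis_def)
  have th: "- pi < \<theta>" "\<theta> \<le> pi" using Arg_bounded[of z] by (auto simp: \<theta>_def)
  have i1: "Im z = r * sin \<theta>" unfolding z by simp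
  have "z / cis (pi / 3) = complex_of_real r * (cis \<theta> / cis (pi / 3))" unfolding z by simp
  also have "cis \<theta> / cis (pi / 3) = cis (\<theta> - pi / 3)" by (rule cis_divide)
  finally have i2: "Im (z / cis (pi / 3)) = r * sin (\<theta> - pi / 3)" by simp
  have s1: "0 \<le> sin \<theta> \<longleftrightarrow> 0 \<le> \<theta>"
  proof
    assume "0 \<le> \<theta>"
    then show "0 \<le> sin \<theta>" using th by (intro sin_ge_zero) auto
  next
    assume s: "0 \<le> sin \<theta>"
    show "0 \<le> \<theta>"
    proof (rule ccontr)
      assume "\<not> 0 \<le> \<theta>"
      then have "sin (- \<theta>) > 0" using th by (intro sin_gt_zero) auto
      then show False using s by simp
    qed
  qed
  have s2: "sin (\<theta> - pi / 3) < 0 \<longleftrightarrow> \<theta> < pi / 3" if "0 \<le> \<theta>"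
  proof
    assume "\<theta> < pi / 3"
    then have "sin (- (\<theta> - pi / 3)) > 0" using that pi_gt_zero by (intro sin_gt_zero) auto
    then show "sin (\<theta> - pi / 3) < 0" by (simp only: sin_minus neg_0_less_iff_less)
  next
    assume s: "sin (\<theta> - pi / 3) < 0"
    show "\<theta> < pi / 3"
    proof (rule ccontr)
      assume "\<not> \<theta> < pi / 3"
      then have "sin (\<theta> - pi / 3) \<ge> 0" using th by (intro sin_ge_zero) auto
      then show False using s by simp
    qed
  qed
  have "0 \<le> Im z \<longleftrightarrow> 0 \<le> \<theta>" unfolding i1 using r s1 by (simp add: zero_le_mult_iff)
  moreover have "Im (z / cis (pi / 3)) < 0 \<longleftrightarrow> sin (\<theta> - pi / 3) < 0"
    unfolding i2 using r by (simp add: mult_less_0_iff)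
  ultimately show ?thesis using s2 False unfolding \<theta>_def[symmetric] by blast
qed simp

lemma in_cone_iff: "in_cone i u v \<longleftrightarrow> i < 6 \<and> 0 \<le> sixth (i + 1) (v - u) \<and> sixth (i + 2) (v - u) < 0"
proof -
  let ?z = "(v - u) / cis (pi / 3 + real i * pi / 3)"
  have a: "pi / 3 + real i * pi / 3 = real (i + 1) * pi / 3" by (simp add: field_simps)
  have "cis (pi / 3 + real i * pi / 3) * cis (pi / 3) = cis (real (i + 2) * pi / 3)"
    unfolding cis_mult by (simp add: field_simps)
  then have z: "?z / cis (pi / 3) = (v - u) / cis (real (i + 2) * pi / 3)" by (simp only: divide_divide_eq_left)
  have e1: "Im ?z = sixth (i + 1) (v - u)" unfolding sixth_def a ..
  have e2: "Im (?z / cis (pi / 3)) = sixth (i + 2) (v - u)" unfolding sixth_def z ..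
  note e = e1 e2
  have "v \<noteq> u \<longleftrightarrow> ?z \<noteq> 0" by simp
  then show ?thesis unfolding in_cone_def e[symmetric] using Arg_sector_iff[of ?z] by blast
qed

text \<open>The bisector is the direction \<open>i * pi / 3\<close> turned by a quarter, and
  dividing by \<open>\<i>\<close> turns the imaginary part into the real part.\<close>

lemma cone_proj_sixth: "cone_proj i u v = sixth i (v - u)"
proof -
  have "cis (pi / 2 + real i * pi / 3) = \<i> * cis (real i * pi / 3)" by (simp flip: cis_mult)
  moreover have "x / (\<i> * c) = - \<i> * (x / c)" for x c :: complex
    by (simp add: divide_inverse)
  ultimately have "(v - u) / cis (pi / 2 + real i * pi / 3) = - \<i> * ((v - u) / cis (real i * pi / 3))"
    by (simp only:)
  then show ?thesis unfolding cone_proj_def sixth_def by (simp only: Re_i_times minus_mult_left[symmetric] uminus_complex.sel minus_minus)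
qed

text \<open>The index of the positive cone that cone \<open>i\<close> is equal or opposite to.\<close>

definition cone_class :: "nat \<Rightarrow> nat" where
  "cone_class i = (if i = 0 \<or> i = 3 then 0 else if i = 2 \<or> i = 5 then 1 else 2)"

lemma cone_proj_ht:
  assumes "i < 6"
  shows "cone_proj i u v = (if even i then ht (cone_class i) (v - u) else - ht (cone_class i) (v - u))"
proof -
  consider "i = 0" | "i = 1" | "i = 2" | "i = 3" | "i = 4" | "i = 5" using assms by linarith
  then show ?thesis unfolding cone_proj_sixth by cases (simp_all only: sixth_ht cone_class_def, simp_all)
qed

lemma cone_class_surj:
  assumes "k < 3"
  obtains i i' where "i < 6" "even i" "cone_class i = k" "i' < 6" "odd i'" "cone_class i' = k"
proof -
  consider "k = 0" | "k = 1" | "k = 2" using assms by linarith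
  then show thesis
  proof cases
    case 1 then show thesis using that[of 0 3] by (simp add: cone_class_def)
  next
    case 2 then show thesis using that[of 2 5] by (simp add: cone_class_def)
  next
    case 3 then show thesis using that[of 4 1] by (simp add: cone_class_def)
  qed
qed

context polygon_scene
begin

text \<open>General position keeps vertices off the cone boundaries, where the half-open cone and
  the open cone \<open>pos\<close> would differ.\<close>

lemma in_cone_pos:
  assumes i: "i < 6" and V: "u \<in> V" "v \<in> V" "u \<noteq> v"
  shows "in_cone i u v \<longleftrightarrow> (if even i then pos (cone_class i) (v - u) else pos (cone_class i) (u - v))"
proof -
  have n: "ht 0 u \<noteq> ht 0 v" "ht 1 u \<noteq> ht 1 v" "ht 2 u \<noteq> ht 2 v" using gen_pos_ht[OF V] by simp_all
  have id: "idx 0 1 2" "idx 1 0 2" "idx 2 0 1" by (simp_all add: idx_def)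
  note p = pos_idx[OF id(1)] pos_idx[OF id(2)] pos_idx[OF id(3)]
  have s: "0 + 1 = (1::nat)" "0 + 2 = (2::nat)" "1 + 1 = (2::nat)" "1 + 2 = (3::nat)" "2 + 1 = (3::nat)" "2 + 2 = (4::nat)"
    "3 + 1 = (4::nat)" "3 + 2 = (5::nat)" "4 + 1 = (5::nat)" "4 + 2 = (6::nat)" "5 + 1 = (6::nat)" "5 + 2 = (7::nat)"
    by simp_all
  have cc: "cone_class 0 = 0" "cone_class 1 = 2" "cone_class 2 = 1" "cone_class 3 = 0" "cone_class 4 = 2" "cone_class 5 = 1"
    by (simp_all add: cone_class_def)
  have ev: "even (0::nat)" "odd (1::nat)" "even (2::nat)" "odd (3::nat)" "even (4::nat)" "odd (5::nat)" by simp_all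
  consider "i = 0" | "i = 1" | "i = 2" | "i = 3" | "i = 4" | "i = 5" using i by linarith
  then show ?thesis
  proof cases
    case 1 show ?thesis unfolding in_cone_iff 1 s sixth_ht cc p ht_diff using n ev by auto
  next
    case 2 show ?thesis unfolding in_cone_iff 2 s sixth_ht cc p ht_diff using n ev by auto
  next
    case 3 show ?thesis unfolding in_cone_iff 3 s sixth_ht cc p ht_diff using n ev by auto
  next
    case 4 show ?thesis unfolding in_cone_iff 4 s sixth_ht cc p ht_diff using n ev by auto
  next
    case 5 show ?thesis unfolding in_cone_iff 5 s sixth_ht cc p ht_diff using n ev by auto
  next
    case 6 show ?thesis unfolding in_cone_iff 6 s sixth_ht cc p ht_diff using n ev by auto
  qed
qed

lemma same_subcone_iff:
  assumes "i < 6"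
  shows "same_subcone V S i u v w \<longleftrightarrow> vis u v \<and> vis u w \<and> \<not> splits S u v w \<and>
    (if even i then pos (cone_class i) (v - u) \<and> pos (cone_class i) (w - u)
     else pos (cone_class i) (u - v) \<and> pos (cone_class i) (u - w))"
proof -
  have "in_cone i u x \<longleftrightarrow> (if even i then pos (cone_class i) (x - u) else pos (cone_class i) (u - x))" if "vis u x" for x
    using in_cone_pos[OF assms, of u x] that by (simp add: vis_def)
  then show ?thesis unfolding same_subcone_def vis_edge_iff by auto
qed

lemma ginf_arc_iff: "ginf_arc V S u v \<longleftrightarrow> (\<exists>k. cone_arc k u v)"
proof
  assume "ginf_arc V S u v"
  then obtain i where i: "i < 6" "even i" "same_subcone V S i u v v"
    and m: "\<forall>w. same_subcone V S i u v w \<longrightarrow> cone_proj i u v \<le> cone_proj i u w"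
    unfolding ginf_arc_def by blast
  have "cone_arc (cone_class i) u v" unfolding cone_arc_def
  proof (intro conjI allI impI)
    show "vis u v" "pos (cone_class i) (v - u)" using i same_subcone_iff[OF i(1)] by auto
    fix w assume "vis u w \<and> pos (cone_class i) (w - u) \<and> \<not> splits S u v w"
    then have "same_subcone V S i u v w" using i(2,3) unfolding same_subcone_iff[OF i(1)] by auto
    then show "ht (cone_class i) v \<le> ht (cone_class i) w" using m cone_proj_ht[OF i(1)] i(2) by auto
  qed
  then show "\<exists>k. cone_arc k u v" ..
next
  assume "\<exists>k. cone_arc k u v"
  then obtain k where k: "cone_arc k u v" ..
  then have "k < 3" by (auto simp: cone_arc_def pos_def)
  then obtain i where i: "i < 6" "even i" "cone_class i = k" using cone_class_surj by metis
  have "same_subcone V S i u v v" unfolding same_subcone_iff[OF i(1)]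
    using k i not_splits_vis by (auto simp: cone_arc_def)
  moreover have "cone_proj i u v \<le> cone_proj i u w" if "same_subcone V S i u v w" for w
    using that k i unfolding same_subcone_iff[OF i(1)] cone_arc_def cone_proj_ht[OF i(1)] by auto
  ultimately show "ginf_arc V S u v" unfolding ginf_arc_def using i by blast
qed

lemma ginf_adj_neg:
  assumes "pos k (u - v)"
  shows "ginf_adj V S u v \<longleftrightarrow> cone_arc k v u"
proof
  assume "ginf_adj V S u v"
  then obtain m where "cone_arc m u v \<or> cone_arc m v u" unfolding ginf_adj_def ginf_arc_iff by blast
  moreover have "\<not> cone_arc m u v" using pos_opposite[OF assms, of m] by (auto simp: cone_arc_def)
  ultimately have a: "cone_arc m v u" by blast
  then have "m = k" using pos_unique[OF arc_pos[OF a] assms] by simp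
  then show "cone_arc k v u" using a by simp
next
  assume "cone_arc k v u"
  then show "ginf_adj V S u v" unfolding ginf_adj_def ginf_arc_iff by blast
qed

text \<open>The projection onto the bisector of a negative cone is the negated height, so the
  closest neighbour is the one of greatest height.\<close>

lemma g10_closest_iff:
  assumes i: "i < 6" "odd i"
  shows "g10_closest V S i u v \<longleftrightarrow> closest (cone_class i) u v"
proof -
  let ?k = "cone_class i"
  have sub: "ginf_adj V S u w \<and> same_subcone V S i u v w \<longleftrightarrow> vis u v \<and> pos ?k (u - v) \<and> cone_arc ?k w u \<and> \<not> splits S u v w" for w
    using i(2) ginf_adj_neg[of ?k u w] arc_pos[of ?k w u] arc_vis[of ?k w u] vis_sym[of u w]
    unfolding same_subcone_iff[OF i(1)] by auto
  have "g10_closest V S i u v \<longleftrightarrow> (ginf_adj V S u v \<and> same_subcone V S i u v v) \<and>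
     (\<forall>w. ginf_adj V S u w \<and> same_subcone V S i u v w \<longrightarrow> cone_proj i u v \<le> cone_proj i u w)"
    unfolding g10_closest_def using i by auto
  also have "\<dots> \<longleftrightarrow> cone_arc ?k v u \<and> (\<forall>w. cone_arc ?k w u \<and> \<not> splits S u v w \<longrightarrow> cone_proj i u v \<le> cone_proj i u w)"
    unfolding sub using arc_pos[of ?k v u] arc_vis[of ?k v u] vis_sym[of u v] not_splits_vis[of u v] by blast
  also have "\<dots> \<longleftrightarrow> closest ?k u v"
    unfolding closest_def cone_proj_ht[OF i(1)] using i(2) by auto
  finally show ?thesis .
qed

text \<open>By Cramer's rule, coming counterclockwise after \<open>v\<close> and before
  \<open>w\<close> amounts to positive coordinates along \<open>v - u\<close> and
  \<open>w - u\<close>.\<close>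

lemma canon_consec_iff:
  assumes i: "i < 6" "odd i"
  shows "canon_consec V S i u v w \<longleftrightarrow> consec (cone_class i) u v w \<and> ccw u v w"
proof -
  let ?k = "cone_class i"
  have ccw: "ccw a b c \<longleftrightarrow> cr (b - a) (c - a) > 0" for a b c by (simp add: ccw_def cr_def)
  have vs: "cone_arc ?k x u \<Longrightarrow> vis u x \<and> pos ?k (u - x)" for x using arc_pos arc_vis vis_sym by blast
  have sub: "ginf_adj V S u x \<and> same_subcone V S i u v x \<longleftrightarrow> cone_arc ?k x u \<and> \<not> splits S u v x" if "cone_arc ?k v u" for x
    using i(2) ginf_adj_neg[of ?k u x] vs[of x] vs[OF that] unfolding same_subcone_iff[OF i(1)] by auto
  have head: "ginf_adj V S u v \<and> ginf_adj V S u w \<and> same_subcone V S i u v w \<longleftrightarrow>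
      cone_arc ?k v u \<and> cone_arc ?k w u \<and> \<not> splits S u v w"
    using i(2) ginf_adj_neg[of ?k u v] ginf_adj_neg[of ?k u w] vs[of v] vs[of w]
    unfolding same_subcone_iff[OF i(1)] by auto
  have between: "(\<exists>x. ginf_adj V S u x \<and> same_subcone V S i u v x \<and> ccw u v x \<and> ccw u x w) \<longleftrightarrow>
     (\<exists>x \<alpha> \<beta>. cone_arc ?k x u \<and> \<alpha> > 0 \<and> \<beta> > 0 \<and> x - u = \<alpha> *\<^sub>R (v - u) + \<beta> *\<^sub>R (w - u))"
    if a: "cone_arc ?k v u" "\<not> splits S u v w" "ccw u v w"
  proof
    assume "\<exists>x. ginf_adj V S u x \<and> same_subcone V S i u v x \<and> ccw u v x \<and> ccw u x w"
    then obtain x where x: "cone_arc ?k x u" "cr (v - u) (x - u) > 0" "cr (x - u) (w - u) > 0"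
      using sub[OF a(1)] unfolding ccw by blast
    have vw: "cr (v - u) (w - u) > 0" using a(3) unfolding ccw .
    then have "x - u = (cr (x - u) (w - u) / cr (v - u) (w - u)) *\<^sub>R (v - u) + (cr (v - u) (x - u) / cr (v - u) (w - u)) *\<^sub>R (w - u)"
      by (intro cr_expand) simp
    moreover have "cr (x - u) (w - u) / cr (v - u) (w - u) > 0" "cr (v - u) (x - u) / cr (v - u) (w - u) > 0"
      using x vw by simp_all
    ultimately show "\<exists>x \<alpha> \<beta>. cone_arc ?k x u \<and> \<alpha> > 0 \<and> \<beta> > 0 \<and> x - u = \<alpha> *\<^sub>R (v - u) + \<beta> *\<^sub>R (w - u)"
      using x(1) by blast
  next
    assume "\<exists>x \<alpha> \<beta>. cone_arc ?k x u \<and> \<alpha> > 0 \<and> \<beta> > 0 \<and> x - u = \<alpha> *\<^sub>R (v - u) + \<beta> *\<^sub>R (w - u)"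
    then obtain x \<alpha> \<beta> where x: "cone_arc ?k x u" "\<alpha> > 0" "\<beta> > 0" "x - u = \<alpha> *\<^sub>R (v - u) + \<beta> *\<^sub>R (w - u)" by blast
    have vw: "cr (v - u) (w - u) > 0" using a(3) unfolding ccw .
    have "\<not> splits S u v x" using splits_mono[of S u v x \<alpha> \<beta> w] x a(2) by auto
    moreover have "ccw u v x" "ccw u x w" unfolding ccw x(4) using x vw by simp_all
    ultimately show "\<exists>x. ginf_adj V S u x \<and> same_subcone V S i u v x \<and> ccw u v x \<and> ccw u x w"
      using sub[OF a(1)] x(1) by blast
  qed
  have ne: "v \<noteq> w" if "ccw u v w" using that unfolding ccw by auto
  have "canon_consec V S i u v w \<longleftrightarrow> (ginf_adj V S u v \<and> ginf_adj V S u w \<and> same_subcone V S i u v w) \<and> ccw u v w \<and>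
     \<not> (\<exists>x. ginf_adj V S u x \<and> same_subcone V S i u v x \<and> ccw u v x \<and> ccw u x w)"
    unfolding canon_consec_def using i by blast
  also have "\<dots> \<longleftrightarrow> consec ?k u v w \<and> ccw u v w"
    unfolding head consec_def using between ne by blast
  finally show ?thesis .
qed

text \<open>\<open>consec\<close> carries no orientation; since \<open>u\<close>, \<open>x\<close>
  and \<open>y\<close> are not collinear, one order of \<open>x\<close> and \<open>y\<close> is
  counterclockwise, and \<open>g10\<close> admits both.\<close>

lemma g10_iff: "g10 V S x y \<longleftrightarrow> G x y"
proof
  assume "g10 V S x y"
  then obtain u i where h: "g10_closest V S i x y \<or> g10_closest V S i y x \<or>
      canon_consec V S i u x y \<or> canon_consec V S i u y x" unfolding g10_def by blast
  have i: "i < 6" "odd i" using h by (auto simp: g10_closest_def canon_consec_def)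
  show "G x y" using h consec_sym unfolding g10_closest_iff[OF i] canon_consec_iff[OF i] G_def by blast
next
  assume "G x y"
  then obtain k where k: "closest k x y \<or> closest k y x \<or> (\<exists>u. consec k u x y)" unfolding G_def by blast
  have "k < 3" using k by (auto simp: closest_def consec_def cone_arc_def pos_def)
  then obtain i where i: "i < 6" "odd i" "cone_class i = k" using cone_class_surj by metis
  have "canon_consec V S i u x y \<or> canon_consec V S i u y x" if c: "consec k u x y" for u
  proof -
    have "u \<in> V" "x \<in> V" "y \<in> V" "x \<noteq> y" "u \<noteq> x" "u \<noteq> y" using c by (auto simp: consec_def cone_arc_def vis_def)
    then have "cr (x - u) (y - u) \<noteq> 0" using noncollinear by blast
    then have "ccw u x y \<or> ccw u y x"
      using cr_commute[of "x - u" "y - u"] unfolding ccw_def cr_def[symmetric] by linarith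
    then show ?thesis using c consec_sym[OF c] i unfolding canon_consec_iff[OF i(1,2)] by blast
  qed
  then show "g10 V S x y" using k i(3) unfolding g10_def g10_closest_iff[OF i(1,2), symmetric, unfolded i(3)] by blast
qed

end

theorem theorem14:
  fixes V :: "complex set" and S :: "complex list set"
  assumes "scene V S"
  shows "(\<forall>x y. g10 V S x y \<longrightarrow> vis_edge V S x y) \<and>
         plane_graph (g10 V S) \<and>
         is_spanner V (vis_edge V S) (g10 V S) 6 \<and>
         (\<forall>u\<in>V. card {v. g10 V S u v} \<le> 10)"
proof -
  interpret polygon_scene V S using assms by (rule polygon_scene.intro)
  have g: "g10 V S = G" by (intro ext) (rule g10_iff)
  have "\<forall>x y. G x y \<longrightarrow> vis_edge V S x y"
    using G_star star_vis vis_edge_iff by blast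
  moreover have "plane_graph G" unfolding plane_graph_def
    using star_plane[OF G_star G_star] by blast
  moreover have "is_spanner V (vis_edge V S) G 6" unfolding is_spanner_def
  proof (intro allI impI)
    fix xs assume xs: "gpath V (vis_edge V S) xs"
    have "\<exists>r. walk V G x y r \<and> r \<le> 6 * dist x y" if "vis_edge V S x y" for x y
      using that G_6_spanner vis_edge_iff by blast
    from gpath_walk[OF xs this] obtain r where "walk V G (hd xs) (last xs) r" "r \<le> 6 * path_len xs" by blast
    then show "\<exists>ys. gpath V G ys \<and> hd ys = hd xs \<and> last ys = last xs \<and> path_len ys \<le> 6 * path_len xs"
      using walk_gpath by metis
  qed
  ultimately show ?thesis unfolding g using degree_G by blast
qed

end
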